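(* Let $\lambda_0$ be the positive root of the polynomial $X^3-X^2-2X-4$ and let $\alpha_0=\frac{\log 2}{\log\lambda_0}$ ($\approx 0.7674$). Let $G=G_{012}$ be the first Grigorchuk group with generating set $S=\{a,b,c,d\}$. For any $\epsilon>0$ there exist a constant $C_\epsilon>0$ and a non-degenerate symmetric probability measure $\mu$ on $G$ of finite entropy and non-trivial Poisson boundary such that for all $r\ge 1$, $$\mu\left(\{g\in G:\ l_S(g)\ge r\}\right)\le C_\epsilon r^{-\alpha_0+\epsilon}.$$ As a consequence, for any $\epsilon>0$ there exists a constant $c_\epsilon>0$ such that for all $n\ge 1$, $$v_{G,S}(n)\ge \exp\left(c_\epsilon n^{\alpha_0-\epsilon}\right).$$
   Context: First Grigorchuk group: the rooted binary tree has the finite words over $\{0,1\}$ as vertices. Its automorphism group acts from the right ($x\cdot g$, and $gh$ means first $g$, then $h$). An automorphism is written $g=(g_0,g_1)\tau$ with $\tau$ a permutation of $\{0,1\}$, meaning $(iw)\cdot g=(i\cdot\tau)(w\cdot g_i)$ for $i\in\{0,1\}$ and any word $w$. Let $\varepsilon$ be the transposition of $0$ and $1$. The automorphisms $a,b,c,d$ are defined by $a=(id,id)\varepsilon$, $b=(a,c)$, $c=(a,d)$, $d=(id,b)$ (recursively), and $G=G_{012}$ is the group generated by $S=\{a,b,c,d\}$. For a group $\Gamma$ with finite generating set $S$, $l_S(\gamma)$ is the word length of $\gamma$ with respect to $S\cup S^{-1}$, and $v_{\Gamma,S}(n)=\#\{\gamma\in\Gamma: l_S(\gamma)\le n\}$.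 A probability measure $\mu$ on $\Gamma$ is non-degenerate if its support generates $\Gamma$ as a semigroup, and symmetric if $\mu(g)=\mu(g^{-1})$ for all $g$. Its (Shannon) entropy is $H(\mu)=-\sum_g\mu(g)\log\mu(g)$. A function $f:\Gamma\to\mathbb{R}$ is $\mu$-harmonic if $f(x)=\sum_{y\in\Gamma}f(xy)\mu(y)$ for all $x$. The Poisson boundary of $(\Gamma,\mu)$ is non-trivial if there is a non-constant bounded $\mu$-harmonic function on $\Gamma$. *)

theory Defs
  imports "HOL-Probability.Probability" "HOL-Algebra.Elementary_Groups"
begin

definition word_length :: "('g, 'm) monoid_scheme \<Rightarrow> 'g set \<Rightarrow> 'g \<Rightarrow> nat" where
  "word_length \<Gamma> S g =
     (LEAST n. \<exists>ws. length ws = n \<and> set ws \<subseteq> S \<union> m_inv \<Gamma> ` S \<and> foldr (mult \<Gamma>) ws (one \<Gamma>) = g)"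

definition growth :: "('g, 'm) monoid_scheme \<Rightarrow> 'g set \<Rightarrow> nat \<Rightarrow> nat" where
  "growth \<Gamma> S n = card {g \<in> carrier \<Gamma>. word_length \<Gamma> S g \<le> n}"

text \<open>A probability measure on a (discrete) group is a \<^typ>\<open>'g pmf\<close> supported in its carrier.\<close>

definition nondegenerate :: "('g, 'm) monoid_scheme \<Rightarrow> 'g pmf \<Rightarrow> bool" where
  "nondegenerate \<Gamma> \<mu> \<longleftrightarrow>
     {foldr (mult \<Gamma>) ws (one \<Gamma>) | ws. ws \<noteq> [] \<and> set ws \<subseteq> set_pmf \<mu>} = carrier \<Gamma>"

definition symmetric_measure :: "('g, 'm) monoid_scheme \<Rightarrow> 'g pmf \<Rightarrow> bool" where
  "symmetric_measure \<Gamma> \<mu> \<longleftrightarrow> (\<forall>g\<in>carrier \<Gamma>. pmf \<mu> g = pmf \<mu> (m_inv \<Gamma> g))"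

text \<open>All summands are nonnegative, so the sum always makes sense with values in \<open>[0, \<infinity>]\<close>.\<close>

definition shannon_entropy :: "('g, 'm) monoid_scheme \<Rightarrow> 'g pmf \<Rightarrow> ennreal" where
  "shannon_entropy \<Gamma> \<mu> = (\<Sum>\<^sub>\<infinity>g\<in>carrier \<Gamma>. ennreal (- (pmf \<mu> g * ln (pmf \<mu> g))))"

definition harmonic :: "('g, 'm) monoid_scheme \<Rightarrow> 'g pmf \<Rightarrow> ('g \<Rightarrow> real) \<Rightarrow> bool" where
  "harmonic \<Gamma> \<mu> f \<longleftrightarrow>
     (\<forall>x\<in>carrier \<Gamma>. ((\<lambda>y. f (mult \<Gamma> x y) * pmf \<mu> y) has_sum f x) (carrier \<Gamma>))"

definition nontrivial_Poisson_boundary :: "('g, 'm) monoid_scheme \<Rightarrow> 'g pmf \<Rightarrow> bool" where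
  "nontrivial_Poisson_boundary \<Gamma> \<mu> \<longleftrightarrow>
     (\<exists>f. harmonic \<Gamma> \<mu> f \<and> bounded (f ` carrier \<Gamma>) \<and> \<not> f constant_on carrier \<Gamma>)"

text \<open>
  The letters 0 and 1 are \<^term>\<open>False\<close> and \<^term>\<open>True\<close>; the root is the empty word.
  Automorphisms act from the right: \<open>x \<cdot> g\<close> is the application \<open>g x\<close>, and in the product
  \<open>g h\<close> the factor \<open>g\<close> is applied first.
\<close>

definition tree_adj :: "bool list \<Rightarrow> bool list \<Rightarrow> bool" where
  "tree_adj u v \<longleftrightarrow> (\<exists>x. v = u @ [x] \<or> u = v @ [x])"

definition tree_Aut :: "(bool list \<Rightarrow> bool list) monoid" where
  "tree_Aut =
    \<lparr>carrier = {g. bij g \<and> g [] = [] \<and> (\<forall>u v. tree_adj (g u) (g v) \<longleftrightarrow> tree_adj u v)},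
     mult = (\<lambda>g h. h \<circ> g),
     one = id\<rparr>"

text \<open>\<open>wreath g0 g1 \<tau>\<close> is the map written \<open>(g\<^sub>0, g\<^sub>1)\<tau>\<close>.\<close>

fun wreath :: "(bool list \<Rightarrow> bool list) \<Rightarrow> (bool list \<Rightarrow> bool list) \<Rightarrow> (bool \<Rightarrow> bool)
    \<Rightarrow> bool list \<Rightarrow> bool list" where
  "wreath g0 g1 \<tau> [] = []"
| "wreath g0 g1 \<tau> (i # w) = \<tau> i # (if i then g1 else g0) w"

definition grig_a :: "bool list \<Rightarrow> bool list" where
  "grig_a = wreath id id Not"

fun grig_b grig_c grig_d :: "bool list \<Rightarrow> bool list" where
  "grig_b [] = []"
| "grig_b (i # w) = i # (if i then grig_c w else grig_a w)"
| "grig_c [] = []"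
| "grig_c (i # w) = i # (if i then grig_d w else grig_a w)"
| "grig_d [] = []"
| "grig_d (i # w) = i # (if i then grig_b w else w)"

lemma grig_b_eq: "grig_b = wreath grig_a grig_c id"
  and grig_c_eq: "grig_c = wreath grig_a grig_d id"
  and grig_d_eq: "grig_d = wreath id grig_b id"
proof -
  have "grig_b w = wreath grig_a grig_c id w \<and> grig_c w = wreath grig_a grig_d id w
      \<and> grig_d w = wreath id grig_b id w" for w
    by (cases w) auto
  then show "grig_b = wreath grig_a grig_c id" "grig_c = wreath grig_a grig_d id"
    "grig_d = wreath id grig_b id" by auto
qed

definition grig_gens :: "(bool list \<Rightarrow> bool list) set" where
  "grig_gens = {grig_a, grig_b, grig_c, grig_d}"

definition Grigorchuk :: "(bool list \<Rightarrow> bool list) monoid" where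
  "Grigorchuk = subgroup_generated tree_Aut grig_gens"

text \<open>
  \<^const>\<open>subgroup_generated\<close> discards generators outside the carrier of the ambient group;
  the following facts show that nothing is discarded here.
\<close>

lemma group_tree_Aut: "group tree_Aut"
proof (rule groupI)
  fix g assume g: "g \<in> carrier tree_Aut"
  then have b: "bij g" by (simp add: tree_Aut_def)
  have "inv_into UNIV g \<in> carrier tree_Aut"
    using g b by (auto simp: tree_Aut_def bij_imp_bij_inv inv_f_eq bij_is_inj)
      (metis bij_inv_eq_iff)+
  moreover have "inv_into UNIV g \<otimes>\<^bsub>tree_Aut\<^esub> g = \<one>\<^bsub>tree_Aut\<^esub>"
    using b by (simp add: tree_Aut_def fun_eq_iff bij_is_surj surj_f_inv_f)
  ultimately show "\<exists>h\<in>carrier tree_Aut. h \<otimes>\<^bsub>tree_Aut\<^esub> g = \<one>\<^bsub>tree_Aut\<^esub>" by blast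
qed (auto simp: tree_Aut_def bij_comp comp_assoc)

lemma tree_adj_Cons: "tree_adj (i # u) (j # v) \<longleftrightarrow> i = j \<and> tree_adj u v"
  by (auto simp: tree_adj_def)

lemma tree_adj_Nil:
  "tree_adj [] v \<longleftrightarrow> length v = 1" "tree_adj v [] \<longleftrightarrow> length v = 1"
  by (auto simp: tree_adj_def length_Suc_conv)

lemma involution_in_tree_Aut:
  assumes inv: "\<And>w. g (g w) = w" and len: "\<And>w. length (g w) = length w"
    and adj: "\<And>u v. tree_adj u v \<Longrightarrow> tree_adj (g u) (g v)"
  shows "g \<in> carrier tree_Aut"
proof -
  have "bij g" by (rule o_bij[of g]) (auto simp: inv)
  moreover have "g [] = []" using len[of "[]"] by simp
  moreover have "tree_adj (g u) (g v) \<longleftrightarrow> tree_adj u v" for u v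
    using adj[of u v] adj[of "g u" "g v"] by (auto simp: inv)
  ultimately show ?thesis by (simp add: tree_Aut_def)
qed

lemma grig_a_simps: "grig_a [] = []" "grig_a (i # w) = (\<not> i) # w"
  by (auto simp: grig_a_def)

lemma length_grig:
  "length (grig_a w) = length w"
  "length (grig_b w) = length w" "length (grig_c w) = length w" "length (grig_d w) = length w"
proof -
  show a: "length (grig_a w) = length w" for w by (cases w) (auto simp: grig_a_simps)
  show "length (grig_b w) = length w" "length (grig_c w) = length w" "length (grig_d w) = length w"
    by (induction w) (auto simp: a)
qed

lemma grig_involution:
  "grig_a (grig_a w) = w" "grig_b (grig_b w) = w" "grig_c (grig_c w) = w" "grig_d (grig_d w) = w"
proof -
  show a: "grig_a (grig_a w) = w" for w by (cases w) (auto simp: grig_a_simps)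
  show "grig_b (grig_b w) = w" "grig_c (grig_c w) = w" "grig_d (grig_d w) = w"
    by (induction w) (auto simp: a)
qed

lemma tree_adj_grig_a: "tree_adj u v \<Longrightarrow> tree_adj (grig_a u) (grig_a v)"
  by (cases u; cases v) (auto simp: grig_a_simps tree_adj_Cons tree_adj_Nil)

lemma tree_adj_grig_bcd:
  "tree_adj u v \<Longrightarrow> tree_adj (grig_b u) (grig_b v) \<and> tree_adj (grig_c u) (grig_c v)
     \<and> tree_adj (grig_d u) (grig_d v)"
proof (induction u arbitrary: v)
  case Nil
  then show ?case by (simp add: tree_adj_Nil length_grig grig_a_simps)
next
  case (Cons i u)
  show ?case
  proof (cases v)
    case Nil
    then show ?thesis using Cons.prems by (simp add: tree_adj_Nil length_grig grig_a_simps)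
  next
    case (Cons j v')
    then show ?thesis using Cons.prems Cons.IH[of v']
      by (auto simp: tree_adj_Cons tree_adj_grig_a grig_a_simps)
  qed
qed

lemma grig_gens_subset: "grig_gens \<subseteq> carrier tree_Aut"
  by (auto simp: grig_gens_def intro!: involution_in_tree_Aut
      simp: grig_involution length_grig tree_adj_grig_a tree_adj_grig_bcd)

lemma carrier_Grigorchuk: "carrier Grigorchuk = generate tree_Aut grig_gens"
  using grig_gens_subset
  by (simp add: Grigorchuk_def carrier_subgroup_generated Int_absorb1)

definition lambda0 :: real where
  "lambda0 = (THE x. x > 0 \<and> poly [:-4, -2, -1, 1:] x = 0)"

lemma lambda0_ex1: "\<exists>!x::real. x > 0 \<and> poly [:-4, -2, -1, 1:] x = 0"
proof -
  let ?p = "[:-4, -2, -1, 1:] :: real poly"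
  have "\<exists>x. 2 < x \<and> x < 3 \<and> poly ?p x = 0"
    by (rule poly_IVT_pos) auto
  then obtain x where x: "2 < x" "poly ?p x = 0" by auto
  have pos: "poly ?p z / z = z^2 - z - 2 - 4 / z" if "z > 0" for z :: real
    using that by (simp add: field_simps power2_eq_square)
  have uniq: "y = z" if "y > 0" "poly ?p y = 0" "z > 0" "poly ?p z = 0" for y z :: real
  proof (rule ccontr)
    have less: False if yz: "0 < y" "y < z" "poly ?p y = 0" "poly ?p z = 0" for y z :: real
    proof -
      have y: "y^2 - y - 2 = 4 / y" and z: "z^2 - z - 2 = 4 / z"
        using pos[of y] pos[of z] yz by auto
      have "(y + 1) * (y - 2) > 0"
        using y yz by (simp add: power2_eq_square algebra_simps)
      then have "y > 2" using yz by (simp add: zero_less_mult_iff)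
      then have "(z - y) * (z + y - 1) > 0" using yz by (intro mult_pos_pos) auto
      then have "z^2 - z - 2 > y^2 - y - 2" by (simp add: power2_eq_square algebra_simps)
      moreover have "4 / z < 4 / y" using yz by (simp add: frac_less2)
      ultimately show False using y z by simp
    qed
    assume "y \<noteq> z"
    then show False using less[of y z] less[of z y] that by fastforce
  qed
  show ?thesis using x uniq by (intro ex1I[of _ x]) auto
qed

definition alpha0 :: real where
  "alpha0 = ln 2 / ln lambda0"

end

theory Submission
  imports Defs
begin

text \<open>
  Both assertions follow from one explicit family of random products, and the growth bound is
  derived from it directly, without the entropy criterion for the Poisson boundary.

  \<^bold>\<open>Lamps.\<close> Call a vertex active for an automorphism \<open>g\<close> if \<open>g\<close> exchanges the two children below
  it. Activity is a cocycle (\<open>active_append\<close>). On a level \<open>K > 0\<close> divisible by 3 the generators \<open>a\<close> and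
  \<open>b\<close> have no active vertex, while \<open>c\<close> and \<open>d\<close> have exactly one, the vertex \<open>o = 1\<dots>10\<close>
  (\<open>letter_active_level\<close>). So whether \<open>v\<close> is active for a word counts, modulo 2, the times at which
  the trajectory of \<open>v\<close> meets a letter \<open>c\<close> or \<open>d\<close> at \<open>o\<close>: every word carries a configuration of
  lamps, and it touches the lamps at its active vertices. For \<open>v = o\<close> and \<open>K \<rightarrow> \<infinity>\<close> the lamp is the
  germ of \<open>g\<close> at \<open>1\<^sup>\<infinity>\<close> modulo the germ of \<open>b\<close>.

  \<^bold>\<open>Balanced lifts.\<close> Let the substitution \<open>b \<mapsto> bdc\<close>, \<open>c \<mapsto> bb\<close>, \<open>d \<mapsto> cc\<close> act on the letters \<open>x\<^sub>i\<close>
  of \<open>w = a x\<^sub>1 a x\<^sub>2 \<dots> a x\<^sub>k\<close>. If \<open>b\<close> occurs an even number of times, the new word represents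
  \<open>(a w a, w)\<close> (\<open>word_map_alternating_lift\<close>), and a suitable weight of the word is multiplied by
  exactly \<open>\<lambda>\<^sub>0\<close> (\<open>word_weight_lift_letter\<close>). The \<open>m\<close>-fold lift of \<open>ac\<close> or \<open>ad\<close> keeps the first \<open>m\<close>
  digits of every vertex, flips the next one, and has length at most \<open>\<lambda>\<^sub>0\<close> to the power \<open>m + 1\<close>. Its
  sections at level \<open>m\<close> are \<open>ac\<close> or \<open>ad\<close> up to inversion, and taking \<open>c\<close> for \<open>m \<equiv> 1\<close> and \<open>d\<close> for
  \<open>m \<equiv> 2\<close> modulo 3 makes all germs below them germs of \<open>b\<close>. Hence these lifts do not touch any lamp;
  those with \<open>m \<equiv> 0\<close> touch at most \<open>2\<^sup>m\<close> of them (\<open>card_active_set_flip_word\<close>).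

  \<^bold>\<open>Scales.\<close> Fix \<open>L\<close>. At scale \<open>n\<close>, multiply the lifts for all \<open>m < 3(L+1)n\<close> with \<open>m \<noteq> 0\<close> modulo 3 and
  for all \<open>m < 3Ln\<close> with \<open>m \<equiv> 0\<close>, each with an independent exponent 0 or 1. This product sends a
  vertex of a deep level to any prescribed one with probability at most \<open>2\<close> to the power \<open>-(3L+2)n\<close>, touches at most
  \<open>2\<close> to the power \<open>3Ln\<close> lamps, and has length of order \<open>\<lambda>\<^sub>0\<close> to the power \<open>3(L+1)n\<close>. Choose the
  scale with probability proportional to \<open>2\<close> to the power \<open>-(3L+1)n\<close>. The exponent lies strictly
  between the other two: the expected number of lamps touched in one step is finite, and the walk on
  the orbit is transient, because the largest scale seen up to time \<open>t\<close> gives a bound for the hitting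
  probability that is summable over \<open>t\<close> (\<open>spread_walk\<close>, \<open>sum_hit_bound\<close>). So the expected number of
  changes of a lamp is finite, and it is small if every step is preceded by lifts that touch no lamp
  but move each vertex around (\<open>pr_active_step_law\<close>, \<open>walk_active_sum\<close>). The steps have tail exponent
  \<open>(3L+1)/(3L+3) \<alpha>\<^sub>0\<close>, which tends to \<open>\<alpha>\<^sub>0\<close> as \<open>L\<close> grows.

  \<^bold>\<open>Boundary.\<close> Started at \<open>x\<close>, the probability that the lamp at \<open>1\<^sup>\<infinity>\<close> is on after \<open>t\<close> steps converges
  to a bounded harmonic function of \<open>x\<close>. It is small at the identity, and multiplying by \<open>c\<close> from the
  left changes its value \<open>p\<close> into \<open>1 - p\<close>; so it is not constant (\<open>boundary_grig_measure\<close>).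

  \<^bold>\<open>Growth.\<close> Insert an optional letter \<open>c\<close> after each of \<open>N\<close> random steps. The lamp at the vertex that
  the first step moves to \<open>o\<close> tells whether the first \<open>c\<close> is present, unless the remaining word also
  touches it, which rarely happens; and so on for the remaining word. So, for a suitable choice of the
  steps, all but few of the \<open>N\<close> bits can be recovered from the group element, which gives
  exponentially many elements in \<open>N\<close>. With all scales at most \<open>m\<close> one can take \<open>N\<close> as \<open>2\<close> to the power
  \<open>(3L+1)m\<close> and total length of order \<open>\<lambda>\<^sub>0\<close> to the power \<open>3(L+1)m\<close> (\<open>growth_at_scale\<close>).
\<close>

section \<open>Words in the generators and active vertices\<close>

datatype letter = LA | LB | LC | LD

fun letter_map :: "letter \<Rightarrow> bool list \<Rightarrow> bool list" where
  "letter_map LA = grig_a" | "letter_map LB = grig_b" | "letter_map LC = grig_c" | "letter_map LD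
    = grig_d"

text \<open>
  A word is applied letter by letter from the left, in agreement with the action from the right.
\<close>

primrec word_map :: "letter list \<Rightarrow> bool list \<Rightarrow> bool list" where
  "word_map [] v = v"
| "word_map (l # w) v = word_map w (letter_map l v)"

lemma word_map_append [simp]: "word_map (u @ w) v = word_map w (word_map u v)"
  by (induction u arbitrary: v) auto

declare length_grig [simp]

lemma length_letter_map [simp]: "length (letter_map l v) = length v"
  by (cases l) auto

lemma letter_map_letter_map [simp]: "letter_map l (letter_map l v) = v"
  by (cases l) (auto simp: grig_involution)

lemma length_word_map [simp]: "length (word_map w v) = length v"
  by (induction w arbitrary: v) auto

lemma word_map_rev_word_map [simp]: "word_map (rev w) (word_map w v) = v"
  by (induction w arbitrary: v) auto

lemma word_map_word_map_rev [simp]: "word_map w (word_map (rev w) v) = v"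
  using word_map_rev_word_map[of "rev w"] by simp

text \<open>
  Whether the generator exchanges the two children of the vertex; the recursion is that of the
  generators themselves.
\<close>

fun letter_active :: "letter \<Rightarrow> bool list \<Rightarrow> bool" where
  "letter_active l [] \<longleftrightarrow> l = LA"
| "letter_active LA (i # v) \<longleftrightarrow> False"
| "letter_active LB (i # v) \<longleftrightarrow> (if i then letter_active LC v else letter_active LA v)"
| "letter_active LC (i # v) \<longleftrightarrow> (if i then letter_active LD v else letter_active LA v)"
| "letter_active LD (i # v) \<longleftrightarrow> i \<and> letter_active LB v"

primrec active :: "letter list \<Rightarrow> bool list \<Rightarrow> bool" where
  "active [] v \<longleftrightarrow> False"
| "active (l # w) v \<longleftrightarrow> letter_active l v \<noteq> active w (letter_map l v)"

lemma letter_map_Nil [simp]: "letter_map l [] = []"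
  by (cases l) (auto simp: grig_a_simps)

lemma letter_map_snoc: "letter_map l (v @ [y]) = letter_map l v @ [y \<noteq> letter_active l v]"
proof (induction v arbitrary: l)
  case Nil
  show ?case by (cases l) (auto simp: grig_a_simps)
next
  case (Cons i v)
  show ?case
  proof (cases l)
    case LA then show ?thesis by (simp add: grig_a_simps)
  next
    case LB then show ?thesis using Cons.IH[of LC] Cons.IH[of LA] by simp
  next
    case LC then show ?thesis using Cons.IH[of LD] Cons.IH[of LA] by simp
  next
    case LD then show ?thesis using Cons.IH[of LB] by simp
  qed
qed

lemma word_map_snoc: "word_map w (v @ [y]) = word_map w v @ [y \<noteq> active w v]"
  by (induction w arbitrary: v y) (auto simp: letter_map_snoc)

text \<open>
  The cocycle identity behind all lamp arguments: the second word meets the vertex where the first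
  one has carried it.
\<close>

lemma active_append: "active (u @ w) v \<longleftrightarrow> active u v \<noteq> active w (word_map u v)"
  by (induction u arbitrary: v) auto

lemma active_rev: "active (rev w) v \<longleftrightarrow> active w (word_map (rev w) v)"
proof -
  have "active (w @ rev w) u = False" for u
  proof -
    have "word_map (w @ rev w) (u @ [False]) = u @ [False]"
      by (simp only: word_map_append word_map_rev_word_map)
    then show ?thesis by (simp only: word_map_snoc) simp
  qed
  from this[of "word_map (rev w) v"] show ?thesis by (simp add: active_append)
qed

lemma word_map_prefix: "\<exists>v'. length v' = length v \<and> word_map w (u @ v) = word_map w u @ v'"
proof (induction v rule: rev_induct)
  case Nil show ?case by simp
next
  case (snoc y v)
  then obtain v' where "length v' = length v" "word_map w (u @ v) = word_map w u @ v'" by blast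
  then show ?case
    using word_map_snoc[of w "u @ v" y] by (intro exI[of _ "v' @ [y \<noteq> active w (u @ v)]"]) simp
qed

lemma take_word_map: "take n (word_map w v) = word_map w (take n v)"
proof (cases "n \<le> length v")
  case True
  obtain v' where "word_map w (take n v @ drop n v) = word_map w (take n v) @ v'"
    using word_map_prefix by blast
  with True show ?thesis by simp
qed simp

text \<open>
  The generators \<open>b\<close>, \<open>c\<close>, \<open>d\<close> are directed along the ray \<open>1\<^sup>\<infinity>\<close>: apart from the vertices hanging off
  that ray nothing is active, and the period 3 of the recursion decides which of the three is active
  where.
\<close>

lemma letter_active_iff:
  assumes "length v = Suc n"
  shows "letter_active LA v \<longleftrightarrow> False"
    "letter_active LB v \<longleftrightarrow> v = replicate n True @ [False] \<and> n mod 3 \<noteq> 2"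
    "letter_active LC v \<longleftrightarrow> v = replicate n True @ [False] \<and> n mod 3 \<noteq> 1"
    "letter_active LD v \<longleftrightarrow> v = replicate n True @ [False] \<and> n mod 3 \<noteq> 0"
proof -
  have "(letter_active LB v \<longleftrightarrow> v = replicate n True @ [False] \<and> n mod 3 \<noteq> 2) \<and>
    (letter_active LC v \<longleftrightarrow> v = replicate n True @ [False] \<and> n mod 3 \<noteq> 1) \<and>
    (letter_active LD v \<longleftrightarrow> v = replicate n True @ [False] \<and> n mod 3 \<noteq> 0)"
    using assms
  proof (induction n arbitrary: v)
    case 0
    then show ?case by (cases v) auto
  next
    case (Suc n)
    then obtain i u where v: "v = i # u" "length u = Suc n" by (cases v) auto
    obtain j u' where u: "u = j # u'" using v by (cases u) auto
    show ?case using Suc.IH[OF v(2)]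
      by (auto simp: v(1) u mod_Suc)
  qed
  then show "letter_active LB v \<longleftrightarrow> v = replicate n True @ [False] \<and> n mod 3 \<noteq> 2"
    "letter_active LC v \<longleftrightarrow> v = replicate n True @ [False] \<and> n mod 3 \<noteq> 1"
    "letter_active LD v \<longleftrightarrow> v = replicate n True @ [False] \<and> n mod 3 \<noteq> 0"
    by auto
  show "letter_active LA v \<longleftrightarrow> False" using assms by (cases v) auto
qed

section \<open>The balanced lift\<close>

text \<open>
  In terms of words this is \<open>ab \<mapsto> abadac\<close>, \<open>ac \<mapsto> abab\<close>, \<open>ad \<mapsto> acac\<close>; the value at \<open>a\<close> is a dummy, as
  only the letters between consecutive \<open>a\<close>'s are substituted.
\<close>

fun lift_letter :: "letter \<Rightarrow> letter list" where
  "lift_letter LA = []"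
| "lift_letter LB = [LB, LD, LC]"
| "lift_letter LC = [LB, LB]"
| "lift_letter LD = [LC, LC]"

definition lift :: "letter list \<Rightarrow> letter list" where
  "lift xs = concat (map lift_letter xs)"

definition alternating :: "letter list \<Rightarrow> letter list" where
  "alternating xs = concat (map (\<lambda>x. [LA, x]) xs)"

lemma alternating_simps [simp]: "alternating [] = []"
  "alternating (x # xs) = LA # x # alternating xs"
  "alternating (xs @ ys) = alternating xs @ alternating ys"
  by (auto simp: alternating_def)

lemma lift_simps [simp]: "lift [] = []" "lift (x # xs) = lift_letter x @ lift xs"
  by (auto simp: lift_def)

lemma klein_four: "grig_d (grig_c v) = grig_b v" "grig_c (grig_d v) = grig_b v"
  "grig_b (grig_c v) = grig_d v" "grig_c (grig_b v) = grig_d v"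
  "grig_b (grig_d v) = grig_c v" "grig_d (grig_b v) = grig_c v"
proof -
  have "grig_d (grig_c v) = grig_b v \<and> grig_c (grig_d v) = grig_b v \<and>
    grig_b (grig_c v) = grig_d v \<and> grig_c (grig_b v) = grig_d v \<and>
    grig_b (grig_d v) = grig_c v \<and> grig_d (grig_b v) = grig_c v" for v
    by (induction v) (auto simp: grig_involution)
  then show "grig_d (grig_c v) = grig_b v" "grig_c (grig_d v) = grig_b v"
  "grig_b (grig_c v) = grig_d v" "grig_c (grig_b v) = grig_d v"
  "grig_b (grig_d v) = grig_c v" "grig_d (grig_b v) = grig_c v" by auto
qed

text \<open>
  Reading the lifted word along the two subtrees, each letter \<open>ab\<close> exchanges them and each of \<open>ac\<close>, \<open>ad\<close>
  keeps them; the two emitted words are again alternating and differ only in whether they start with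
  \<open>a\<close>. An odd number of \<open>b\<close>'s leaves the subtrees exchanged.
\<close>

lemma word_map_alternating_lift_general:
  assumes "LA \<notin> set xs"
  shows "word_map (alternating (lift xs)) (i # v) =
    (i = even (count_list xs LB)) # word_map ((if i then [] else [LA]) @ alternating xs
        @ (if i = even (count_list xs LB) then [] else [LA])) v"
  using assms
proof (induction xs arbitrary: i v)
  case Nil
  show ?case by (simp add: grig_involution)
next
  case (Cons x xs)
  then have IH: "word_map (alternating (lift xs)) (i # v) =
    (i = even (count_list xs LB)) # word_map ((if i then [] else [LA]) @ alternating xs
        @ (if i = even (count_list xs LB) then [] else [LA])) v" for i v
    by simp
  consider "x = LB" | "x = LC" | "x = LD" using Cons.prems by (cases x) auto
  then show ?case
    by cases (cases i; auto simp: IH grig_a_simps grig_involution klein_four)+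
qed

text \<open>
  The balanced lift \<open>(a w a, w)\<close>: both subtrees receive a conjugate of the whole word.
\<close>

lemma word_map_alternating_lift:
  assumes "LA \<notin> set xs" "even (count_list xs LB)"
  shows "word_map (alternating (lift xs)) (i # v) =
    i # (if i then word_map (alternating xs) v else letter_map LA (word_map (alternating xs) (letter_map LA v)))"
  using word_map_alternating_lift_general[OF assms(1), of i v] assms(2) by auto

lemma lift_not_LA: "LA \<notin> set (lift xs)"
proof -
  have "LA \<notin> set (lift_letter x)" for x by (cases x) auto
  then show ?thesis by (auto simp: lift_def)
qed

text \<open>
  Preservation of this parity is what allows the lift to be iterated.
\<close>

lemma even_count_lift: "even (count_list (lift xs) LB) \<longleftrightarrow> even (count_list xs LB)"
  if "LA \<notin> set xs"
  using that
proof (induction xs)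
  case (Cons x xs)
  then show ?case by (cases x) (auto simp: count_list_append)
qed simp

text \<open>
  Conjugating \<open>(a w a, w)\<close> by \<open>a\<close> only exchanges the coordinates, so iterated lifts have no other
  sections than \<open>w\<close> and \<open>a w a\<close>.
\<close>

lemma word_map_alternating_lift_funpow:
  assumes "LA \<notin> set xs" "even (count_list xs LB)" "length v = m"
  shows "(\<forall>w. word_map (alternating ((lift ^^ m) xs)) (v @ w) = v @ word_map (alternating xs) w) \<or>
    (\<forall>w. word_map (alternating ((lift ^^ m) xs)) (v @ w) = v @ letter_map LA (word_map (alternating xs) (letter_map LA w)))"
  using assms(3)
proof (induction m arbitrary: v)
  case 0
  then show ?case by simp
next
  case (Suc m)
  let ?ys = "(lift ^^ m) xs"
  have ys: "LA \<notin> set ?ys \<and> even (count_list ?ys LB)"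
    using assms(1,2) by (induction m) (auto simp: lift_not_LA even_count_lift)
  obtain i u where v: "v = i # u" "length u = m" using Suc.prems by (cases v) auto
  have step: "word_map (alternating (lift ?ys)) (i # u @ w) =
    i # (if i then word_map (alternating ?ys) (u @ w) else letter_map LA (word_map (alternating ?ys)
      (letter_map LA (u @ w))))" for w
    using word_map_alternating_lift[of ?ys i "u @ w"] ys by simp
  show ?case
  proof (cases i)
    case True
    then have "word_map (alternating (lift ?ys)) (True # u @ w) = True
      # word_map (alternating ?ys) (u @ w)" for w
      using step[of w] by simp
    then show ?thesis using Suc.IH[OF v(2)] True by (simp add: v(1))
  next
    case i: False
    show ?thesis
    proof (cases u)
      case Nil
      then have "m = 0" using v by simp
      have "word_map (alternating (lift ?ys)) (False # w) = False
        # letter_map LA (word_map (alternating ?ys) (letter_map LA w))" for w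
        using step[of w] i Nil by simp
      then show ?thesis using v i Nil \<open>m = 0\<close> by simp
    next
      case (Cons j u')
      have "length ((\<not> j) # u') = m" using v Cons by simp
      note IH = Suc.IH[OF this]
      have "word_map (alternating (lift ?ys)) (False # j # u' @ w)
          = False # letter_map LA (word_map (alternating ?ys) ((\<not> j) # u' @ w))" for w
        using step[of w] i Cons by (simp add: grig_a_simps)
      then show ?thesis using IH v(1) i Cons by (auto simp: grig_a_simps)
    qed
  qed
qed

text \<open>
  The letter is chosen such that its germ, shifted up by \<open>m\<close> levels in the cycle of \<open>b\<close>, \<open>c\<close>, \<open>d\<close>, is
  the germ of \<open>b\<close> whenever \<open>m\<close> is not divisible by 3. For \<open>m\<close> divisible by 3 that would require
  \<open>ab\<close>, whose lift is not balanced.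
\<close>

definition flip_letter :: "nat \<Rightarrow> letter" where
  "flip_letter m = (if m mod 3 = 2 then LD else LC)"

definition flip_word :: "nat \<Rightarrow> letter list" where
  "flip_word m = alternating ((lift ^^ m) [flip_letter m])"

lemma word_map_flip_word:
  assumes "length v = m"
  shows "(\<forall>w. word_map (flip_word m) (v @ w) = v @ word_map [LA, flip_letter m] w) \<or>
    (\<forall>w. word_map (flip_word m) (v @ w) = v @ word_map [flip_letter m, LA] w)"
  using word_map_alternating_lift_funpow[of "[flip_letter m]" v m] assms
  by (auto simp: flip_word_def flip_letter_def grig_involution)

lemma flip_word_flips:
  assumes "length v = m"
  shows "\<exists>w'. length w' = length w \<and> word_map (flip_word m) (v @ y # w) = v @ (\<not> y) # w'"
proof -
  have "letter_map l (y # w) = y # tl (letter_map l (y # w))" if "l = LC \<or> l = LD" for l y w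
    using that by auto
  have 1: "word_map [LA, l] (y # w) = (\<not> y) # tl (word_map [LA, l] (y # w))"
    "word_map [l, LA] (y # w) = (\<not> y) # tl (word_map [l, LA] (y # w))" if "l = LC \<or> l = LD" for l
    using that by (auto simp: grig_a_simps)
  have "flip_letter m = LC \<or> flip_letter m = LD" by (simp add: flip_letter_def)
  note 2 = 1[OF this]
  have len: "length (tl (word_map u (y # w))) = length w" for u by simp
  show ?thesis using word_map_flip_word[OF assms] 2 len by metis
qed

lemma active_flip_word:
  assumes "length v = m"
  shows "(\<forall>w. active (flip_word m) (v @ w) \<longleftrightarrow> active [LA, flip_letter m] w) \<or>
    (\<forall>w. active (flip_word m) (v @ w) \<longleftrightarrow> active [flip_letter m, LA] w)"
proof -
  have *: "active (flip_word m) (v @ w) \<longleftrightarrow> active x w"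
    if "\<forall>w. word_map (flip_word m) (v @ w) = v @ word_map x w" for x w
    using that[rule_format, of "w @ [False]"] word_map_snoc[of "flip_word m" "v @ w" False]
    by (simp add: word_map_snoc)
  show ?thesis using word_map_flip_word[OF assms] * by metis
qed

lemma flip_word_short: "length v \<le> m \<Longrightarrow> word_map (flip_word m) v = v"
proof -
  assume v: "length v \<le> m"
  let ?u = "v @ replicate (m - length v) True"
  have "word_map (flip_word m) ?u = ?u"
    using word_map_flip_word[of ?u m] v by (auto dest: spec[of _ "[]"] simp del: letter_map.simps)
  then show ?thesis using take_word_map[of "length v" "flip_word m" ?u] by simp
qed

section \<open>Active vertices of flip words\<close>

definition active_set :: "nat \<Rightarrow> letter list \<Rightarrow> bool list set" where
  "active_set K w = {v. length v = K \<and> active w v}"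

text \<open>
  The vertex \<open>1\<dots>10\<close> of level \<open>K\<close>, where the lamp of the word is read off.
\<close>

definition ray_vertex :: "nat \<Rightarrow> bool list" where
  "ray_vertex K = replicate (K - 1) True @ [False]"

lemma length_ray_vertex [simp]: "K > 0 \<Longrightarrow> length (ray_vertex K) = K"
  by (simp add: ray_vertex_def)

lemma card_vertices: "finite {v :: bool list. length v = n}"
  "card {v :: bool list. length v = n} = 2 ^ n"
  using card_lists_length_eq[of "UNIV :: bool set" n] finite_lists_length_eq[of "UNIV :: bool
    set" n]
  by simp_all

lemma finite_active_set [simp]: "finite (active_set K w)"
  by (rule finite_subset[OF _ card_vertices(1)[of K]]) (auto simp: active_set_def)

text \<open>
  On levels divisible by 3 only \<open>c\<close> and \<open>d\<close> can touch a lamp, and only the one at the ray vertex.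
\<close>

lemma letter_active_level:
  assumes "3 dvd K" "K > 0" "length v = K"
  shows "\<not> letter_active LA v" "\<not> letter_active LB v" "letter_active LC v \<longleftrightarrow> v = ray_vertex K"
    "letter_active LD v \<longleftrightarrow> v = ray_vertex K"
proof -
  have len: "length v = Suc (K - 1)" using assms by simp
  obtain p where "K = 3 * Suc p" using assms(1,2)
    by (metis dvdE gr0_implies_Suc nat_0_less_mult_iff)
  then have "K - 1 = 2 + p * 3" by simp
  then have "(K - 1) mod 3 = 2" by (simp only: mod_mult_self1) simp
  then show "\<not> letter_active LA v" "\<not> letter_active LB v" "letter_active LC v \<longleftrightarrow> v = ray_vertex K"
    "letter_active LD v \<longleftrightarrow> v = ray_vertex K"
    using letter_active_iff[OF len] by (simp_all add: ray_vertex_def)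
qed

lemma letter_map_ray_vertex: "l \<noteq> LA \<Longrightarrow> K > 0 \<Longrightarrow> 3 dvd K \<Longrightarrow> letter_map l (ray_vertex K) = ray_vertex K"
proof -
  have *: "(l \<noteq> LA \<longrightarrow> letter_map l (replicate n True @ [False]) = replicate n True @ [False])" for n
  proof (induction n arbitrary: l)
    case 0 then show ?case by (cases l) (auto simp: grig_a_simps)
  next
    case (Suc n)
    have "grig_b (replicate n True @ [False]) = replicate n True @ [False]"
      "grig_c (replicate n True @ [False]) = replicate n True @ [False]"
      "grig_d (replicate n True @ [False]) = replicate n True @ [False]"
      using Suc[of LB] Suc[of LC] Suc[of LD] by simp_all
    then show ?case by (cases l) simp_all
  qed
  show "l \<noteq> LA \<Longrightarrow> K > 0 \<Longrightarrow> 3 dvd K \<Longrightarrow> letter_map l (ray_vertex K) = ray_vertex K"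
    using * by (simp add: ray_vertex_def)
qed

text \<open>
  Below each vertex of level \<open>m\<close> the word acts as \<open>ax\<close> or \<open>xa\<close> with \<open>x\<close> its flip letter, which has at
  most one active vertex on level \<open>K - m\<close>; by the choice of the flip letter it has none if \<open>m\<close> is not
  divisible by 3. If \<open>K \<le> m\<close>, either the word fixes the levels up to \<open>K + 1\<close> or the bound \<open>2\<^sup>m\<close> is
  trivial.
\<close>

lemma card_active_set_flip_word:
  assumes K: "3 dvd K" "K > 0"
  shows "card (active_set K (flip_word m)) \<le> (if m mod 3 = 0 then 2 ^ m else 0)"
proof (cases "m < K")
  case True
  define n where "n = K - 1 - m"
  let ?l = "flip_letter m"
  have nK: "K - m = Suc n" using True by (simp add: n_def)
  have low: "active [LA, ?l] w \<longleftrightarrow> letter_active ?l (letter_map LA w)"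
    "active [?l, LA] w \<longleftrightarrow> letter_active ?l w"
    if "length w = Suc n" for w
    using that letter_active_iff(1)[of w n] letter_active_iff(1)[of "letter_map ?l w" n] by auto
  have O: "letter_active ?l w \<Longrightarrow> m mod 3 = 0 \<and> w = replicate n True @ [False]" if "length w = Suc n"
    for w
  proof -
    assume a: "letter_active ?l w"
    have "(m + n + 1) mod 3 = 0" using K True by (simp add: n_def)
    moreover have "(m mod 3 + n mod 3 + 1) mod 3 = (m + n + 1) mod 3"
      by (metis mod_add_eq mod_add_left_eq)
    ultimately have "(m mod 3 + n mod 3 + 1) mod 3 = 0" by simp
    moreover have "m mod 3 = 0 \<or> m mod 3 = 1 \<or> m mod 3 = 2"
      "n mod 3 = 0 \<or> n mod 3 = 1 \<or> n mod 3 = 2"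
      by linarith+
    ultimately consider "m mod 3 = 0" | "m mod 3 = 1" "n mod 3 = 1" | "m mod 3 = 2" "n mod 3 = 0"
      by (elim disjE) (simp_all del: One_nat_def)
    then show ?thesis
      using a letter_active_iff[OF that] by cases (auto simp: flip_letter_def)
  qed
  have len: "length (drop m v) = Suc n" if "v \<in> active_set K (flip_word m)" for v
    using that nK by (simp add: active_set_def)
  show ?thesis
  proof (cases "m mod 3 = 0")
    case m: False
    have "v \<notin> active_set K (flip_word m)" for v
    proof
      assume v: "v \<in> active_set K (flip_word m)"
      then have "length (take m v) = m" using True by (simp add: active_set_def)
      from active_flip_word[OF this] v
      have "active [LA, ?l] (drop m v) \<or> active [?l, LA] (drop m v)"
        by (metis append_take_drop_id mem_Collect_eq active_set_def)
      then have "letter_active ?l (letter_map LA (drop m v)) \<or> letter_active ?l (drop m v)"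
        unfolding low[OF len[OF v]] .
      moreover have "length (letter_map LA (drop m v)) = Suc n" using len[OF v] by simp
      ultimately show False using O[OF len[OF v]] O[of "letter_map LA (drop m v)"] m by argo
    qed
    then have "active_set K (flip_word m) = {}" by blast
    then show ?thesis by simp
  next
    case m: True
    have "inj_on (take m) (active_set K (flip_word m))"
    proof (rule inj_onI)
      fix v v' assume v: "v \<in> active_set K (flip_word m)" and v': "v' \<in> active_set K (flip_word m)"
        and eq: "take m v = take m v'"
      have "length (take m v) = m" using v True by (simp add: active_set_def)
      note alt = active_flip_word[OF this]
      have av: "active (flip_word m) (take m v @ drop m v)" using v by (simp add: active_set_def)
      have av': "active (flip_word m) (take m v @ drop m v')" using v' unfolding eq
        by (simp add: active_set_def)
      have "letter_map LA (drop m v) = letter_map LA (drop m v') \<or> drop m v = drop m v'"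
        using alt
      proof
        assume h: "\<forall>w. active (flip_word m) (take m v @ w) = active [LA, ?l] w"
        have "letter_active ?l (letter_map LA (drop m v))"
          "letter_active ?l (letter_map LA (drop m v'))"
          using av av' unfolding h[rule_format] low(1)[OF len[OF v]] low(1)[OF len[OF v']]
            by simp_all
        moreover have "length (letter_map LA (drop m v)) = Suc n"
          "length (letter_map LA (drop m v')) = Suc n"
          using len[OF v] len[OF v'] by simp_all
        ultimately show ?thesis using O[of "letter_map LA (drop m v)"] O[of "letter_map LA
          (drop m v')"] by metis
      next
        assume h: "\<forall>w. active (flip_word m) (take m v @ w) = active [?l, LA] w"
        have "letter_active ?l (drop m v)" "letter_active ?l (drop m v')"
          using av av' unfolding h[rule_format] low(2)[OF len[OF v]] low(2)[OF len[OF v']]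
            by simp_all
        then show ?thesis using O[OF len[OF v]] O[OF len[OF v']] by metis
      qed
      then have "drop m v = drop m v'" by (metis letter_map_letter_map)
      with eq show "v = v'" by (metis append_take_drop_id)
    qed
    then have "card (active_set K (flip_word m)) = card (take m ` active_set K (flip_word m))"
      by (simp add: card_image)
    also have "\<dots> \<le> card {v :: bool list. length v = m}"
      using True by (intro card_mono card_vertices) (auto simp: active_set_def)
    finally show ?thesis using m by (simp add: card_vertices)
  qed
next
  case False
  show ?thesis
  proof (cases "m mod 3 = 0")
    case True
    have "card (active_set K (flip_word m)) \<le> card {v :: bool list. length v = K}"
      by (intro card_mono card_vertices) (auto simp: active_set_def)
    also have "\<dots> \<le> 2 ^ m" using False by (simp add: card_vertices)
    finally show ?thesis using True by simp
  next
    case m: False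
    then have "K < m" using False K(1) by (metis dvd_imp_mod_0 linorder_neqE_nat)
    have "\<not> active (flip_word m) v" if "length v = K" for v
      using flip_word_short[of "v @ [False]" m] \<open>K < m\<close> that by (simp add: word_map_snoc)
    then have "active_set K (flip_word m) = {}" by (auto simp: active_set_def)
    then show ?thesis by simp
  qed
qed

lemma active_set_append: "card (active_set K (u @ w)) \<le> card (active_set K u)
  + card (active_set K w)"
proof -
  have "active_set K (u @ w) \<subseteq> active_set K u \<union> word_map (rev u) ` active_set K w"
  proof
    fix v assume "v \<in> active_set K (u @ w)"
    then have "v \<in> active_set K u \<or> word_map u v \<in> active_set K w"
      by (auto simp: active_set_def active_append)
    then show "v \<in> active_set K u \<union> word_map (rev u) ` active_set K w"
      by (metis UnCI word_map_rev_word_map image_eqI)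
  qed
  then have "card (active_set K (u @ w))
    \<le> card (active_set K u \<union> word_map (rev u) ` active_set K w)"
    by (intro card_mono) auto
  also have "\<dots> \<le> card (active_set K u) + card (word_map (rev u) ` active_set K w)"
    by (rule card_Un_le)
  also have "\<dots> \<le> card (active_set K u) + card (active_set K w)" by (simp add: card_image_le)
  finally show ?thesis .
qed

lemma active_set_rev: "card (active_set K (rev w)) \<le> card (active_set K w)"
proof -
  have "active_set K (rev w) \<subseteq> word_map w ` active_set K w"
    by (auto simp: active_set_def active_rev intro!: image_eqI[where x = "word_map (rev w) _"])
  then have "card (active_set K (rev w)) \<le> card (word_map w ` active_set K w)"
    by (intro card_mono) auto
  also have "\<dots> \<le> card (active_set K w)" by (simp add: card_image_le)
  finally show ?thesis .
qed

lemma active_set_letter: 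
  assumes "3 dvd K" "K > 0" shows "card (active_set K [l]) \<le> 1"
proof -
  have "active_set K [l] \<subseteq> {ray_vertex K}" using letter_active_level[OF assms]
    by (cases l) (auto simp: active_set_def)
  then show ?thesis using card_mono[of "{ray_vertex K}" "active_set K [l]"] by simp
qed

section \<open>Random words\<close>

abbreviation (input) pr :: "'a pmf \<Rightarrow> ('a \<Rightarrow> bool) \<Rightarrow> real" where
  "pr p Q \<equiv> measure_pmf.prob p {x. Q x}"

lemma integrable_pmf_bounded:
  fixes f :: "'a \<Rightarrow> real"
  assumes "\<And>x. \<bar>f x\<bar> \<le> B"
  shows "integrable (measure_pmf p) f"
  by (rule measure_pmf.integrable_const_bound[where B = B]) (auto simp: assms)

lemma integrable_pr: "integrable (measure_pmf p) (\<lambda>x. pr (f x) (Q x))"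
  by (rule integrable_pmf_bounded[where B = 1]) auto

lemma pr_bind: "pr (bind_pmf p f) Q = (\<integral>x. pr (f x) Q \<partial>measure_pmf p)"
proof -
  have "ennreal (pr (bind_pmf p f) Q) = (\<integral>\<^sup>+x. ennreal (pr (f x) Q) \<partial>measure_pmf p)"
    by (simp add: measure_pmf.emeasure_eq_measure[symmetric])
  also have "\<dots> = ennreal (\<integral>x. pr (f x) Q \<partial>measure_pmf p)"
    by (intro nn_integral_eq_integral integrable_pr) auto
  finally show ?thesis by (simp add: integral_nonneg_AE)
qed

lemma pr_map: "pr (map_pmf f p) Q = pr p (\<lambda>x. Q (f x))"
  by (simp add: vimage_def)

lemma pr_mono: "(\<And>x. x \<in> set_pmf p \<Longrightarrow> Q x \<Longrightarrow> R x) \<Longrightarrow> pr p Q \<le> pr p R"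
proof -
  assume *: "\<And>x. x \<in> set_pmf p \<Longrightarrow> Q x \<Longrightarrow> R x"
  have "pr p Q = measure_pmf.prob p ({x. Q x} \<inter> set_pmf p)" by (simp add: measure_Int_set_pmf)
  also have "\<dots> \<le> pr p R" using * by (intro measure_pmf.finite_measure_mono) auto
  finally show ?thesis .
qed

lemma pr_cong: "(\<And>x. x \<in> set_pmf p \<Longrightarrow> Q x \<longleftrightarrow> R x) \<Longrightarrow> pr p Q = pr p R"
  by (intro antisym pr_mono) auto

lemma pr_disj: "pr p (\<lambda>x. Q x \<or> R x) \<le> pr p Q + pr p R"
proof -
  have "{x. Q x \<or> R x} = {x. Q x} \<union> {x. R x}" by auto
  then show ?thesis using measure_Un_le[of "{x. Q x}" "measure_pmf p" "{x. R x}"] by simp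
qed

lemma integral_pmf_mono:
  fixes f g :: "'a \<Rightarrow> real"
  assumes "\<And>x. x \<in> set_pmf p \<Longrightarrow> f x \<le> g x" "integrable (measure_pmf p) f"
    "integrable (measure_pmf p) g"
  shows "(\<integral>x. f x \<partial>measure_pmf p) \<le> (\<integral>x. g x \<partial>measure_pmf p)"
  using assms by (intro integral_mono_AE) (auto simp: AE_measure_pmf_iff)

lemma pr_bind_le_integral:
  assumes "\<And>x. x \<in> set_pmf p \<Longrightarrow> pr (f x) Q \<le> g x" "integrable (measure_pmf p) g"
  shows "pr (bind_pmf p f) Q \<le> (\<integral>x. g x \<partial>measure_pmf p)"
  unfolding pr_bind by (intro integral_pmf_mono assms integrable_pr)

lemma pr_bind_le:
  assumes "\<And>x. x \<in> set_pmf p \<Longrightarrow> pr (f x) Q \<le> c"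
  shows "pr (bind_pmf p f) Q \<le> c"
  using pr_bind_le_integral[of p f Q "\<lambda>_. c"] assms by simp

text \<open>
  Independent concatenation, that is, convolution before passing to the group.
\<close>

definition cat_pmf :: "letter list pmf \<Rightarrow> letter list pmf \<Rightarrow> letter list pmf" where
  "cat_pmf p q = bind_pmf p (\<lambda>u. map_pmf (\<lambda>w. u @ w) q)"

lemma cat_pmf_flip: "cat_pmf p q = bind_pmf q (\<lambda>w. map_pmf (\<lambda>u. u @ w) p)"
  unfolding cat_pmf_def map_pmf_def by (rule bind_commute_pmf)

lemma cat_pmf_assoc: "cat_pmf (cat_pmf p q) r = cat_pmf p (cat_pmf q r)"
  by (simp add: cat_pmf_def map_pmf_def bind_assoc_pmf bind_return_pmf)

lemma cat_pmf_Nil [simp]: "cat_pmf (return_pmf []) q = q" "cat_pmf p (return_pmf []) = p"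
  by (simp_all add: cat_pmf_def bind_return_pmf map_pmf_def bind_return_pmf')

lemma cat_pmf_bind_left: "cat_pmf (bind_pmf p f) q = bind_pmf p (\<lambda>x. cat_pmf (f x) q)"
  by (simp add: cat_pmf_def bind_assoc_pmf)

lemma cat_pmf_bind_right: "cat_pmf p (bind_pmf r f) = bind_pmf r (\<lambda>x. cat_pmf p (f x))"
  by (simp add: cat_pmf_flip bind_assoc_pmf)

lemma set_cat_pmf: "set_pmf (cat_pmf p q) = {u @ w | u w. u \<in> set_pmf p \<and> w \<in> set_pmf q}"
  by (auto simp: cat_pmf_def)

lemma map_rev_cat_pmf: "map_pmf rev (cat_pmf p q) = cat_pmf (map_pmf rev q) (map_pmf rev p)"
  unfolding cat_pmf_flip[of "map_pmf rev q"] 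
  by (simp add: cat_pmf_def map_bind_pmf bind_map_pmf map_pmf_comp)

lemma pr_concat_le_of_left_fixed: "(\<And>u. u \<in> set_pmf p \<Longrightarrow> pr q (\<lambda>w. Q (u @ w)) \<le> c)
  \<Longrightarrow> pr (cat_pmf p q) Q \<le> c"
  unfolding cat_pmf_def by (rule pr_bind_le) (simp add: pr_map del: measure_map_pmf)

lemma pr_concat_le_of_right_fixed: "(\<And>w. w \<in> set_pmf q \<Longrightarrow> pr p (\<lambda>u. Q (u @ w)) \<le> c)
  \<Longrightarrow> pr (cat_pmf p q) Q \<le> c"
  unfolding cat_pmf_flip by (rule pr_bind_le) (simp add: pr_map del: measure_map_pmf)

text \<open>
  The bound concerns all targets at once; this makes it stable under composition with independent
  words on either side.
\<close>

definition spread :: "nat \<Rightarrow> letter list pmf \<Rightarrow> real \<Rightarrow> bool" where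
  "spread K p b \<longleftrightarrow> (\<forall>v v'. length v = K \<longrightarrow> pr p (\<lambda>w. word_map w v = v') \<le> b)"

lemma spreadD: "spread K p b \<Longrightarrow> length v = K \<Longrightarrow> pr p (\<lambda>w. word_map w v = v') \<le> b"
  by (simp add: spread_def)

lemma spread_one: "1 \<le> b \<Longrightarrow> spread K p b"
  unfolding spread_def by (meson measure_pmf.prob_le_1 order_trans)

lemma word_map_eq_iff: "word_map w v = v' \<longleftrightarrow> v = word_map (rev w) v'"
  by (metis word_map_rev_word_map word_map_word_map_rev)

lemma spread_concat_left: "spread K p b \<Longrightarrow> spread K (cat_pmf p q) b"
  unfolding spread_def
proof (intro allI impI)
  fix v v' :: "bool list" assume "\<forall>v v'. length v = K \<longrightarrow> pr p (\<lambda>w. word_map w v = v') \<le> b"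
    "length v = K"
  then show "pr (cat_pmf p q) (\<lambda>w. word_map w v = v') \<le> b"
    by (intro pr_concat_le_of_right_fixed) (subst word_map_append, subst (1) word_map_eq_iff, simp)
qed

lemma spread_concat_right: "spread K q b \<Longrightarrow> spread K (cat_pmf p q) b"
  unfolding spread_def by (intro allI impI pr_concat_le_of_left_fixed) simp

lemma spread_bind: "(\<And>x. x \<in> set_pmf p \<Longrightarrow> spread K (f x) b) \<Longrightarrow> spread K (bind_pmf p f) b"
  unfolding spread_def by (intro allI impI pr_bind_le) simp

lemma spread_rev: "spread K p b \<Longrightarrow> spread K (map_pmf rev p) b"
  unfolding spread_def
proof (intro allI impI)
  fix v v' :: "bool list"
  assume *: "\<forall>v v'. length v = K \<longrightarrow> pr p (\<lambda>w. word_map w v = v') \<le> b" and v: "length v = K"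
  have "pr (map_pmf rev p) (\<lambda>w. word_map w v = v') = pr p (\<lambda>w. word_map (rev w) v = v')"
    by (rule pr_map)
  also have "\<dots> = pr p (\<lambda>w. word_map w v' = v)"
    by (intro arg_cong[where f = "measure_pmf.prob
      p"] Collect_cong) (metis word_map_rev_word_map word_map_word_map_rev)
  also have "\<dots> \<le> b"
  proof (cases "length v' = K")
    case False
    then have "{w. word_map w v' = v} = {}" using v
      by (auto simp: length_word_map[symmetric] simp del: length_word_map)
    then have "pr p (\<lambda>w. word_map w v' = v) = 0" by simp
    also have "0 \<le> b" using *[rule_format, OF v, of v] by (meson measure_nonneg order_trans)
    finally show ?thesis .
  qed (use * in simp)
  finally show "pr (map_pmf rev p) (\<lambda>w. word_map w v = v') \<le> b" .
qed

definition coin :: "bool pmf" where "coin = bernoulli_pmf (1/2)"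

text \<open>
  Reversing a word inverts the group element, since all letters are involutions.
\<close>

definition symmetrize :: "letter list pmf \<Rightarrow> letter list pmf" where
  "symmetrize p = bind_pmf coin (\<lambda>s. if s then map_pmf rev p else p)"

lemma map_Not_coin: "map_pmf Not coin = coin"
  by (rule pmf_eqI) (auto simp: coin_def map_pmf_def pmf_bind indicator_def)

lemma set_coin [simp]: "set_pmf coin = UNIV"
  by (simp add: coin_def)

lemma map_rev_symmetrize: "map_pmf rev (symmetrize p) = symmetrize p"
proof -
  have "map_pmf rev (symmetrize p) = bind_pmf coin (\<lambda>s. if \<not> s then map_pmf rev p else p)"
    by (simp add: symmetrize_def map_bind_pmf if_distrib[of "map_pmf
      rev"] map_pmf_comp cong: if_cong)
      (rule bind_pmf_cong, auto)
  also have "\<dots> = bind_pmf (map_pmf Not coin) (\<lambda>s. if s then map_pmf rev p else p)"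
    by (simp add: bind_map_pmf)
  finally show ?thesis by (simp add: map_Not_coin symmetrize_def)
qed

lemma spread_symmetrize: "spread K p b \<Longrightarrow> spread K (symmetrize p) b"
  unfolding symmetrize_def by (intro spread_bind) (auto intro: spread_rev)

lemma set_symmetrize: "set_pmf (symmetrize p) = set_pmf p \<union> rev ` set_pmf p"
  by (auto simp: symmetrize_def split: if_splits)

text \<open>
  A random subproduct of the flip words with index in \<open>J\<close>, in increasing order. The order matters: a
  later flip word does not disturb the digits settled before.
\<close>

primrec flip_cube :: "(nat \<Rightarrow> bool) \<Rightarrow> nat \<Rightarrow> letter list pmf" where
  "flip_cube J 0 = return_pmf []"
| "flip_cube J (Suc m) = (if J m
     then cat_pmf (flip_cube J m) (map_pmf (\<lambda>s. if s then flip_word m else []) coin) else flip_cube J m)"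

lemma set_flip_cube_step: "set_pmf (map_pmf (\<lambda>s. if s then x else y) coin) = {x, y}"
  by auto

lemma pr_coin: "pr coin (\<lambda>s. s = b) = 1/2"
  by (simp add: measure_pmf_single coin_def)

text \<open>
  The digits are determined one after the other: given the word up to \<open>M\<close>, exactly one value of the
  next coin produces the required digit. Flip words beyond the level \<open>K\<close> act trivially and contribute
  nothing to the exponent.
\<close>

lemma pr_take_flip_cube:
  assumes "length v = K"
  shows "pr (flip_cube J M) (\<lambda>w. take (min M K) (word_map w v) = u)
    \<le> (1/2) ^ card {m. m < min M K \<and> J m}"
proof (induction M arbitrary: u)
  case 0
  show ?case by simp
next
  case (Suc M)
  let ?F = "map_pmf (\<lambda>s. if s then flip_word M else []) coin"
  show ?case
  proof (cases "M < K")
    case True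
    have S: "{m. m < Suc M \<and> J m} = (if J M then insert M {m. m < M \<and> J m} else {m. m < M \<and> J m})"
      by (auto simp: less_Suc_eq)
    have IH: "pr (flip_cube J M) (\<lambda>w. take M (word_map w v) = take M u)
      \<le> (1/2) ^ card {m. m < M \<and> J m}"
      using Suc[of "take M u"] True by simp
    show ?thesis
    proof (cases "J M")
      case J: True
      have flip: "take (Suc M) (word_map (if s then flip_word M else []) x) = u \<longrightarrow>
          take M x = take M u \<and> s = (u ! M \<noteq> x ! M)" if "length x = K" for x s
      proof -
        have M: "length (take M x) = M" using that True by simp
        have x: "x = take M x @ x ! M # drop (Suc M) x"
          using that True by (simp add: id_take_nth_drop[symmetric])
        obtain w' where w': "word_map (flip_word M) x = take M x @ (\<not> x ! M) # w'"
          using flip_word_flips[OF M, of "drop (Suc M) x" "x ! M"] x by metis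
        have "take (Suc M) (word_map (if s then flip_word M else []) x) = take M x @ [s \<noteq> x ! M]"
        proof (cases s)
          case s: True
          then show ?thesis using w' M by simp
        next
          case False
          then show ?thesis using that True by (simp add: take_Suc_conv_app_nth)
        qed
        then show ?thesis using M by (auto simp: nth_append)
      qed
      have "pr (flip_cube J (Suc M)) (\<lambda>w. take (Suc M) (word_map w v) = u)
          = (\<integral>w. pr coin (\<lambda>s. take (Suc M) (word_map (if s then flip_word M else []) (word_map w v)) = u)
               \<partial>measure_pmf (flip_cube J M))"
        using J by (simp add: cat_pmf_def pr_bind pr_map del: measure_map_pmf)
      also have "\<dots> \<le> (\<integral>w. 1/2 * indicator {w. take M (word_map w v) = take M u} w
               \<partial>measure_pmf (flip_cube J M))"
      proof (intro integral_pmf_mono integrable_pr)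
        fix w
        show "pr coin (\<lambda>s. take (Suc M) (word_map (if s then flip_word M else []) (word_map w v))
          = u)
          \<le> 1/2 * indicator {w. take M (word_map w v) = take M u} w"
        proof (cases "take M (word_map w v) = take M u")
          case eq: True
          have "pr coin (\<lambda>s. take (Suc M) (word_map (if s then flip_word M else []) (word_map w v))
            = u)
              \<le> pr coin (\<lambda>s. s = (u ! M \<noteq> word_map w v ! M))"
            using flip[of "word_map w v"] assms by (intro pr_mono) simp
          also have "\<dots> = 1/2" by (rule pr_coin)
          also have "(1/2::real) = 1/2 * indicator {w. take M (word_map w v) = take M u} w" using eq
            by simp
          finally show ?thesis .
        next
          case False
          then have "{s. take (Suc M) (word_map (if s then flip_word M else []) (word_map w v)) = u}
            = {}"
            using flip[of "word_map w v"] assms by auto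
          then show ?thesis by simp
        qed
      qed (auto intro!: integrable_pmf_bounded[where B = 1] simp: indicator_def)
      also have "\<dots> = 1/2 * pr (flip_cube J M) (\<lambda>w. take M (word_map w v) = take M u)" by simp
      also have "\<dots> \<le> 1/2 * (1/2) ^ card {m. m < M \<and> J m}" using IH by simp
      finally show ?thesis using True J by (simp add: S)
    next
      case False
      have "pr (flip_cube J (Suc M)) (\<lambda>w. take (Suc M) (word_map w v) = u)
        \<le> pr (flip_cube J M) (\<lambda>w. take M (word_map w v) = take M u)"
        using False by (auto intro!: pr_mono simp: min_def)
      also note IH
      finally show ?thesis using True False by (simp add: S)
    qed
  next
    case False
    have *: "word_map (flip_word M) x = x" if "length x = K" for x
      using flip_word_short[of x M] that False by simp
    have min: "min (Suc M) K = K" "min M K = K" using False by auto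
    have "pr (flip_cube J (Suc M)) (\<lambda>w. take K (word_map w v) = u)
      \<le> pr (flip_cube J M) (\<lambda>w. take K (word_map w v) = u)"
      using * assms by (cases "J
        M") (auto intro!: pr_concat_le_of_right_fixed pr_mono split: if_splits)
    then show ?thesis using Suc[of u] unfolding min by (rule order_trans)
  qed
qed

lemma spread_flip_cube: 
  assumes "c \<le> card {m. m < min M K \<and> J m}"
  shows "spread K (flip_cube J M) ((1/2) ^ c)"
  unfolding spread_def
proof (intro allI impI)
  fix v v' :: "bool list" assume "length v = K"
  have "pr (flip_cube J M) (\<lambda>w. word_map w v = v')
    \<le> pr (flip_cube J M) (\<lambda>w. take (min M K) (word_map w v) = take (min M K) v')"
    by (rule pr_mono) simp
  also have "\<dots> \<le> (1/2) ^ card {m. m < min M K \<and> J m}" by (rule pr_take_flip_cube) fact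
  also have "\<dots> \<le> (1/2) ^ c" using assms by (intro power_decreasing) auto
  finally show "pr (flip_cube J M) (\<lambda>w. word_map w v = v') \<le> (1/2) ^ c" .
qed

lemma active_set_flip_cube:
  assumes "3 dvd K" "K > 0" "w \<in> set_pmf (flip_cube J M)"
  shows "card (active_set K w) \<le> (\<Sum>m | m < M \<and> J m \<and> m mod 3 = 0. 2 ^ m)"
  using assms(3)
proof (induction M arbitrary: w)
  case 0
  then show ?case by (simp add: active_set_def)
next
  case (Suc M)
  have S: "{m. m < Suc M \<and> J m \<and> m mod 3 = 0} =
    (if J M \<and> M mod 3 = 0 then {M} else {}) \<union> {m. m < M \<and> J m \<and> m mod 3 = 0}"
    by (auto simp: less_Suc_eq)
  have S': "(\<Sum>m | m < Suc M \<and> J m \<and> m mod 3 = 0. 2 ^ m) =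
    (\<Sum>m | m < M \<and> J m \<and> m mod 3 = 0. 2 ^ m) + (if J M \<and> M mod 3 = 0 then 2 ^ M else (0::nat))"
    unfolding S by (subst sum.union_disjoint) auto
  show ?case
  proof (cases "J M")
    case True
    then obtain u x where w: "w = u @ x" "u \<in> set_pmf (flip_cube J M)" "x \<in> {flip_word M, []}"
      using Suc.prems by (auto simp: set_cat_pmf set_flip_cube_step)
    then have "card (active_set K x) \<le> (if M mod 3 = 0 then 2 ^ M else 0)"
      using card_active_set_flip_word[OF assms(1,2), of M] by (auto simp: active_set_def)
    then show ?thesis using active_set_append[of K u x] Suc.IH[OF w(2)] True
      unfolding S' w(1) by simp
  next
    case False
    then show ?thesis using Suc by (simp add: S')
  qed
qed

section \<open>Scales\<close>

lemma cat_pmf_pair: "cat_pmf p q = map_pmf (\<lambda>(u, w). u @ w) (pair_pmf p q)"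
  by (simp add: cat_pmf_def pair_pmf_def map_pmf_def bind_assoc_pmf bind_return_pmf)

text \<open>
  The digits flipped at scale \<open>n\<close>. Indices divisible by 3 cost lamps, so they stop a bit earlier, at
  \<open>3Ln\<close> instead of \<open>3(L+1)n\<close>; this gap is what makes all exponents fit together.
\<close>

definition flipped_digit :: "nat \<Rightarrow> nat \<Rightarrow> nat \<Rightarrow> bool" where
  "flipped_digit L n m \<longleftrightarrow> m mod 3 \<noteq> 0 \<or> m < 3 * L * n"

text \<open>
  Random words that move every vertex around but touch no lamp.
\<close>

definition clean_pmf :: "nat \<Rightarrow> letter list pmf" where
  "clean_pmf M = symmetrize (flip_cube (\<lambda>m. m mod 3 \<noteq> 0) (3 * M))"

text \<open>
  Scale 0 is used for the generators, which are needed for non-degeneracy.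
\<close>

definition scale_pmf :: "nat \<Rightarrow> nat \<Rightarrow> letter list pmf" where
  "scale_pmf L n = (if n = 0 then map_pmf (\<lambda>l. [l]) (pmf_of_set {LA, LB, LC, LD})
     else symmetrize (flip_cube (flipped_digit L n) (3 * (L + 1) * n)))"

text \<open>
  The two ratios are separated by a factor 2. The scale \<open>n\<close> has probability of order
  \<open>scale_ratio L ^ n\<close>, and its spread is at most \<open>spread_ratio L ^ n\<close>.
\<close>

definition scale_ratio :: "nat \<Rightarrow> real" where "scale_ratio L = (1/2) ^ (3 * L + 1)"
definition spread_ratio :: "nat \<Rightarrow> real" where "spread_ratio L = (1/2) ^ (3 * L + 2)"

lemma scale_ratio_bounds: "0 < scale_ratio L" "scale_ratio L < 1" "scale_ratio L \<le> 1/2"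
proof -
  have "scale_ratio L \<le> (1/2) ^ 1" unfolding scale_ratio_def by (intro power_decreasing) auto
  then show "0 < scale_ratio L" "scale_ratio L < 1" "scale_ratio L \<le> 1/2"
    by (auto simp: scale_ratio_def)
qed

lemma spread_ratio_eq: "spread_ratio L = scale_ratio L / 2"
  by (simp add: spread_ratio_def scale_ratio_def)

lemma spread_ratio_bounds: "0 < spread_ratio L" "spread_ratio L < 1"
  using scale_ratio_bounds[of L] by (auto simp: spread_ratio_eq)

lemma card_residues_mod3: "card {m. m < 3 * p \<and> m mod 3 \<noteq> 0} = 2 * p"
  "card {m. m < 3 * p \<and> m mod 3 = 0} = p"
proof -
  have S: "{m. m < 3 * Suc p \<and> m mod 3 \<noteq> 0}
    = insert (3 * p + 1) (insert (3 * p + 2) {m. m < 3 * p \<and> m mod 3 \<noteq> 0})"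
    "{m. m < 3 * Suc p \<and> m mod 3 = 0} = insert (3 * p) {m. m < 3 * p \<and> m mod 3 = 0}" for p :: nat
  proof -
    have "m < 3 * Suc p \<longleftrightarrow> m < 3 * p \<or> m = 3 * p \<or> m = 3 * p + 1 \<or> m = 3 * p + 2" for m
    proof -
      have "3 * Suc p = Suc (Suc (Suc (3 * p)))" by simp
      then show ?thesis unfolding less_Suc_eq by auto
    qed
    moreover have "(3 * p) mod 3 = 0" by simp
    moreover have "(3 * p + 1) mod 3 \<noteq> 0" "(3 * p + 2) mod 3 \<noteq> 0"
      unfolding mod_mult_self4 by simp_all
    ultimately have "m < 3 * Suc p \<and> m mod 3 \<noteq> 0 \<longleftrightarrow> m = 3 * p + 1 \<or> m = 3 * p + 2 \<or> m < 3 * p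
      \<and> m mod 3 \<noteq> 0"
      "m < 3 * Suc p \<and> m mod 3 = 0 \<longleftrightarrow> m = 3 * p \<or> m < 3 * p \<and> m mod 3 = 0" for m
      by metis+
    then show
      "{m. m < 3 * Suc p \<and> m mod 3 \<noteq> 0}
        = insert (3 * p + 1) (insert (3 * p + 2) {m. m < 3 * p \<and> m mod 3 \<noteq> 0})"
      "{m. m < 3 * Suc p \<and> m mod 3 = 0} = insert (3 * p) {m. m < 3 * p \<and> m mod 3 = 0}"
      by (simp_all only: set_eq_iff mem_Collect_eq insert_iff) simp_all
  qed
  show "card {m. m < 3 * p \<and> m mod 3 \<noteq> 0} = 2 * p"
    by (induction p) (simp_all only: S, simp_all)
  show "card {m. m < 3 * p \<and> m mod 3 = 0} = p"
    by (induction p) (simp_all only: S, simp_all)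
qed

lemma card_flipped_digit:
  assumes "k \<le> n"
  shows "(3 * L + 2) * k \<le> card {m. m < 3 * (L + 1) * k \<and> flipped_digit L n m}"
proof -
  let ?A = "{m. m < 3 * ((L + 1) * k) \<and> m mod 3 \<noteq> 0}" and ?B = "{m. m < 3 * (L * k) \<and> m mod 3 = 0}"
  have "m < 3 * L * n" if "m < 3 * (L * k)" for m
  proof -
    have "L * k \<le> L * n" using assms by simp
    then show ?thesis using that by (simp only: mult.assoc)
  qed
  moreover have "m < 3 * (L + 1) * k" if "m < 3 * (L * k)" for m
    using that by (simp add: algebra_simps)
  ultimately have sub: "?A \<union> ?B \<subseteq> {m. m < 3 * (L + 1) * k \<and> flipped_digit L n m}"
    unfolding flipped_digit_def mult.assoc by blast
  have "card (?A \<union> ?B) = card ?A + card ?B" by (intro card_Un_disjoint) auto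
  also have "\<dots> = (3 * L + 2) * k" unfolding card_residues_mod3 by (simp add: algebra_simps)
  finally show ?thesis using card_mono[OF _ sub] by simp
qed

text \<open>
  A level \<open>3(L+1)\<nu>\<close> sees only the digits of the scales up to \<open>\<nu>\<close>.
\<close>

lemma spread_scale_pmf: "spread (3 * (L + 1) * \<nu>) (scale_pmf L n) (spread_ratio L ^ min n \<nu>)"
proof (cases "n = 0")
  case False
  have "(3 * L + 2) * min n \<nu> \<le> card {m. m < 3 * (L + 1) * min n \<nu> \<and> flipped_digit L n m}"
    by (rule card_flipped_digit) simp
  also have "3 * (L + 1) * min n \<nu> = min (3 * (L + 1) * n) (3 * (L + 1) * \<nu>)"
    by (simp only: nat_mult_min_right)
  finally have "spread (3 * (L + 1) * \<nu>)
    (symmetrize (flip_cube (flipped_digit L n) (3 * (L + 1) * n)))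
      ((1/2) ^ ((3 * L + 2) * min n \<nu>))"
    by (intro spread_symmetrize spread_flip_cube)
  then show ?thesis using False by (simp only: scale_pmf_def spread_ratio_def power_mult if_False)
qed (simp add: spread_one)

lemma spread_clean_pmf:
  assumes "(3 * L + 2) * j \<le> \<nu>"
  shows "spread (3 * (L + 1) * \<nu>) (clean_pmf ((3 * L + 2) * j)) (spread_ratio L ^ j)"
proof -
  let ?M = "(3 * L + 2) * j"
  have "\<nu> \<le> (L + 1) * \<nu>" by simp
  then have le: "3 * ?M \<le> 3 * (L + 1) * \<nu>" using assms by (simp only: mult.assoc)
  have "?M \<le> card {m. m < min (3 * ?M) (3 * (L + 1) * \<nu>) \<and> m mod 3 \<noteq> 0}"
    unfolding min_absorb1[OF le] card_residues_mod3 by simp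
  then have "spread (3 * (L + 1) * \<nu>) (clean_pmf ?M) ((1/2) ^ ?M)"
    unfolding clean_pmf_def by (intro spread_symmetrize spread_flip_cube)
  then show ?thesis by (simp only: spread_ratio_def power_mult)
qed

lemma active_clean_pmf:
  assumes "3 dvd K" "K > 0" "w \<in> set_pmf (clean_pmf M)" "length v = K"
  shows "\<not> active w v"
proof -
  have "card (active_set K u) = 0" if "u \<in> set_pmf (flip_cube (\<lambda>m. m mod 3 \<noteq> 0) (3 * M))" for u
    using active_set_flip_cube[OF assms(1,2) that] by (auto cong: conj_cong)
  moreover have "w \<in> set_pmf (flip_cube (\<lambda>m. m mod 3 \<noteq> 0) (3 * M)) \<or>
      (\<exists>u\<in>set_pmf (flip_cube (\<lambda>m. m mod 3 \<noteq> 0) (3 * M)). w = rev u)"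
    using assms(3) unfolding clean_pmf_def set_symmetrize by blast
  ultimately have "card (active_set K w) \<le> 0" using active_set_rev[of K] by (metis le_zero_eq)
  then have "active_set K w = {}" by simp
  then show ?thesis using assms(4) unfolding active_set_def by blast
qed

lemma active_set_scale_pmf:
  assumes "3 dvd K" "K > 0" "w \<in> set_pmf (scale_pmf L n)"
  shows "card (active_set K w) \<le> 2 ^ (3 * L * n)"
proof (cases "n = 0")
  case True
  then obtain l where "w = [l]" using assms(3) by (auto simp: scale_pmf_def)
  then show ?thesis using active_set_letter[OF assms(1,2), of l] True by simp
next
  case False
  have "card (active_set K u) \<le> 2 ^ (3 * L * n)"
    if u: "u \<in> set_pmf (flip_cube (flipped_digit L n) (3 * (L + 1) * n))" for u
  proof -
    have "card (active_set K u)
      \<le> (\<Sum>m | m < 3 * (L + 1) * n \<and> flipped_digit L n m \<and> m mod 3 = 0. 2 ^ m)"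
      by (rule active_set_flip_cube[OF assms(1,2) u])
    also have "\<dots> \<le> (\<Sum>m < 3 * L * n. 2 ^ m)"
      by (intro sum_mono2) (auto simp: flipped_digit_def)
    also have "\<dots> \<le> 2 ^ (3 * L * n)" using sum_power2[of "3 * L * n"] by (simp add: atLeast0LessThan)
    finally show ?thesis .
  qed
  then show ?thesis using assms(3) False active_set_rev[of K]
    by (auto simp: scale_pmf_def set_symmetrize intro: order_trans)
qed

definition scale_law :: "nat \<Rightarrow> nat pmf" where "scale_law L = geometric_pmf (1 - scale_ratio L)"

lemma pmf_scale_law: "pmf (scale_law L) n = (1 - scale_ratio L) * scale_ratio L ^ n"
  using scale_ratio_bounds[of L] by (simp add: scale_law_def)

lemma pr_scale_law_le: "pr (scale_law L) (\<lambda>n. n \<le> m) = 1 - scale_ratio L ^ (m + 1)"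
proof -
  have "pr (scale_law L) (\<lambda>n. n \<le> m) = (\<Sum>n\<le>m. pmf (scale_law L) n)"
    by (subst measure_measure_pmf_finite) (auto simp: atMost_def)
  also have "\<dots> = (1 - scale_ratio L) * (\<Sum>n\<le>m. scale_ratio L ^ n)"
    by (simp add: pmf_scale_law sum_distrib_left)
  also have "\<dots> = 1 - scale_ratio L ^ (m + 1)" using one_diff_power_eq'[of "scale_ratio L" "Suc m"]
    by (simp add: lessThan_Suc_atMost sum_gp_basic)
  finally show ?thesis .
qed

lemma nn_integral_scale_law:
  assumes "\<And>n. 0 \<le> f n" "(\<lambda>n. (1 - scale_ratio L) * scale_ratio L ^ n * f n) sums s"
  shows "(\<integral>\<^sup>+n. ennreal (f n) \<partial>measure_pmf (scale_law L)) = ennreal s"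
proof -
  have "(\<integral>\<^sup>+n. ennreal (f n) \<partial>measure_pmf (scale_law L))
    = (\<Sum>n. ennreal ((1 - scale_ratio L) * scale_ratio L ^ n * f n))"
    using scale_ratio_bounds[of L] assms(1)
    by (simp add: nn_integral_measure_pmf nn_integral_count_space_nat pmf_scale_law ennreal_mult)
  also have "\<dots> = ennreal s"
    using assms scale_ratio_bounds[of L]
      by (intro suminf_ennreal_eq) (auto intro!: mult_nonneg_nonneg)
  finally show ?thesis .
qed

section \<open>The random walk and its hitting probabilities\<close>

text \<open>
  The clean factors on both sides make the law invariant under inversion for trivial \<open>E\<close>; the first
  one moves the vertex before the costly factor is applied. The law \<open>E\<close> leaves room for the
  optional letter of the growth argument.
\<close>

definition scale_step :: "nat \<Rightarrow> nat \<Rightarrow> letter list pmf \<Rightarrow> nat \<Rightarrow> letter list pmf" where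
  "scale_step L j E n = cat_pmf (clean_pmf ((3 * L + 2) * j))
    (cat_pmf (scale_pmf L n) (cat_pmf (clean_pmf ((3 * L + 2) * j)) E))"

definition step_law :: "nat \<Rightarrow> nat \<Rightarrow> letter list pmf \<Rightarrow> letter list pmf" where
  "step_law L j E = bind_pmf (scale_law L) (scale_step L j E)"

primrec walk :: "letter list pmf \<Rightarrow> nat \<Rightarrow> letter list pmf" where
  "walk T 0 = return_pmf []"
| "walk T (Suc t) = cat_pmf (walk T t) T"

text \<open>
  The expectation of \<open>spread_ratio L ^ max j M\<close>, truncated at the exponent \<open>\<nu>\<close>, where \<open>M\<close> is the
  largest scale among \<open>t\<close> independent ones: the power is written as a telescoping sum over \<open>m\<close>, and
  \<open>1 - scale_ratio L ^ (m + 1)\<close> is the probability of a scale at most \<open>m\<close>.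
\<close>

definition hit_bound :: "nat \<Rightarrow> nat \<Rightarrow> nat \<Rightarrow> nat \<Rightarrow> real" where
  "hit_bound L \<nu> t j = spread_ratio L ^ \<nu>
    + (\<Sum>m\<in>{j..<\<nu>}. (1 - spread_ratio L) * spread_ratio L ^ m * (1 - scale_ratio L ^ (m + 1)) ^ t)"

lemma hit_bound_0: "hit_bound L \<nu> 0 j = spread_ratio L ^ min j \<nu>"
proof (cases "j \<le> \<nu>")
  case True
  then have "(\<Sum>m\<in>{j..<\<nu>}. (1 - spread_ratio L) * spread_ratio L ^ m)
    = spread_ratio L ^ j - spread_ratio L ^ \<nu>"
  proof (induction \<nu> rule: dec_induct)
    case (step n)
    then show ?case by (simp add: algebra_simps)
  qed simp
  then show ?thesis using True by (simp add: hit_bound_def)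
qed (simp add: hit_bound_def min_def)

lemma scale_ratio_pow: "0 \<le> 1 - scale_ratio L ^ n" "1 - scale_ratio L ^ n \<le> 1"
  using scale_ratio_bounds[of L] by (auto simp: power_le_one)

lemma hit_bound_nonneg: "0 \<le> hit_bound L \<nu> t j"
  using spread_ratio_bounds[of L] scale_ratio_pow[of L] unfolding hit_bound_def
  by (intro add_nonneg_nonneg sum_nonneg mult_nonneg_nonneg zero_le_power) (auto simp del: power_Suc)

text \<open>
  Adding one more scale \<open>n\<close> to the maximum amounts to adding one more step.
\<close>

lemma integral_hit_bound:
  "(\<integral>n. hit_bound L \<nu> t (max n j) \<partial>measure_pmf (scale_law L)) = hit_bound L \<nu> (Suc t) j"
  "integrable (measure_pmf (scale_law L)) (\<lambda>n. hit_bound L \<nu> t (max n j))"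
proof -
  define c where "c m = (1 - spread_ratio L) * spread_ratio L ^ m * (1 - scale_ratio L ^ (m + 1)) ^
    t" for m
  have eq: "hit_bound L \<nu> t (max n j) = spread_ratio L ^ \<nu>
    + (\<Sum>m\<in>{j..<\<nu>}. c m * indicator {n. n \<le> m} n)" for n
  proof -
    have "(\<Sum>m\<in>{max n j..<\<nu>}. c m) = (\<Sum>m\<in>{j..<\<nu>}. c m * indicator {n. n \<le> m} n)"
      by (intro sum.mono_neutral_cong_left) (auto simp: indicator_def)
    then show ?thesis by (simp only: hit_bound_def c_def)
  qed
  have int: "integrable (measure_pmf (scale_law L)) (\<lambda>n. c m * indicator {n. n \<le> m} n)" for m
    by (intro integrable_pmf_bounded[where B = "\<bar>c m\<bar>"]) (auto simp: indicator_def)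
  then have sumint: "integrable (measure_pmf (scale_law L))
    (\<lambda>n. \<Sum>m\<in>{j..<\<nu>}. c m * indicator {n. n \<le> m} n)"
    by (rule Bochner_Integration.integrable_sum)
  show "integrable (measure_pmf (scale_law L)) (\<lambda>n. hit_bound L \<nu> t (max n j))"
    unfolding eq using sumint by (rule Bochner_Integration.integrable_add[rotated]) simp
  have "(\<integral>n. hit_bound L \<nu> t (max n j) \<partial>measure_pmf (scale_law L))
      = spread_ratio L ^ \<nu> + (\<integral>n. (\<Sum>m\<in>{j..<\<nu>}. c m * indicator {n. n \<le> m} n) \<partial>measure_pmf (scale_law L))"
    unfolding eq using sumint by (subst Bochner_Integration.integral_add) simp_all
  also have "(\<integral>n. (\<Sum>m\<in>{j..<\<nu>}. c m * indicator {n. n \<le> m} n) \<partial>measure_pmf (scale_law L))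
      = (\<Sum>m\<in>{j..<\<nu>}. c m * pr (scale_law L) (\<lambda>n. n \<le> m))"
    using int by (subst Bochner_Integration.integral_sum) simp_all
  also have "spread_ratio L ^ \<nu> + \<dots> = hit_bound L \<nu> (Suc t) j"
    unfolding pr_scale_law_le hit_bound_def c_def by (simp add: mult_ac)
  finally show "(\<integral>n. hit_bound L \<nu> t (max n j) \<partial>measure_pmf (scale_law L))
    = hit_bound L \<nu> (Suc t) j" .
qed

lemma spread_scale_step: "spread (3 * (L + 1) * \<nu>) (scale_step L j E n) (spread_ratio L ^ min n \<nu>)"
  unfolding scale_step_def by (intro spread_concat_right spread_concat_left spread_scale_pmf)

text \<open>
  The step of the largest scale alone spreads the vertex as required, whatever the other steps are. In
  the induction the factor \<open>q\<close> accumulates the steps after time \<open>t\<close>, with \<open>i\<close> the best scale among them.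
\<close>

lemma spread_walk:
  assumes "spread (3 * (L + 1) * \<nu>) q (spread_ratio L ^ min i \<nu>)"
  shows "spread (3 * (L + 1) * \<nu>) (cat_pmf (walk (step_law L j E) t) q) (hit_bound L \<nu> t i)"
  using assms
proof (induction t arbitrary: q i)
  case 0
  then show ?case by (simp add: hit_bound_0)
next
  case (Suc t)
  let ?K = "3 * (L + 1) * \<nu>"
  have "spread ?K (cat_pmf (scale_step L j E n) q) (spread_ratio L ^ min (max n i) \<nu>)" for n
    using spread_concat_left[OF spread_scale_step[of L \<nu> j E n], of q]
      spread_concat_right[OF Suc.prems, of "scale_step L j E n"]
    by (cases "n \<le> i") (simp_all add: max_def)
  then have IH: "spread ?K (cat_pmf (walk (step_law L j E) t) (cat_pmf (scale_step L j E n) q))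
    (hit_bound L \<nu> t (max n i))" for n
    by (rule Suc.IH)
  have eq: "cat_pmf (walk (step_law L j E) (Suc t)) q
      = bind_pmf (scale_law L) (\<lambda>n. cat_pmf (walk (step_law L j E) t) (cat_pmf (scale_step L j E n) q))"
    by (simp add: cat_pmf_assoc step_law_def cat_pmf_bind_left cat_pmf_bind_right)
  show ?case
    unfolding spread_def eq
  proof (intro allI impI)
    fix v v' :: "bool list" assume v: "length v = ?K"
    show "pr (scale_law L \<bind> (\<lambda>n. cat_pmf (walk (step_law L j E) t) (cat_pmf (scale_step L j E n) q))) (\<lambda>w. word_map w v = v')
        \<le> hit_bound L \<nu> (Suc t) i"
      unfolding integral_hit_bound(1)[symmetric]
      by (intro pr_bind_le_integral integral_hit_bound spreadD[OF IH v])
  qed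
qed

section \<open>How often a lamp is touched\<close>

text \<open>
  The probability that a word from \<open>q\<close> touches the lamp at the place where an independent word from \<open>p\<close>
  has carried \<open>v\<close>.
\<close>

definition pr_active :: "letter list pmf \<Rightarrow> letter list pmf \<Rightarrow> bool list \<Rightarrow> real" where
  "pr_active p q v = pr (pair_pmf p q) (\<lambda>(w, y). active y (word_map w v))"

lemma pr_active_alt: "pr_active p q v = (\<integral>y. pr p (\<lambda>w. active y (word_map w v)) \<partial>measure_pmf q)"
proof -
  have "pair_pmf p q = bind_pmf q (\<lambda>y. map_pmf (\<lambda>w. (w, y)) p)"
    unfolding pair_pmf_def map_pmf_def by (rule bind_commute_pmf)
  then show ?thesis by (simp add: pr_active_def pr_bind pr_map del: measure_map_pmf)
qed

text \<open>
  Union bound over the lamps that the second word touches.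
\<close>

lemma pr_active_le:
  assumes "spread K p b" "0 \<le> b" "\<And>y. y \<in> set_pmf q \<Longrightarrow> card (active_set K y) \<le> s" "length v = K"
  shows "pr_active p q v \<le> real s * b"
proof -
  have "pr p (\<lambda>w. active y (word_map w v)) \<le> real s * b" if "y \<in> set_pmf q" for y
  proof -
    have "{w. active y (word_map w v)} = (\<Union>z\<in>active_set K y. {w. word_map w v = z})"
      using assms(4) by (auto simp: active_set_def)
    then have "pr p (\<lambda>w. active y (word_map w v))
      \<le> (\<Sum>z\<in>active_set K y. pr p (\<lambda>w. word_map w v = z))"
      by (simp add: measure_pmf.finite_measure_subadditive_finite)
    also have "\<dots> \<le> (\<Sum>z\<in>active_set K y. b)" by (intro sum_mono spreadD[OF assms(1,4)])
    also have "\<dots> \<le> real s * b" using assms(2,3) that by (simp add: mult_right_mono)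
    finally show ?thesis .
  qed
  then have "pr_active p q v \<le> (\<integral>y. real s * b \<partial>measure_pmf q)"
    unfolding pr_active_alt by (intro integral_pmf_mono integrable_pr) auto
  then show ?thesis by simp
qed

lemma pr_active_cat_pmf: "pr_active p (cat_pmf q r) v \<le> pr_active p q v
  + pr_active (cat_pmf p q) r v"
proof -
  have 1: "pr_active p (cat_pmf q r) v
    = pr (pair_pmf p (pair_pmf q r)) (\<lambda>(w, y, z). active (y @ z) (word_map w v))"
    unfolding pr_active_def cat_pmf_pair pair_map_pmf2
      by (subst pr_map) (simp add: case_prod_unfold)
  have 2: "pr_active p q v = pr (pair_pmf p (pair_pmf q r)) (\<lambda>(w, y, z). active y (word_map w v))"
  proof -
    have "pair_pmf p q = map_pmf (\<lambda>(w, y, z). (w, y)) (pair_pmf p (pair_pmf q r))"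
      by (simp add: pair_pmf_def map_bind_pmf bind_assoc_pmf bind_return_pmf)
    then show ?thesis unfolding pr_active_def by (simp only: pr_map) (simp add: case_prod_unfold)
  qed
  have 3: "pr_active (cat_pmf p q) r v
    = pr (pair_pmf p (pair_pmf q r)) (\<lambda>(w, y, z). active z (word_map (w @ y) v))"
  proof -
    have "pair_pmf (cat_pmf p q) r = map_pmf (\<lambda>(w, y, z). (w @ y, z)) (pair_pmf p (pair_pmf q r))"
      by (simp add: cat_pmf_def pair_pmf_def map_pmf_def bind_assoc_pmf bind_return_pmf)
    then show ?thesis unfolding pr_active_def by (simp only: pr_map) (simp add: case_prod_unfold)
  qed
  show ?thesis unfolding 1 2 3
    by (rule order_trans[OF pr_mono pr_disj]) (auto simp: active_append)
qed

lemma pr_active_bind: "pr_active p (bind_pmf g f) v = (\<integral>n. pr_active p (f n) v \<partial>measure_pmf g)"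
proof -
  have "pair_pmf p (bind_pmf g f) = bind_pmf g (\<lambda>n. pair_pmf p (f n))"
    unfolding pair_pmf_def bind_assoc_pmf by (rule bind_commute_pmf)
  then show ?thesis by (simp add: pr_active_def pr_bind)
qed

text \<open>
  The clean factors touch nothing. The middle factor of scale \<open>n\<close> touches at most \<open>2\<close> to the power \<open>3Ln\<close>
  lamps, which has expectation at most 2 for the law of scales, and the last factor touches at most one.
  Each of these lamps is met with probability at most the hitting bound.
\<close>

lemma pr_active_step_law:
  assumes E: "\<And>w. w \<in> set_pmf E \<Longrightarrow> card (active_set (3 * (L + 1) * \<nu>) w) \<le> 1"
    and \<nu>: "(3 * L + 2) * j \<le> \<nu>" "0 < \<nu>" and v: "length v = 3 * (L + 1) * \<nu>"
  shows "pr_active (walk (step_law L j E) t) (step_law L j E) v \<le> 3 * hit_bound L \<nu> t j"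
proof -
  let ?K = "3 * (L + 1) * \<nu>" and ?W = "walk (step_law L j E) t"
    and ?H = "clean_pmf ((3 * L + 2) * j)"
  let ?U = "hit_bound L \<nu> t j"
  have K: "3 dvd ?K" "?K > 0" using \<nu> by auto
  have "j \<le> (3 * L + 2) * j" by simp
  then have min: "min j \<nu> = j" using \<nu>(1) by linarith
  have H: "spread ?K ?H (spread_ratio L ^ min j \<nu>)" using spread_clean_pmf[OF \<nu>(1)] min by simp
  have WH: "spread ?K (cat_pmf ?W (cat_pmf ?H r)) ?U" for r
    by (intro spread_walk spread_concat_left H)
  have sH: "card (active_set ?K y) \<le> 0" if "y \<in> set_pmf ?H" for y
  proof -
    have "active_set ?K y = {}" unfolding active_set_def using active_clean_pmf[OF K that] by blast
    then show ?thesis by simp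
  qed
  have H0: "pr_active p ?H v \<le> 0" for p
    using pr_active_le[of ?K p 1 ?H 0 v] sH v spread_one by simp
  have n: "pr_active ?W (scale_step L j E n) v \<le> (2 ^ (3 * L * n) + 1) * ?U" for n
  proof -
    have "pr_active ?W (scale_step L j E n) v
        \<le> pr_active ?W ?H v + (pr_active (cat_pmf ?W ?H) (scale_pmf L n) v
          + (pr_active (cat_pmf (cat_pmf ?W ?H) (scale_pmf L n)) ?H v
             + pr_active (cat_pmf (cat_pmf (cat_pmf ?W ?H) (scale_pmf L n)) ?H) E v))"
      unfolding scale_step_def by (intro order_trans[OF pr_active_cat_pmf] add_left_mono) simp
    also have "\<dots> \<le> 0 + (real (2 ^ (3 * L * n)) * ?U + (0 + real 1 * ?U))"
      using WH[of "return_pmf []"] WH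
      by (intro add_mono H0 pr_active_le[of ?K] active_set_scale_pmf[OF K] v hit_bound_nonneg E)
        (simp_all add: cat_pmf_assoc)
    finally show ?thesis by (simp add: algebra_simps)
  qed
  \<comment> \<open>\<open>scale_ratio L * 2 ^ (3 * L) = 1/2\<close>, so the number of lamps touched has finite expectation\<close>
  have geo: "(\<lambda>n. (1 - scale_ratio L) * scale_ratio L ^ n * ((2 ^ (3 * L * n) + 1) * ?U)) sums
    (2 * (1 - scale_ratio L) * ?U + ?U)"
  proof -
    have "scale_ratio L * 2 ^ (3 * L) = 1/2"
      by (simp add: scale_ratio_def power_add power_mult_distrib[symmetric])
    then have e: "scale_ratio L ^ n * 2 ^ (3 * L * n) = (1/2) ^ n" for n
      by (simp only: power_mult[of _ "3 * L" n] power_mult_distrib[symmetric])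
    have "(\<lambda>n. (1 - scale_ratio L) * ?U * (1/2) ^ n + (1 - scale_ratio L) * ?U * scale_ratio L ^ n)
        sums ((1 - scale_ratio L) * ?U * (1 / (1 - 1/2)) + (1 - scale_ratio L) * ?U * (1 / (1 - scale_ratio L)))"
      using scale_ratio_bounds[of L] by (intro sums_add sums_mult geometric_sums) auto
    moreover have "(1 - scale_ratio L) * ?U * (1 / (1 - 1/2))
      + (1 - scale_ratio L) * ?U * (1 / (1 - scale_ratio L))
        = 2 * (1 - scale_ratio L) * ?U + ?U"
      using scale_ratio_bounds[of L] by simp
    moreover have "(1 - scale_ratio L) * scale_ratio L ^ n * ((2 ^ (3 * L * n) + 1) * ?U)
        = (1 - scale_ratio L) * ?U * (1/2) ^ n + (1 - scale_ratio L) * ?U * scale_ratio L ^ n" for n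
      unfolding e[of n, symmetric] by (simp add: algebra_simps)
    ultimately show ?thesis by (simp only:)
  qed
  have "ennreal (pr_active ?W (step_law L j E) v)
    = (\<integral>\<^sup>+n. ennreal (pr_active ?W (scale_step L j E n) v) \<partial>measure_pmf (scale_law L))"
  proof -
    have "pr_active ?W (step_law L j E) v
      = (\<integral>n. pr_active ?W (scale_step L j E n) v \<partial>measure_pmf (scale_law L))"
      by (subst (2) step_law_def) (rule pr_active_bind)
    then show ?thesis unfolding pr_active_def
      by (simp only:) (intro nn_integral_eq_integral[symmetric] integrable_pr, auto)
  qed
  also have "\<dots> \<le> (\<integral>\<^sup>+n. ennreal ((2 ^ (3 * L * n) + 1) * ?U) \<partial>measure_pmf (scale_law L))"
    by (intro nn_integral_mono ennreal_leI n)
  also have "\<dots> = ennreal (2 * (1 - scale_ratio L) * ?U + ?U)"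
    by (intro nn_integral_scale_law geo mult_nonneg_nonneg hit_bound_nonneg) simp
  finally have "pr_active ?W (step_law L j E) v \<le> 2 * (1 - scale_ratio L) * ?U + ?U"
    using scale_ratio_bounds[of L] hit_bound_nonneg[of L \<nu> t j]
      by (subst (asm) ennreal_le_iff) (auto intro!: add_nonneg_nonneg mult_nonneg_nonneg)
  also have "2 * (1 - scale_ratio L) * ?U \<le> 2 * ?U"
    using scale_ratio_bounds[of L] hit_bound_nonneg[of L \<nu> t j] by (intro mult_right_mono) auto
  finally show ?thesis by simp
qed

lemma pr_diff_le: "\<bar>pr p Q - pr p R\<bar> \<le> pr p (\<lambda>x. Q x \<noteq> R x)"
proof -
  have "pr p Q \<le> pr p R + pr p (\<lambda>x. Q x \<noteq> R x)" "pr p R \<le> pr p Q + pr p (\<lambda>x. Q x \<noteq> R x)"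
    by (rule order_trans[OF pr_mono pr_disj]; auto)+
  then show ?thesis by linarith
qed

lemma pr_active_walk_diff:
  assumes E: "\<And>w. w \<in> set_pmf E \<Longrightarrow> card (active_set (3 * (L + 1) * \<nu>) w) \<le> 1"
    and \<nu>: "(3 * L + 2) * j \<le> \<nu>" "0 < \<nu>" and v: "length v = 3 * (L + 1) * \<nu>"
  shows "\<bar>pr (walk (step_law L j E) (Suc t)) (\<lambda>w. active w v) - pr (walk (step_law L j E) t)
    (\<lambda>w. active w v)\<bar>
    \<le> 3 * hit_bound L \<nu> t j"
proof -
  let ?W = "walk (step_law L j E) t" and ?T = "step_law L j E"
  have 1: "pr (walk ?T (Suc t)) (\<lambda>w. active w v)
    = pr (pair_pmf ?W ?T) (\<lambda>x. active (fst x @ snd x) v)"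
    unfolding walk.simps cat_pmf_pair by (subst pr_map) (simp add: case_prod_unfold)
  have 2: "pr ?W (\<lambda>w. active w v) = pr (pair_pmf ?W ?T) (\<lambda>x. active (fst x) v)"
    by (subst map_fst_pair_pmf[of ?W ?T, symmetric]) (rule pr_map)
  have 3: "pr (pair_pmf ?W ?T) (\<lambda>x. active (fst x @ snd x) v \<noteq> active (fst x) v)
    = pr_active ?W ?T v"
    unfolding pr_active_def by (intro pr_cong) (auto simp: active_append)
  show ?thesis unfolding 1 2
    by (rule order_trans[OF pr_diff_le]) (unfold 3, rule pr_active_step_law[OF assms])
qed

text \<open>
  Transience, in quantitative form: the term with index \<open>m\<close> sums up over \<open>t\<close> to at most
  \<open>spread_ratio L ^ m / scale_ratio L ^ (m + 1)\<close>, a geometric sequence with ratio \<open>1/2\<close>.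
  The first summand is the error of working on a finite level.
\<close>

lemma sum_hit_bound: 
  shows "(\<Sum>t<N. hit_bound L \<nu> t j) \<le> real N * spread_ratio L ^ \<nu> + 2 ^ (3 * L + 2) * (1/2) ^ j"
proof -
  have "(\<Sum>t<N. hit_bound L \<nu> t j) = real N * spread_ratio L ^ \<nu>
      + (\<Sum>m\<in>{j..<\<nu>}. (1 - spread_ratio L) * spread_ratio L ^ m * (\<Sum>t<N. (1 - scale_ratio L ^ (m + 1)) ^ t))"
    unfolding hit_bound_def sum.distrib by (subst sum.swap) (simp add: sum_distrib_left)
  also have "(\<Sum>m\<in>{j..<\<nu>}. (1 - spread_ratio L) * spread_ratio L ^ m *
    (\<Sum>t<N. (1 - scale_ratio L ^ (m + 1)) ^ t))
      \<le> (\<Sum>m\<in>{j..<\<nu>}. 2 ^ (3 * L + 1) * (1/2) ^ m)"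
  proof (rule sum_mono)
    fix m
    have o: "0 < scale_ratio L ^ (m + 1)" using scale_ratio_bounds[of L] by simp
    have "(\<Sum>t<N. (1 - scale_ratio L ^ (m + 1)) ^ t) \<le> 1 / scale_ratio L ^ (m + 1)"
    proof -
      have "scale_ratio L ^ (m + 1) * (\<Sum>t<N. (1 - scale_ratio L ^ (m + 1)) ^ t)
        = 1 - (1 - scale_ratio L ^ (m + 1)) ^ N"
        using one_diff_power_eq[of "1 - scale_ratio L ^ (m + 1)" N] by simp
      also have "\<dots> \<le> 1" using scale_ratio_pow[of L "m + 1"] by simp
      finally show ?thesis using o by (simp add: field_simps)
    qed
    then have "(1 - spread_ratio L) * spread_ratio L ^ m * (\<Sum>t<N. (1 - scale_ratio L ^ (m + 1)) ^ t)
      \<le> 1 * spread_ratio L ^ m * (1 / scale_ratio L ^ (m + 1))"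
      using spread_ratio_bounds[of L] scale_ratio_pow[of L]
      by (intro mult_mono) (auto intro!: sum_nonneg simp del: power_Suc)
    also have "\<dots> = 2 ^ (3 * L + 1) * (1/2) ^ m"
      using scale_ratio_bounds[of L]
        by (simp add: spread_ratio_eq power_divide) (simp add: scale_ratio_def power_one_over)
    finally show "(1 - spread_ratio L) * spread_ratio L ^ m *
      (\<Sum>t<N. (1 - scale_ratio L ^ (m + 1)) ^ t) \<le> 2 ^ (3 * L + 1) * (1/2) ^ m" .
  qed
  also have "\<dots> \<le> 2 ^ (3 * L + 1) * (2 * (1/2) ^ j)"
  proof -
    have "(\<Sum>m\<in>{j..<\<nu>}. (1/2::real) ^ m) \<le> 2 * (1/2) ^ j"
    proof (cases "j \<le> \<nu>")
      case True
      then have "(\<Sum>m\<in>{j..<\<nu>}. (1/2::real) ^ m) = 2 * (1/2) ^ j - 2 * (1/2) ^ \<nu>"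
        by (induction \<nu> rule: dec_induct) auto
      then show ?thesis by simp
    qed simp
    then show ?thesis by (simp add: sum_distrib_left[symmetric])
  qed
  finally show ?thesis by (simp add: algebra_simps)
qed

lemma walk_active_sum:
  assumes E: "\<And>w. w \<in> set_pmf E \<Longrightarrow> card (active_set (3 * (L + 1) * \<nu>) w) \<le> 1"
    and \<nu>: "(3 * L + 2) * j \<le> \<nu>" "0 < \<nu>" and v: "length v = 3 * (L + 1) * \<nu>"
  shows "(\<Sum>t<N. \<bar>pr (walk (step_law L j E) (Suc t)) (\<lambda>w. active w v) - pr (walk (step_law L j E) t)
    (\<lambda>w. active w v)\<bar>)
    \<le> 3 * (real N * spread_ratio L ^ \<nu> + 2 ^ (3 * L + 2) * (1/2) ^ j)"
proof -
  have "(\<Sum>t<N. \<bar>pr (walk (step_law L j E) (Suc t)) (\<lambda>w. active w v) - pr (walk (step_law L j E) t)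
    (\<lambda>w. active w v)\<bar>)
    \<le> (\<Sum>t<N. 3 * hit_bound L \<nu> t j)"
    by (intro sum_mono pr_active_walk_diff[OF assms])
  also have "\<dots> \<le> 3 * (real N * spread_ratio L ^ \<nu> + 2 ^ (3 * L + 2) * (1/2) ^ j)"
    using sum_hit_bound[of L \<nu> j N] by (simp add: sum_distrib_left[symmetric])
  finally show ?thesis .
qed

section \<open>Words and the Grigorchuk group\<close>

lemma mult_Grigorchuk [simp]: "mult Grigorchuk g h = h \<circ> g"
  by (simp add: Grigorchuk_def subgroup_generated_def tree_Aut_def)

lemma one_Grigorchuk [simp]: "one Grigorchuk = id"
  by (simp add: Grigorchuk_def subgroup_generated_def tree_Aut_def)

lemma group_Grigorchuk: "group Grigorchuk"
  unfolding Grigorchuk_def by (rule group.group_subgroup_generated[OF group_tree_Aut])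

lemma word_map_append_comp: "word_map (u @ w) = word_map w \<circ> word_map u"
  by (rule ext) simp

lemma word_map_single: "word_map [l] = letter_map l"
  by (rule ext) simp

lemma letter_map_in_gens: "letter_map l \<in> grig_gens"
  by (cases l) (auto simp: grig_gens_def)

lemma gens_letter_map: "grig_gens = range letter_map"
proof -
  have U: "UNIV = {LA, LB, LC, LD}" using letter.exhaust by auto
  show ?thesis unfolding grig_gens_def U by simp
qed

lemma inv_tree_letter_map: "m_inv tree_Aut (letter_map l) = letter_map l"
proof -
  have "letter_map l \<in> carrier tree_Aut" using letter_map_in_gens grig_gens_subset by blast
  then show ?thesis
    by (intro group.inv_equality[OF group_tree_Aut]) (auto simp: tree_Aut_def fun_eq_iff)
qed

lemma carrier_eq_range_word_map: "carrier Grigorchuk = range word_map"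
proof
  show "carrier Grigorchuk \<subseteq> range word_map"
  proof
    fix g assume "g \<in> carrier Grigorchuk"
    then have "g \<in> generate tree_Aut grig_gens" by (simp add: carrier_Grigorchuk)
    then show "g \<in> range word_map"
    proof induction
      case one
      have "one tree_Aut = word_map []" by (auto simp: tree_Aut_def)
      then show ?case by (rule range_eqI)
    next
      case (incl h)
      then obtain l where "h = letter_map l" by (auto simp: gens_letter_map)
      then have "h = word_map [l]" by auto
      then show ?case by (rule range_eqI)
    next
      case (inv h)
      then obtain l where "h = letter_map l" by (auto simp: gens_letter_map)
      then have "m_inv tree_Aut h = word_map [l]"
        by (auto simp: inv_tree_letter_map simp del: letter_map.simps)
      then show ?case by (rule range_eqI)
    next
      case (eng h1 h2)
      then obtain u w where "h1 = word_map u" "h2 = word_map w" by blast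
      then have "mult tree_Aut h1 h2 = word_map (u @ w)"
        by (simp add: tree_Aut_def word_map_append_comp)
      then show ?case by (rule range_eqI)
    qed
  qed
  have "word_map w \<in> generate tree_Aut grig_gens" for w
  proof (induction w)
    case Nil
    have "word_map [] = one tree_Aut" by (auto simp: tree_Aut_def)
    then show ?case using generate.one by metis
  next
    case (Cons l w)
    have "word_map (l # w) = mult tree_Aut (letter_map l) (word_map w)" by (auto simp: tree_Aut_def)
    then show ?case using generate.eng[OF generate.incl[OF letter_map_in_gens] Cons] by simp
  qed
  then show "range word_map \<subseteq> carrier Grigorchuk" by (auto simp: carrier_Grigorchuk)
qed

lemma inv_word_map: "m_inv Grigorchuk (word_map w) = word_map (rev w)"
  by (intro group.inv_equality[OF group_Grigorchuk]) (auto simp: carrier_eq_range_word_map fun_eq_iff)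

lemma foldr_letter_map: "foldr (mult Grigorchuk) (map letter_map w) (one Grigorchuk) = word_map w"
  by (induction w) auto

lemma gens_inv: "grig_gens \<union> m_inv Grigorchuk ` grig_gens = range letter_map"
proof -
  have "m_inv Grigorchuk (letter_map l) = letter_map l" for l
    using inv_word_map[of "[l]"] by (simp add: word_map_single del: letter_map.simps)
  then show ?thesis by (auto simp: gens_letter_map)
qed

lemma word_length_le: "word_length Grigorchuk grig_gens (word_map w) \<le> length w"
  unfolding word_length_def gens_inv
  by (rule Least_le) (rule exI[of _ "map letter_map
    w"], auto simp del: mult_Grigorchuk one_Grigorchuk simp: foldr_letter_map)

lemma list_range_letter_map: "set ws \<subseteq> range letter_map \<longleftrightarrow> (\<exists>w. ws = map letter_map w)"
proof (induction ws)
  case (Cons x ws)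
  then show ?case by (auto simp: Cons_eq_map_conv)
qed simp

text \<open>
  The generating set is closed under inverses, so words over the four letters suffice.
\<close>

lemma word_length_attained:
  "\<exists>w'. word_map w' = word_map w \<and> length w' = word_length Grigorchuk grig_gens (word_map w)"
proof -
  let ?P = "\<lambda>n. \<exists>ws. length ws = n \<and> set ws \<subseteq> range letter_map
    \<and> foldr (mult Grigorchuk) ws (one Grigorchuk) = word_map w"
  have "?P (length w)"
    by (rule exI[of _ "map letter_map
      w"]) (auto simp del: mult_Grigorchuk one_Grigorchuk simp: foldr_letter_map)
  then have "?P (LEAST n. ?P n)" by (rule LeastI)
  then obtain ws where ws: "length ws = word_length Grigorchuk grig_gens (word_map w)"
    "set ws \<subseteq> range letter_map"
    "foldr (mult Grigorchuk) ws (one Grigorchuk) = word_map w"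
    unfolding word_length_def gens_inv by blast
  then obtain w' where "ws = map letter_map w'" by (auto simp: list_range_letter_map)
  then show ?thesis using ws foldr_letter_map[of w'] by auto
qed

lemma finite_words_le: "finite {w :: letter list. length w \<le> n}"
proof -
  have "UNIV = {LA, LB, LC, LD}" using letter.exhaust by auto
  then have "finite (UNIV :: letter set)" by (metis finite.emptyI finite.insertI)
  then show ?thesis using finite_lists_length_le[of "UNIV :: letter set" n] by simp
qed

lemma growth_eq: "growth Grigorchuk grig_gens n = card (word_map ` {w. length w \<le> n})"
proof -
  have "{g \<in> carrier Grigorchuk. word_length Grigorchuk grig_gens g \<le> n}
    = word_map ` {w. length w \<le> n}"
  proof (intro equalityI subsetI)
    fix g assume "g \<in> {g \<in> carrier Grigorchuk. word_length Grigorchuk grig_gens g \<le> n}"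
    then obtain w where "g = word_map w" "word_length Grigorchuk grig_gens (word_map w) \<le> n"
      by (auto simp: carrier_eq_range_word_map)
    moreover obtain w' where "word_map w' = word_map w"
      "length w' = word_length Grigorchuk grig_gens (word_map w)"
      using word_length_attained by blast
    ultimately show "g \<in> word_map ` {w. length w \<le> n}" by (intro image_eqI[of _ _ w']) auto
  next
    fix g assume "g \<in> word_map ` {w. length w \<le> n}"
    then show "g \<in> {g \<in> carrier Grigorchuk. word_length Grigorchuk grig_gens g \<le> n}"
      using word_length_le order_trans by (auto simp: carrier_eq_range_word_map)
  qed
  then show ?thesis by (simp add: growth_def)
qed

section \<open>Lengths\<close>

lemma lambda0_facts: "lambda0 > 2" "lambda0 ^ 3 = lambda0\<^sup>2 + 2 * lambda0 + 4"
proof -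
  have "lambda0 > 0 \<and> poly [:-4, -2, -1, 1:] lambda0 = 0"
    unfolding lambda0_def by (rule theI'[OF lambda0_ex1])
  then have pos: "lambda0 > 0" and eq: "lambda0 ^ 3 = lambda0\<^sup>2 + 2 * lambda0 + 4"
    by (auto simp: algebra_simps power2_eq_square power3_eq_cube)
  show "lambda0 ^ 3 = lambda0\<^sup>2 + 2 * lambda0 + 4" by fact
  have "lambda0 * ((lambda0 - 2) * (lambda0 + 1)) = 4"
    using eq by (simp add: algebra_simps power2_eq_square power3_eq_cube)
  then have "0 < lambda0 * ((lambda0 - 2) * (lambda0 + 1))" by simp
  then show "lambda0 > 2" using pos by (simp add: zero_less_mult_iff)
qed

text \<open>
  An eigenvector of the incidence matrix of the substitution for the eigenvalue \<open>\<lambda>\<^sub>0\<close>; at \<open>b\<close> the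
  eigenvector equation is the defining equation of \<open>\<lambda>\<^sub>0\<close>.
\<close>

fun letter_weight :: "letter \<Rightarrow> real" where
  "letter_weight LA = 0" | "letter_weight LB = 1" | "letter_weight LC
    = 2 / lambda0" | "letter_weight LD = 4 / lambda0\<^sup>2"

definition word_weight :: "letter list \<Rightarrow> real"
  where "word_weight xs = sum_list (map letter_weight xs)"

lemma word_weight_simps [simp]: "word_weight [] = 0"
  "word_weight (x # xs) = letter_weight x + word_weight xs"
  "word_weight (xs @ ys) = word_weight xs + word_weight ys"
  by (auto simp: word_weight_def)

lemma word_weight_lift_letter: "word_weight (lift_letter x) = lambda0 * letter_weight x"
proof (cases x)
  case LB
  have "1 + 2 / lambda0 + 4 / lambda0\<^sup>2 = (lambda0\<^sup>2 + 2 * lambda0 + 4) / lambda0\<^sup>2"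
    using lambda0_facts(1) by (simp add: add_divide_distrib power2_eq_square)
  also have "\<dots> = lambda0" unfolding lambda0_facts(2)[symmetric]
    using lambda0_facts(1) by (simp add: power2_eq_square power3_eq_cube)
  finally have "1 + 2 / lambda0 + 4 / lambda0\<^sup>2 = lambda0" .
  then show ?thesis using LB lambda0_facts(1) by simp
next
  case LC then show ?thesis using lambda0_facts(1) by (simp add: field_simps)
next
  case LD then show ?thesis using lambda0_facts(1) by (simp add: field_simps power2_eq_square)
qed simp

lemma word_weight_lift_funpow: "word_weight ((lift ^^ m) xs) = lambda0 ^ m * word_weight xs"
proof -
  have "word_weight (lift xs) = lambda0 * word_weight xs" for xs
    by (induction xs) (auto simp: word_weight_lift_letter algebra_simps)
  then show ?thesis by (induction m) auto
qed

lemma length_le_word_weight: "LA \<notin> set xs \<Longrightarrow> real (length xs) \<le> lambda0\<^sup>2 / 4 * word_weight xs"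
proof (induction xs)
  case (Cons x xs)
  have "1 \<le> lambda0\<^sup>2 / 4 * letter_weight x"
  proof -
    have "4 \<le> lambda0\<^sup>2" using lambda0_facts(1) power_mono[of 2 lambda0 2] by simp
    then show ?thesis using Cons.prems lambda0_facts(1)
      by (cases x) (auto simp: field_simps power2_eq_square)
  qed
  then show ?case using Cons by (simp add: distrib_left)
qed simp

lemma length_flip_word: "real (length (flip_word m)) \<le> lambda0 ^ Suc m"
proof -
  let ?xs = "(lift ^^ m) [flip_letter m]"
  have "LA \<notin> set ?xs"
    by (cases m) (auto simp: flip_letter_def lift_not_LA)
  then have "real (length ?xs) \<le> lambda0\<^sup>2 / 4 * (lambda0 ^ m * letter_weight (flip_letter m))"
    using length_le_word_weight[of ?xs] by (simp add: word_weight_lift_funpow)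
  also have "letter_weight (flip_letter m) \<le> 2 / lambda0"
    using lambda0_facts(1) by (auto simp: flip_letter_def field_simps power2_eq_square)
  then have "lambda0\<^sup>2 / 4 * (lambda0 ^ m * letter_weight (flip_letter m))
      \<le> lambda0\<^sup>2 / 4 * (lambda0 ^ m * (2 / lambda0))"
    using lambda0_facts(1) by (intro mult_left_mono) auto
  also have "\<dots> = lambda0 ^ Suc m / 2" using lambda0_facts(1)
    by (simp add: field_simps power2_eq_square)
  finally have "2 * real (length ?xs) \<le> lambda0 ^ Suc m" by simp
  moreover have "length (alternating xs) = 2 * length xs" for xs by (induction xs) auto
  ultimately show ?thesis by (simp add: flip_word_def)
qed

text \<open>
  A geometric sum, with \<open>\<lambda>\<^sub>0 > 2\<close> absorbing the constant.
\<close>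

lemma length_flip_cube: "w \<in> set_pmf (flip_cube J M) \<Longrightarrow> real (length w) \<le> lambda0 ^ Suc M"
proof (induction M arbitrary: w)
  case 0
  then show ?case using lambda0_facts(1) by simp
next
  case (Suc M)
  have le: "lambda0 ^ Suc M + lambda0 ^ Suc M \<le> lambda0 ^ Suc (Suc M)"
    using lambda0_facts(1) mult_right_mono[of 2 lambda0 "lambda0 ^ Suc M"] by simp
  have nonneg: "0 \<le> lambda0 ^ Suc M" using lambda0_facts(1) by simp
  show ?case
  proof (cases "J M")
    case True
    then obtain u x where w: "w = u @ x" "u \<in> set_pmf (flip_cube J M)" "x \<in> {flip_word M, []}"
      using Suc.prems by (auto simp: set_cat_pmf set_flip_cube_step)
    then have "real (length w) \<le> real (length u) + real (length (flip_word M))" by auto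
    then show ?thesis using Suc.IH[OF w(2)] length_flip_word[of M] le by linarith
  next
    case False
    then have "real (length w) \<le> lambda0 ^ Suc M" using Suc by simp
    then show ?thesis using le nonneg by linarith
  qed
qed

lemma length_symmetrize:
  "(\<And>w. w \<in> set_pmf p \<Longrightarrow> real (length w) \<le> b) \<Longrightarrow> w \<in> set_pmf (symmetrize p) \<Longrightarrow> real (length w) \<le> b"
  by (auto simp: set_symmetrize)

definition length_ratio :: "nat \<Rightarrow> real" where "length_ratio L = lambda0 ^ (3 * (L + 1))"

text \<open>
  The two clean factors have bounded length; the last summand leaves room for an inserted letter.
\<close>

definition length_const :: "nat \<Rightarrow> nat \<Rightarrow> real" where
  "length_const L j = 2 * lambda0 ^ Suc (3 * ((3 * L + 2) * j)) + lambda0 + 1"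

lemma length_scale_step:
  assumes "w \<in> set_pmf (scale_step L j (return_pmf []) n)"
  shows "real (length w) + 1 \<le> length_const L j * length_ratio L ^ n"
proof -
  have H: "real (length h) \<le> lambda0 ^ Suc (3 * M)" if "h \<in> set_pmf (clean_pmf M)" for h M
    using that unfolding clean_pmf_def by (rule length_symmetrize[rotated]) (rule length_flip_cube)
  have pow: "1 \<le> lambda0 ^ k" for k using lambda0_facts(1) by (simp add: one_le_power)
  have C: "real (length c) \<le> lambda0 * length_ratio L ^ n" if c: "c \<in> set_pmf (scale_pmf L n)" for c
  proof (cases "n = 0")
    case True
    then show ?thesis using c lambda0_facts(1) by (auto simp: scale_pmf_def)
  next
    case False
    then have "c \<in> set_pmf (symmetrize (flip_cube (flipped_digit L n) (3 * (L + 1) * n)))"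
      using c unfolding scale_pmf_def by simp
    then have "real (length c) \<le> lambda0 ^ Suc (3 * (L + 1) * n)"
      by (rule length_symmetrize[rotated]) (rule length_flip_cube)
    then show ?thesis by (simp only: length_ratio_def power_mult power_Suc)
  qed
  obtain h c h' where w: "w = h @ c @ h'" "h \<in> set_pmf (clean_pmf ((3 * L + 2) * j))"
    "c \<in> set_pmf (scale_pmf L n)"
    "h' \<in> set_pmf (clean_pmf ((3 * L + 2) * j))"
    using assms unfolding scale_step_def cat_pmf_Nil set_cat_pmf by blast
  have "1 \<le> length_ratio L ^ n" using pow by (simp add: length_ratio_def one_le_power)
  moreover have "0 \<le> 2 * lambda0 ^ Suc (3 * ((3 * L + 2) * j)) + 1" using lambda0_facts(1) by simp
  ultimately have "(2 * lambda0 ^ Suc (3 * ((3 * L + 2) * j)) + 1) * 1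
      \<le> (2 * lambda0 ^ Suc (3 * ((3 * L + 2) * j)) + 1) * length_ratio L ^ n"
    by (intro mult_left_mono)
  then show ?thesis using H[OF w(2)] H[OF w(4)] C[OF w(3)]
    unfolding w(1) length_const_def by (simp add: algebra_simps)
qed

section \<open>Recovering lamps from group elements\<close>

fun lamp_word :: "letter list list \<Rightarrow> bool list \<Rightarrow> letter list" where
  "lamp_word (u # us) (a # as) = u @ (if a then [LC] else []) @ lamp_word us as"
| "lamp_word _ _ = []"

text \<open>
  The \<open>i\<close>-th entry records whether the word after the \<open>i\<close>-th optional letter touches the lamp at the ray
  vertex, which spoils reading the \<open>i\<close>-th bit.
\<close>

fun decoding_errors :: "nat \<Rightarrow> letter list list \<Rightarrow> bool list \<Rightarrow> bool list" where
  "decoding_errors K (u # us) (a # as) = active (lamp_word us as) (ray_vertex K)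
    # decoding_errors K us as"
| "decoding_errors K _ _ = []"

lemma length_decoding_errors: "length as = length us \<Longrightarrow> length (decoding_errors K us as) = length us"
  by (induction K us as rule: decoding_errors.induct) auto

lemma active_cong: "word_map w = word_map w' \<Longrightarrow> active w v = active w' v"
  using word_map_snoc[of w v True] word_map_snoc[of w' v True] by auto

text \<open>
  The lamp at the vertex that \<open>u\<close> carries to the ray vertex is the sum of three terms: the contribution
  of \<open>u\<close>, which is known, the bit, and the recorded error. Once the bit is known, the first factor can
  be cancelled.
\<close>

lemma decode_lamps:
  assumes "3 dvd K" "K > 0"
    and "length as = length us" "length as' = length us"
    and "word_map (lamp_word us as) = word_map (lamp_word us as')"
      "decoding_errors K us as = decoding_errors K us as'"
  shows "as = as'"
  using assms(3-)
proof (induction us arbitrary: as as')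
  case (Cons u us)
  obtain a bs where as: "as = a # bs" "length bs = length us" using Cons.prems(1) by (cases as) auto
  obtain a' bs' where as': "as' = a' # bs'" "length bs' = length us" using Cons.prems(2)
    by (cases as') auto
  \<comment> \<open>the vertex that \<open>u\<close> carries to the ray vertex\<close>
  let ?x = "word_map (rev u) (ray_vertex K)" and ?c = "\<lambda>a. if a then [LC] else []"
  have fixed: "word_map (?c a) (ray_vertex K) = ray_vertex K" for a
    using letter_map_ray_vertex[of LC K] assms(1,2) by simp
  have bit: "active (lamp_word (u # us) (a # bs)) ?x
    \<longleftrightarrow> active u ?x \<noteq> (a \<noteq> active (lamp_word us bs) (ray_vertex K))" for a bs
    using letter_active_level(3)[OF assms(1,2) length_ray_vertex[OF assms(2)]] fixed[of a]
    by (auto simp: active_append simp del: letter_map.simps)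
  have "active (lamp_word us bs) (ray_vertex K) = active (lamp_word us bs') (ray_vertex K)"
    "decoding_errors K us bs = decoding_errors K us bs'"
    using Cons.prems(4) by (auto simp: as as')
  moreover from this(1) have aa: "a = a'"
    using active_cong[OF Cons.prems(3), of ?x] bit[of a bs] bit[of a' bs'] by (auto simp: as as')
  moreover have "word_map (lamp_word us bs) = word_map (lamp_word us bs')"
  proof
    fix v
    show "word_map (lamp_word us bs) v = word_map (lamp_word us bs') v"
      using fun_cong[OF Cons.prems(3), of "word_map (rev (u @ ?c a)) v"] aa
      by (simp only: as(1) as'(1) lamp_word.simps append_assoc[symmetric] word_map_append[of _
        "lamp_word _ _"] word_map_word_map_rev)
  qed
  ultimately show ?case using Cons.IH[OF as(2) as'(2)] by (simp add: as as')
qed simp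

definition sparse_patterns :: "nat \<Rightarrow> bool list set" where
  "sparse_patterns M = {e. length e = 4 * M \<and> count_list e True \<le> M}"

text \<open>
  Chernoff's bound: a pattern with at most \<open>M\<close> ones has weight at least \<open>4\<^sup>-\<^sup>M\<close> if every one is weighted
  by \<open>1/4\<close>.
\<close>

lemma card_sparse_patterns: "real (card (sparse_patterns M)) \<le> (625 / 64) ^ M"
proof -
  have sum: "(\<Sum>e | length e = n. (1/4::real) ^ count_list e True) = (5/4) ^ n" for n
  proof (induction n)
    case (Suc n)
    have S: "{e :: bool list. length e = Suc n}
      = (#) True ` {e. length e = n} \<union> (#) False ` {e. length e = n}"
      by (auto simp: length_Suc_conv image_iff)
    show ?case unfolding S
      by (subst sum.union_disjoint) (auto simp: card_vertices sum.reindex Suc sum_divide_distrib[symmetric])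
  qed simp
  have "real (card (sparse_patterns M)) * (1/4) ^ M = (\<Sum>e\<in>sparse_patterns M. (1/4) ^ M)" by simp
  also have "\<dots> \<le> (\<Sum>e\<in>sparse_patterns M. (1/4) ^ count_list e True)"
    by (intro sum_mono power_decreasing) (auto simp: sparse_patterns_def)
  also have "\<dots> \<le> (\<Sum>e | length e = 4 * M. (1/4) ^ count_list e True)"
    by (intro sum_mono2 card_vertices) (auto simp: sparse_patterns_def)
  also have "\<dots> = (625/256) ^ M"
  proof -
    have "(5/4 :: real) ^ 4 = 625/256" by (simp add: power_divide)
    then show ?thesis unfolding sum power_mult by (simp only:)
  qed
  finally have "real (card (sparse_patterns M)) \<le> (625/256) ^ M * 4 ^ M" by (simp add: field_simps)
  then show ?thesis by (simp add: power_mult_distrib[symmetric])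
qed

lemma pmf_replicate_coin: "length as = N \<Longrightarrow> pmf (replicate_pmf N coin) as = (1/2) ^ N"
proof (induction N arbitrary: as)
  case (Suc N)
  obtain a bs where as: "as = a # bs" "length bs = N" using Suc.prems by (cases as) auto
  have "replicate_pmf (Suc N) coin
    = map_pmf (\<lambda>(x, xs). x # xs) (pair_pmf coin (replicate_pmf N coin))"
    by (simp add: pair_pmf_def map_pmf_def bind_assoc_pmf bind_return_pmf)
  then have "pmf (replicate_pmf (Suc N) coin) as
      = pmf (map_pmf (\<lambda>(x, xs). x # xs) (pair_pmf coin (replicate_pmf N coin))) ((\<lambda>(x, xs). x # xs) (a, bs))"
    by (simp add: as)
  also have "\<dots> = pmf (pair_pmf coin (replicate_pmf N coin)) (a, bs)"
    by (intro pmf_map_inj') (auto simp: inj_on_def)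
  also have "\<dots> = (1/2) ^ Suc N" using Suc.IH[OF as(2)] by (simp add: pmf_pair coin_def)
  finally show ?case .
qed simp

text \<open>
  Bits and element determine each other up to the error pattern, and there are much fewer sparse patterns
  than bit strings: \<open>16 / (625/64) = 1024/625\<close>.
\<close>

lemma count_images:
  assumes K: "3 dvd K" "K > 0" and us: "length us = 4 * M"
    and pr: "1/2 \<le> pr (replicate_pmf (4 * M) coin)
      (\<lambda>as. count_list (decoding_errors K us as) True \<le> M)"
    and X: "finite X" "\<And>as. length as = 4 * M \<Longrightarrow> word_map (lamp_word us as) \<in> X"
  shows "1/2 * (1024/625) ^ M \<le> real (card X)"
proof -
  let ?G = "{as. length as = 4 * M \<and> count_list (decoding_errors K us as) True \<le> M}"
  have fin: "finite ?G" using card_vertices(1)[of "4 * M"] by (rule rev_finite_subset) auto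
  have "1/2 \<le> measure_pmf.prob (replicate_pmf (4 * M) coin) ?G"
    using pr by (rule order_trans) (auto intro!: pr_mono simp: set_replicate_pmf)
  also have "\<dots> = (\<Sum>as\<in>?G. pmf (replicate_pmf (4 * M) coin) as)"
    by (rule measure_measure_pmf_finite[OF fin])
  also have "\<dots> = real (card ?G) * (1/2) ^ (4 * M)"
    by (simp add: pmf_replicate_coin)
  also have "(1/2 :: real) ^ (4 * M) = 1 / 16 ^ M" by (simp add: power_mult power_one_over)
  finally have G: "1/2 * 16 ^ M \<le> real (card ?G)" by (simp add: field_simps)
  have "inj_on (\<lambda>as. (word_map (lamp_word us as), decoding_errors K us as)) ?G"
  proof (rule inj_onI)
    fix as as' assume "as \<in> ?G" "as' \<in> ?G"
      "(word_map (lamp_word us as), decoding_errors K us as)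
        = (word_map (lamp_word us as'), decoding_errors K us as')"
    then show "as = as'" using us by (intro decode_lamps[OF K, of as us as']) auto
  qed
  moreover have "(\<lambda>as. (word_map (lamp_word us as), decoding_errors K us as)) ` ?G \<subseteq> X \<times>
    sparse_patterns M"
    using X(2) us by (auto simp: sparse_patterns_def length_decoding_errors)
  moreover have "finite (sparse_patterns M)"
    using card_vertices(1)[of "4 * M"] by (rule rev_finite_subset) (auto simp: sparse_patterns_def)
  ultimately have "card ?G \<le> card (X \<times> sparse_patterns M)"
    using X(1) by (intro card_inj_on_le) auto
  then have "1/2 * 16 ^ M \<le> real (card X) * real (card (sparse_patterns M))"
    using G by (simp add: card_cartesian_product del: of_nat_mult add: of_nat_mult[symmetric])
  also have "\<dots> \<le> real (card X) * (625/64) ^ M"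
    by (intro mult_left_mono card_sparse_patterns) simp
  finally have "1/2 * 16 ^ M / (625/64) ^ M \<le> real (card X)" by (simp add: field_simps)
  moreover have "16 ^ M / (625/64) ^ M = (1024/625 :: real) ^ M"
    unfolding power_divide[symmetric] by simp
  ultimately show ?thesis by simp
qed

section \<open>Expected errors\<close>

definition indexed_step :: "nat \<Rightarrow> nat \<Rightarrow> (nat \<times> letter list) pmf" where
  "indexed_step L j = bind_pmf (scale_law L)
    (\<lambda>n. map_pmf (Pair n) (scale_step L j (return_pmf []) n))"

definition lamp_coin :: "letter list pmf" where
  "lamp_coin = map_pmf (\<lambda>s. if s then [LC] else []) coin"

lemma walk_Suc': "walk T (Suc t) = cat_pmf T (walk T t)"
  by (induction t) (simp_all add: cat_pmf_assoc)

lemma step_law_lamp_coin: "step_law L j lamp_coin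
  = cat_pmf (map_pmf snd (indexed_step L j)) lamp_coin"
  by (simp add: step_law_def indexed_step_def scale_step_def[abs_def] map_bind_pmf map_pmf_comp
    cat_pmf_bind_left cat_pmf_assoc)

text \<open>
  The word with random steps and random bits is a walk, to which the estimates on lamps apply.
\<close>

lemma lamp_word_law:
  "bind_pmf (replicate_pmf N (indexed_step L j))
    (\<lambda>xs. map_pmf (lamp_word (map snd xs)) (replicate_pmf N coin))
     = walk (step_law L j lamp_coin) N"
proof (induction N)
  case 0
  show ?case by (simp add: bind_return_pmf)
next
  case (Suc N)
  let ?S = "indexed_step L j" and ?R = "replicate_pmf N (indexed_step L j)"
    and ?B = "replicate_pmf N coin"
  have inner: "bind_pmf ?R (\<lambda>xs. bind_pmf ?B
    (\<lambda>as. return_pmf (snd x @ (if a then [LC] else []) @ lamp_word (map snd xs) as)))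
      = map_pmf (\<lambda>w. snd x @ (if a then [LC] else []) @ w) (walk (step_law L j lamp_coin) N)" for x
        :: "nat \<times> letter list" and a
    unfolding Suc.IH[symmetric] by (simp add: map_pmf_def bind_assoc_pmf bind_return_pmf)
  have "bind_pmf (replicate_pmf (Suc N) ?S)
    (\<lambda>xs. map_pmf (lamp_word (map snd xs)) (replicate_pmf (Suc N) coin))
    = bind_pmf ?S (\<lambda>x. bind_pmf ?R (\<lambda>xs. bind_pmf coin (\<lambda>a. bind_pmf ?B (\<lambda>as.
        return_pmf (snd x @ (if a then [LC] else []) @ lamp_word (map snd xs) as)))))"
    by (simp add: map_pmf_def bind_assoc_pmf bind_return_pmf)
  also have "\<dots> = bind_pmf ?S (\<lambda>x. bind_pmf coin (\<lambda>a. bind_pmf ?R (\<lambda>xs. bind_pmf ?B (\<lambda>as.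
        return_pmf (snd x @ (if a then [LC] else []) @ lamp_word (map snd xs) as)))))"
    by (subst bind_commute_pmf) (rule refl)
  also have "\<dots> = bind_pmf ?S (\<lambda>x. bind_pmf coin (\<lambda>a.
        map_pmf (\<lambda>w. snd x @ (if a then [LC] else []) @ w) (walk (step_law L j lamp_coin) N)))"
    unfolding inner ..
  also have "bind_pmf ?S (\<lambda>x. bind_pmf coin (\<lambda>a.
        map_pmf (\<lambda>w. snd x @ (if a then [LC] else []) @ w) (walk (step_law L j lamp_coin) N)))
      = cat_pmf (step_law L j lamp_coin) (walk (step_law L j lamp_coin) N)"
    by (subst (2) step_law_lamp_coin) (simp add: cat_pmf_def lamp_coin_def map_pmf_def bind_assoc_pmf bind_return_pmf)
  finally show ?case by (simp only: walk_Suc')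
qed

lemma expected_errors:
  "(\<integral>\<^sup>+xs. \<integral>\<^sup>+as. of_nat (count_list (decoding_errors K (map snd xs) as) True)
       \<partial>measure_pmf (replicate_pmf N coin) \<partial>measure_pmf (replicate_pmf N (indexed_step L j)))
    = (\<Sum>t<N. ennreal (pr (walk (step_law L j lamp_coin) t) (\<lambda>w. active w (ray_vertex K))))"
proof (induction N)
  case (Suc N)
  let ?S = "indexed_step L j" and ?R = "replicate_pmf N (indexed_step L j)"
    and ?B = "replicate_pmf N coin"
  let ?f = "\<lambda>xs as. of_nat (count_list (decoding_errors K (map snd xs) as) True) :: ennreal"
  have "(\<integral>\<^sup>+xs. \<integral>\<^sup>+as. ?f xs as \<partial>measure_pmf (replicate_pmf (Suc N) coin) \<partial>measure_pmf
    (replicate_pmf (Suc N) ?S))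
    = (\<integral>\<^sup>+xs. \<integral>\<^sup>+as. indicator {w. active w (ray_vertex K)} (lamp_word (map snd xs) as) + ?f xs as
        \<partial>measure_pmf ?B \<partial>measure_pmf ?R)"
    by (simp, intro nn_integral_cong, simp add: indicator_def)
  also have "\<dots> = (\<integral>\<^sup>+xs. \<integral>\<^sup>+as. indicator {w. active w (ray_vertex K)} (lamp_word (map snd xs) as)
    \<partial>measure_pmf ?B \<partial>measure_pmf ?R)
     + (\<integral>\<^sup>+xs. \<integral>\<^sup>+as. ?f xs as \<partial>measure_pmf ?B \<partial>measure_pmf ?R)"
    by (simp add: nn_integral_add)
  also have "(\<integral>\<^sup>+xs. \<integral>\<^sup>+as. indicator {w. active w (ray_vertex K)} (lamp_word (map snd xs) as)
    \<partial>measure_pmf ?B \<partial>measure_pmf ?R)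
     = (\<integral>\<^sup>+w. indicator {w. active w (ray_vertex K)} w \<partial>measure_pmf (walk (step_law L j lamp_coin) N))"
    unfolding lamp_word_law[symmetric] by simp
  also have "\<dots> = ennreal (pr (walk (step_law L j lamp_coin) N) (\<lambda>w. active w (ray_vertex K)))"
    by (simp add: measure_pmf.emeasure_eq_measure)
  finally show ?case unfolding Suc.IH by (simp add: add.commute)
qed simp

lemma expected_length_cost:
  "(\<integral>\<^sup>+xs. (\<Sum>x\<leftarrow>xs. f (fst x)) \<partial>measure_pmf (replicate_pmf N (indexed_step L j)))
     = of_nat N * (\<integral>\<^sup>+n. f n \<partial>measure_pmf (scale_law L))" for f :: "nat \<Rightarrow> ennreal"
proof (induction N)
  case (Suc N)
  have "(\<integral>\<^sup>+x. f (fst x) \<partial>measure_pmf (indexed_step L j)) = (\<integral>\<^sup>+n. f n \<partial>measure_pmf (scale_law L))"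
    by (simp add: indexed_step_def)
  then show ?case using Suc by (simp add: nn_integral_add algebra_simps)
qed simp

section \<open>The lower bound for the growth\<close>

lemma pr_walk_active_le:
  assumes E: "\<And>w. w \<in> set_pmf E \<Longrightarrow> card (active_set (3 * (L + 1) * \<nu>) w) \<le> 1"
    and \<nu>: "(3 * L + 2) * j \<le> \<nu>" "0 < \<nu>" and v: "length v = 3 * (L + 1) * \<nu>"
  shows "pr (walk (step_law L j E) t) (\<lambda>w. active w v)
    \<le> 3 * (real t * spread_ratio L ^ \<nu> + 2 ^ (3 * L + 2) * (1/2) ^ j)"
proof -
  let ?p = "\<lambda>t. pr (walk (step_law L j E) t) (\<lambda>w. active w v)"
  have "(\<Sum>s<t. ?p (Suc s) - ?p s) = ?p t - ?p 0" by (rule sum_lessThan_telescope)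
  moreover have "?p 0 = 0" by simp
  ultimately have "?p t = (\<Sum>s<t. ?p (Suc s) - ?p s)" by linarith
  also have "\<dots> \<le> (\<Sum>s<t. \<bar>?p (Suc s) - ?p s\<bar>)" by (intro sum_mono) (rule abs_ge_self)
  also have "\<dots> \<le> 3 * (real t * spread_ratio L ^ \<nu> + 2 ^ (3 * L + 2) * (1/2) ^ j)"
    by (rule walk_active_sum[OF assms])
  finally show ?thesis .
qed

lemma length_ratio_ge: "2 ^ (3 * L + 3) \<le> length_ratio L"
  unfolding length_ratio_def
    using lambda0_facts(1) power_mono[of 2 lambda0 "3 * L + 3"] by (simp add: algebra_simps)

lemma scale_length_ratio_ge: "4 \<le> scale_ratio L * length_ratio L"
proof -
  have "scale_ratio L * 2 ^ (3 * L + 3) = 4"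
    by (simp add: scale_ratio_def power_add power_mult_distrib[symmetric] power_one_over)
  then show ?thesis using mult_left_mono[OF length_ratio_ge, of "scale_ratio
    L" L] scale_ratio_bounds[of L] by simp
qed

lemma sum_geometric_le: "(4 :: real) \<le> x \<Longrightarrow> (\<Sum>n\<le>m. x ^ n) \<le> 4 / 3 * x ^ m"
proof (induction m)
  case (Suc m)
  then have "4 * x ^ m \<le> x * x ^ m" by (intro mult_right_mono) auto
  then show ?case using Suc.IH[OF Suc.prems] unfolding sum.atMost_Suc power_Suc by linarith
qed simp

lemma exists_below_nn_integral:
  assumes "(\<integral>\<^sup>+x. f x \<partial>measure_pmf p) < (1 :: ennreal)"
  shows "\<exists>x\<in>set_pmf p. f x < 1"
proof (rule ccontr)
  assume "\<not> (\<exists>x\<in>set_pmf p. f x < 1)"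
  then have "(\<integral>\<^sup>+x. 1 \<partial>measure_pmf p) \<le> (\<integral>\<^sup>+x. f x \<partial>measure_pmf p)"
    by (intro nn_integral_mono_AE) (auto simp: AE_measure_pmf_iff not_less)
  then show False using assms by simp
qed

lemma length_const_pos: "length_const L j > 0"
proof -
  have "0 < lambda0" using lambda0_facts(1) by simp
  then show ?thesis unfolding length_const_def by (intro add_pos_pos mult_pos_pos) auto
qed

text \<open>
  The share of a step in the length budget \<open>R\<close>. A step of scale larger than \<open>m\<close> uses up the whole
  budget, so a total cost below 1 excludes such steps.
\<close>

definition length_cost :: "real \<Rightarrow> nat \<Rightarrow> nat \<Rightarrow> nat \<Rightarrow> nat \<Rightarrow> real" where
  "length_cost R L j m n = (if n \<le> m then length_const L j * length_ratio L ^ n / R else 1)"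

text \<open>
  The length grows faster with the scale than its probability decays, so the largest scale \<open>m\<close>
  dominates the expected length.
\<close>

lemma expected_length_cost_le:
  assumes R: "R = 6 * length_const L j * length_ratio L ^ m" and N: "real N * scale_ratio L ^ m = 1"
    and L: "L \<ge> 1"
  shows "of_nat N * (\<integral>\<^sup>+n. ennreal (length_cost R L j m n) \<partial>measure_pmf (scale_law L))
    \<le> ennreal (1/2)"
proof -
  have big: "length_ratio L > 0" using length_ratio_ge[of L] by (smt (verit) zero_less_power)
  have Rpos: "R > 0" using length_const_pos big by (simp add: R)
  let ?f = "\<lambda>n. if n \<le> m then length_const L j * length_ratio L ^ n / R else 0"
  have split: "ennreal (length_cost R L j m n) = ennreal (?f n) + indicator {n. \<not> n \<le> m} n" for n
    by (simp add: length_cost_def indicator_def)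
  have s: "(\<lambda>n. (1 - scale_ratio L) * scale_ratio L ^ n * ?f n) sums
    (\<Sum>n\<le>m. (1 - scale_ratio L) * scale_ratio L ^ n * (length_const L j * length_ratio L ^ n / R))"
    using sums_If_finite_set[of "{..m}"
      "\<lambda>n. (1 - scale_ratio L) * scale_ratio L ^ n * (length_const L j * length_ratio L ^ n / R)"]
    by (simp add: if_distrib cong: if_cong)
  have "(\<Sum>n\<le>m. (1 - scale_ratio L) * scale_ratio L ^ n *
    (length_const L j * length_ratio L ^ n / R))
      = (1 - scale_ratio L) * (length_const L j / R) * (\<Sum>n\<le>m. (scale_ratio L * length_ratio L) ^ n)"
    by (simp add: sum_distrib_left power_mult_distrib mult_ac)
  also have "\<dots> \<le> 1 * (length_const L j / R) * (4 / 3 * (scale_ratio L * length_ratio L) ^ m)"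
    using scale_ratio_bounds[of L] length_const_pos[of L j] Rpos big
    by (intro mult_mono sum_geometric_le scale_length_ratio_ge sum_nonneg) auto
  also have "\<dots> = 2 / 9 * scale_ratio L ^ m"
    using length_const_pos[of L j] big by (simp add: R power_mult_distrib)
  finally have fin: "(\<Sum>n\<le>m. (1 - scale_ratio L) * scale_ratio L ^ n *
    (length_const L j * length_ratio L ^ n / R)) \<le> 2 / 9 * scale_ratio L ^ m" .
  have "(\<integral>\<^sup>+n. ennreal (?f n) \<partial>measure_pmf (scale_law L)) \<le> ennreal (2 / 9 * scale_ratio L ^ m)"
  proof -
    have "(\<integral>\<^sup>+n. ennreal (?f n) \<partial>measure_pmf (scale_law L))
        = ennreal (\<Sum>n\<le>m. (1 - scale_ratio L) * scale_ratio L ^ n * (length_const L j * length_ratio L ^ n / R))"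
      using length_const_pos[of L j] Rpos big by (intro nn_integral_scale_law[OF _ s]) simp
    then show ?thesis using ennreal_leI[OF fin] by (simp only:)
  qed
  moreover have "(\<integral>\<^sup>+n. indicator {n. \<not> n \<le> m} n \<partial>measure_pmf (scale_law L))
    = ennreal (scale_ratio L ^ (m + 1))"
  proof -
    have "(\<integral>\<^sup>+n. indicator {n. \<not> n \<le> m} n \<partial>measure_pmf (scale_law L))
      = ennreal (pr (scale_law L) (\<lambda>n. \<not> n \<le> m))"
      by (simp add: measure_pmf.emeasure_eq_measure)
    also have "pr (scale_law L) (\<lambda>n. \<not> n \<le> m) = 1 - pr (scale_law L) (\<lambda>n. n \<le> m)"
      using measure_pmf.prob_compl[of "{n. n \<le> m}"
        "scale_law L"] by (simp add: Compl_eq_Diff_UNIV[symmetric] Collect_neg_eq)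
    finally show ?thesis by (simp only: pr_scale_law_le) simp
  qed
  ultimately have "(\<integral>\<^sup>+n. ennreal (length_cost R L j m n) \<partial>measure_pmf (scale_law L))
      \<le> ennreal (2 / 9 * scale_ratio L ^ m) + ennreal (scale_ratio L ^ (m + 1))"
    unfolding split by (subst nn_integral_add) (auto intro: add_mono)
  also have "\<dots> = ennreal (2 / 9 * scale_ratio L ^ m + scale_ratio L ^ (m + 1))"
    using scale_ratio_bounds[of L] by (intro ennreal_plus[symmetric]) auto
  finally have "of_nat N * (\<integral>\<^sup>+n. ennreal (length_cost R L j m n) \<partial>measure_pmf (scale_law L))
      \<le> ennreal (real N) * ennreal (2 / 9 * scale_ratio L ^ m + scale_ratio L ^ (m + 1))"
    by (simp add: ennreal_of_nat_eq_real_of_nat mult_left_mono)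
  also have "\<dots> = ennreal (real N * (2 / 9 * scale_ratio L ^ m + scale_ratio L ^ (m + 1)))"
    using scale_ratio_bounds[of L] by (intro ennreal_mult[symmetric]) auto
  also have "real N * (2 / 9 * scale_ratio L ^ m + scale_ratio L ^ (m + 1))
    = (2 / 9 + scale_ratio L) * (real N * scale_ratio L ^ m)"
    by (simp add: algebra_simps)
  also have "\<dots> \<le> 1/2"
  proof -
    have "scale_ratio L \<le> (1/2) ^ 4" unfolding scale_ratio_def using L
      by (intro power_decreasing) auto
    then show ?thesis unfolding N by (simp add: power_one_over)
  qed
  finally show ?thesis by (simp add: ennreal_leI)
qed

text \<open>
  The parameter \<open>3L + 10\<close> of the clean factors is chosen such that
  \<open>3 * 2 ^ (3L+2) / 2 ^ (3L+10) = 3/256\<close> is well below \<open>1/32\<close>.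
\<close>

lemma small_errors:
  assumes \<nu>: "(3 * L + 2) * (3 * L + 10) \<le> \<nu>" "0 < \<nu>" and N: "real N * spread_ratio L ^ \<nu> \<le> 1 / 192"
    and t: "t \<le> N"
  shows "pr (walk (step_law L (3 * L + 10) lamp_coin) t)
    (\<lambda>w. active w (ray_vertex (3 * (L + 1) * \<nu>))) \<le> 1 / 32"
proof -
  have K: "3 dvd 3 * (L + 1) * \<nu>" "3 * (L + 1) * \<nu> > 0" using \<nu>(2) by auto
  have E: "card (active_set (3 * (L + 1) * \<nu>) w) \<le> 1" if "w \<in> set_pmf lamp_coin" for w
  proof -
    from that have "w = [LC] \<or> w = []" by (auto simp: lamp_coin_def split: if_splits)
    then show ?thesis using active_set_letter[OF K, of LC] by (auto simp: active_set_def)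
  qed
  have "pr (walk (step_law L (3 * L + 10) lamp_coin) t)
    (\<lambda>w. active w (ray_vertex (3 * (L + 1) * \<nu>)))
      \<le> 3 * (real t * spread_ratio L ^ \<nu> + 2 ^ (3 * L + 2) * (1/2) ^ (3 * L + 10))"
    by (intro pr_walk_active_le E \<nu> length_ray_vertex K)
  also have "real t * spread_ratio L ^ \<nu> \<le> real N * spread_ratio L ^ \<nu>"
    using t spread_ratio_bounds[of L] by (intro mult_right_mono) auto
  also note N
  also have "2 ^ (3 * L + 2) * (1/2) ^ (3 * L + 10) = (1/256 :: real)"
    by (simp add: power_add power_one_over field_simps)
  finally show ?thesis by simp
qed

text \<open>
  There are \<open>4M\<close> bits. A first moment argument finds steps with few errors for most bits and with
  total length within the budget.
\<close>

lemma growth_at_scale: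
  assumes L: "L \<ge> 1" and M: "4 * M = 2 ^ ((3 * L + 1) * m)" "M \<ge> 2"
    and n: "6 * length_const L (3 * L + 10) * length_ratio L ^ m \<le> real n"
  shows "(11 / 10) ^ M \<le> real (growth Grigorchuk grig_gens n)"
proof -
  let ?j = "3 * L + 10"
  define N where "N = 4 * M"
  define R where "R = 6 * length_const L ?j * length_ratio L ^ m"
  have big: "length_ratio L > 0" using length_ratio_ge[of L] by (smt (verit) zero_less_power)
  have Rpos: "R > 0" using length_const_pos big by (simp add: R_def)
  have Nom: "real N * scale_ratio L ^ m = 1"
    unfolding N_def M(1) scale_ratio_def
      by (simp only: power_mult of_nat_power of_nat_numeral power_mult_distrib[symmetric]) simp
  have Npos: "N > 0" using M(2) by (simp add: N_def)
  \<comment> \<open>The level must be so deep that truncating the scales does not matter for \<open>N\<close> steps.\<close>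
  obtain k where k: "spread_ratio L ^ k < 1 / (192 * real N)"
    using real_arch_pow_inv[of "1 / (192 * real N)"
      "spread_ratio L"] spread_ratio_bounds[of L] Npos by auto
  define \<nu> where "\<nu> = k + (3 * L + 2) * ?j + 1"
  have \<nu>: "(3 * L + 2) * ?j \<le> \<nu>" "0 < \<nu>" by (simp_all add: \<nu>_def)
  have "spread_ratio L ^ \<nu> \<le> spread_ratio L ^ k" using spread_ratio_bounds[of L]
    by (intro power_decreasing) (auto simp: \<nu>_def)
  then have "real N * spread_ratio L ^ \<nu> \<le> real N * (1 / (192 * real N))" using k
    by (intro mult_left_mono) auto
  then have N\<nu>: "real N * spread_ratio L ^ \<nu> \<le> 1 / 192" using Npos by simp
  define K where "K = 3 * (L + 1) * \<nu>"
  have K: "3 dvd K" "K > 0" using \<nu>(2) by (auto simp: K_def)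
  let ?S = "replicate_pmf N (indexed_step L ?j)"
  let ?err = "\<lambda>xs. \<integral>\<^sup>+as. of_nat (count_list (decoding_errors K (map snd xs) as) True) \<partial>measure_pmf
    (replicate_pmf N coin)"
  let ?cost = "\<lambda>xs :: (nat \<times> letter list) list. \<Sum>x\<leftarrow>xs. ennreal (length_cost R L ?j m (fst x))"
  \<comment> \<open>The errors contribute at most \<open>1/4\<close> and the cost at most \<open>1/2\<close>. A total below 1 means that the expected
    number of errors is less than \<open>N/8 = M/2\<close> and that the length budget is kept.\<close>
  have "(\<integral>\<^sup>+xs. ennreal (8 / real N) * ?err xs + ?cost xs \<partial>measure_pmf ?S)
      = ennreal (8 / real N) * (\<integral>\<^sup>+xs. ?err xs \<partial>measure_pmf ?S) + (\<integral>\<^sup>+xs. ?cost xs \<partial>measure_pmf ?S)"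
    by (simp add: nn_integral_add nn_integral_cmult)
  also have "(\<integral>\<^sup>+xs. ?err xs \<partial>measure_pmf ?S) \<le> (\<Sum>t<N. ennreal (1/32))"
    unfolding expected_errors K_def
    by (intro sum_mono ennreal_leI small_errors[OF \<nu> N\<nu>]) simp
  also have "(\<Sum>t<N. ennreal (1/32)) = ennreal (real N / 32)"
    by (simp add: ennreal_of_nat_eq_real_of_nat ennreal_mult[symmetric])
  also have "(\<integral>\<^sup>+xs. ?cost xs \<partial>measure_pmf ?S) \<le> ennreal (1/2)"
    unfolding expected_length_cost[where f = "\<lambda>n. ennreal (length_cost R L ?j m n)"]
    by (rule expected_length_cost_le[OF R_def Nom L])
  also have "ennreal (8 / real N) * ennreal (real N / 32) + ennreal (1/2) = ennreal (3/4)"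
  proof -
    have "ennreal (8 / real N) * ennreal (real N / 32) = ennreal (1/4)"
      using Npos by (simp add: ennreal_mult[symmetric])
    moreover have "ennreal (1/4) + ennreal (1/2) = ennreal (1/4 + 1/2)"
      by (rule ennreal_plus[symmetric]) auto
    ultimately show ?thesis by (simp only:) simp
  qed
  also have "ennreal (3/4) < 1" by (simp add: ennreal_less_one_iff)
  finally have "(\<integral>\<^sup>+xs. ennreal (8 / real N) * ?err xs + ?cost xs \<partial>measure_pmf ?S) < 1"
    by (simp add: add_mono mult_left_mono)
  then obtain xs where xs: "xs \<in> set_pmf ?S" "ennreal (8 / real N) * ?err xs + ?cost xs < 1"
    using exists_below_nn_integral by blast
  then have err: "ennreal (8 / real N) * ?err xs < 1" and cost: "?cost xs < 1"
    by (meson order.strict_trans1 zero_le add_increasing add_increasing2 order_refl)+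
  have len: "length xs = N"
    and mem: "\<And>x. x \<in> set xs \<Longrightarrow> snd x \<in> set_pmf (scale_step L ?j (return_pmf []) (fst x))"
    using xs(1) by (auto simp: set_replicate_pmf indexed_step_def)
  have small: "fst x \<le> m" if "x \<in> set xs" for x
  proof (rule ccontr)
    assume "\<not> fst x \<le> m"
    then have "1 = ennreal (length_cost R L ?j m (fst x))" by (simp add: length_cost_def)
    also have "\<dots> \<le> ?cost xs" using that by (intro member_le_sum_list) auto
    finally have "1 \<le> ?cost xs" .
    with cost show False by simp
  qed
  have lenR: "(\<Sum>x\<leftarrow>xs. real (length (snd x)) + 1) \<le> R"
  proof -
    have "(\<Sum>x\<leftarrow>xs. real (length (snd x)) + 1) \<le> (\<Sum>x\<leftarrow>xs. R * length_cost R L ?j m (fst x))"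
      using small Rpos length_scale_step[OF mem]
        by (intro sum_list_mono) (simp add: length_cost_def)
    also have "\<dots> = R * (\<Sum>x\<leftarrow>xs. length_cost R L ?j m (fst x))" by (simp add: sum_list_const_mult)
    also have "(\<Sum>x\<leftarrow>xs. length_cost R L ?j m (fst x)) \<le> 1"
    proof -
      have nonneg: "0 \<le> length_cost R L ?j m n" for n using length_const_pos[of L ?j] big Rpos
        by (simp add: length_cost_def)
      have "ennreal (\<Sum>x\<leftarrow>ys. length_cost R L ?j m (fst x))
        = (\<Sum>x\<leftarrow>ys. ennreal (length_cost R L ?j m (fst x)))" for ys :: "(nat \<times> letter list) list"
      proof (induction ys)
        case (Cons y ys)
        have "0 \<le> (\<Sum>x\<leftarrow>ys. length_cost R L ?j m (fst x))"
          by (intro sum_list_nonneg) (auto simp: nonneg)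
        then show ?case using Cons nonneg[of "fst y"] by simp
      qed simp
      then have "ennreal (\<Sum>x\<leftarrow>xs. length_cost R L ?j m (fst x)) < 1" using cost by simp
      then show ?thesis by (simp add: ennreal_less_one_iff)
    qed
    finally show ?thesis using Rpos by simp
  qed
  have mix_len: "real (length (lamp_word us as)) \<le> (\<Sum>u\<leftarrow>us. real (length u) + 1)" for us as
  proof (induction us as rule: lamp_word.induct)
    case (1 u us a as)
    then show ?case by simp
  qed (auto intro!: sum_list_nonneg)
  have X: "word_map (lamp_word (map snd xs) as) \<in> word_map ` {w. length w \<le> n}" for as
  proof -
    have "real (length (lamp_word (map snd xs) as)) \<le> real n"
      using mix_len[of "map snd xs" as] lenR n by (simp add: comp_def R_def)
    then show ?thesis by auto
  qed
  have "1/2 \<le> pr (replicate_pmf N coin)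
    (\<lambda>as. count_list (decoding_errors K (map snd xs) as) True \<le> M)"
  proof -
    let ?c = "\<lambda>as. count_list (decoding_errors K (map snd xs) as) True"
      and ?B = "replicate_pmf N coin"
    have "ennreal (8 / real N) * (of_nat M * emeasure (measure_pmf ?B) {as. M < ?c as})
        \<le> ennreal (8 / real N) * ?err xs"
    proof (intro mult_left_mono)
      have "of_nat M * emeasure (measure_pmf ?B) {as. M < ?c as}
          = (\<integral>\<^sup>+as. of_nat M * indicator {as. M < ?c as} as \<partial>measure_pmf ?B)"
        by (simp add: nn_integral_cmult)
      also have "\<dots> \<le> ?err xs" by (intro nn_integral_mono) (auto simp: indicator_def)
      finally show "of_nat M * emeasure (measure_pmf ?B) {as. M < ?c as} \<le> ?err xs" .
    qed simp
    also note err
    also have "ennreal (8 / real N) * (of_nat M * emeasure (measure_pmf ?B) {as. M < ?c as})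
        = ennreal (2 * pr ?B (\<lambda>as. M < ?c as))"
      using M(2) by (simp add: N_def measure_pmf.emeasure_eq_measure
          ennreal_of_nat_eq_real_of_nat ennreal_mult[symmetric])
    finally have "pr ?B (\<lambda>as. M < ?c as) < 1/2" by (simp add: ennreal_less_one_iff)
    moreover have "pr ?B (\<lambda>as. M < ?c as) = 1 - pr ?B (\<lambda>as. ?c as \<le> M)"
      using measure_pmf.prob_compl[of "{as. ?c as \<le> M}" ?B]
      by (simp add: Compl_eq_Diff_UNIV[symmetric] Collect_neg_eq[symmetric] not_le)
    ultimately show ?thesis by simp
  qed
  then have "1/2 * (1024/625) ^ M \<le> real (growth Grigorchuk grig_gens n)"
    unfolding growth_eq N_def
    by (intro count_images[OF K, of "map snd xs"] X finite_imageI finite_words_le)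
      (simp_all add: len N_def)
  moreover have "(11/10 :: real) ^ M \<le> 1/2 * (1024/625) ^ M"
  proof -
    have "(2::real) \<le> (1024/625 / (11/10)) ^ 2" by (simp add: power_divide)
    also have "\<dots> \<le> (1024/625 / (11/10)) ^ M" using M(2) by (intro power_increasing) auto
    also have "\<dots> = (1024/625) ^ M / (11/10) ^ M" by (rule power_divide)
    finally show ?thesis by (simp add: field_simps)
  qed
  ultimately show ?thesis by linarith
qed

lemma growth_ge_2: "n \<ge> 1 \<Longrightarrow> 2 \<le> growth Grigorchuk grig_gens n"
proof -
  assume n: "n \<ge> 1"
  have "word_map [] [True] \<noteq> word_map [LA] [True]" by (simp add: grig_a_simps)
  then have "word_map [] \<noteq> word_map [LA]" by metis
  then have "2 = card {word_map [], word_map [LA]}" by simp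
  also have "\<dots> \<le> card (word_map ` {w. length w \<le> n})"
    using n by (intro card_mono finite_imageI finite_words_le) auto
  finally show ?thesis by (simp add: growth_eq)
qed

definition alpha_approx :: "nat \<Rightarrow> real" where
  "alpha_approx L = (3 * real L + 1) / (3 * real L + 3) * alpha0"

lemma alpha0_pos: "0 < alpha0"
  unfolding alpha0_def using lambda0_facts(1) by simp

lemma alpha_approx_pos: "0 < alpha_approx L"
  unfolding alpha_approx_def using alpha0_pos by (intro mult_pos_pos divide_pos_pos) auto

lemma length_ratio_powr: "length_ratio L powr alpha_approx L = 2 ^ (3 * L + 1)"
proof -
  have "ln lambda0 > 0" using lambda0_facts(1) by simp
  have "length_ratio L powr alpha_approx L
    = exp (alpha_approx L * (real (3 * (L + 1)) * ln lambda0))"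
    using lambda0_facts(1) unfolding length_ratio_def by (simp add: powr_def ln_realpow)
  also have "alpha_approx L * (real (3 * (L + 1)) * ln lambda0) = real (3 * L + 1) * ln 2"
  proof -
    define q where "q = 3 * real L + 3"
    have "q > 0" by (simp add: q_def add_nonneg_pos)
    then have "(3 * real L + 1) / q * (ln 2 / ln lambda0) * (q * ln lambda0)
      = (3 * real L + 1) * ln 2"
      using \<open>ln lambda0 > 0\<close> by simp
    moreover have "real (3 * (L + 1)) = q" "real (3 * L + 1) = 3 * real L + 1"
      by (simp_all add: q_def)
    ultimately show ?thesis unfolding alpha_approx_def alpha0_def q_def[symmetric] by (simp only:)
  qed
  also have "exp (real (3 * L + 1) * ln 2) = (2::real) ^ (3 * L + 1)"
    by (subst exp_of_nat_mult) simp
  finally show ?thesis .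
qed

text \<open>
  The loss is \<open>2\<alpha>\<^sub>0/(3L+3)\<close>.
\<close>

lemma exists_alpha_approx: 
  assumes "\<epsilon> > 0" shows "\<exists>L\<ge>1. alpha0 - \<epsilon> \<le> alpha_approx L"
proof -
  obtain L :: nat where L: "2 * alpha0 / \<epsilon> < real L" using reals_Archimedean2 by blast
  then have "2 * alpha0 < \<epsilon> * real L" using assms by (simp add: field_simps)
  then have "2 * alpha0 \<le> \<epsilon> * (3 * real (L + 1) + 3)" using assms alpha0_pos
    by (simp add: algebra_simps)
  then have "alpha0 - \<epsilon> \<le> alpha_approx (L + 1)"
    unfolding alpha_approx_def by (simp add: field_simps)
  then show ?thesis by (intro exI[of _ "L + 1"]) auto
qed

text \<open>
  Interpolation between the lengths of consecutive scales; below the first scale the two elements \<open>1\<close>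
  and \<open>a\<close> suffice.
\<close>

theorem growth_lower_bound:
  assumes "\<epsilon> > 0"
  shows "\<exists>c>0. \<forall>n::nat. n \<ge> 1 \<longrightarrow>
    real (growth Grigorchuk grig_gens n) \<ge> exp (c * real n powr (alpha0 - \<epsilon>))"
proof -
  obtain L where L: "L \<ge> 1" "alpha0 - \<epsilon> \<le> alpha_approx L" using exists_alpha_approx[OF assms]
    by blast
  define C where "C = 6 * length_const L (3 * L + 10)"
  have C: "C > 0" using length_const_pos by (simp add: C_def)
  have "(2::real) ^ 6 \<le> 2 ^ (3 * L + 3)" using L(1) by (intro power_increasing) auto
  then have big: "1 < length_ratio L" using length_ratio_ge[of L] by simp
  define c where "c = ln (11/10) / 4 * (C * length_ratio L) powr (- alpha_approx L)"
  have cpos: "c > 0" using C big by (simp add: c_def)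
  have "exp (c * real n powr (alpha0 - \<epsilon>)) \<le> real (growth Grigorchuk grig_gens n)" if n: "n \<ge> 1"
    for n
  proof -
    have "c * real n powr (alpha0 - \<epsilon>) \<le> c * real n powr alpha_approx L"
      using n L(2) cpos by (intro mult_left_mono powr_mono) auto
    also have "\<dots> = ln (11/10) / 4 * (real n / (C * length_ratio L)) powr alpha_approx L"
      using n C big by (simp add: c_def powr_divide powr_minus field_simps)
    finally have le: "c * real n powr (alpha0 - \<epsilon>)
      \<le> ln (11/10) / 4 * (real n / (C * length_ratio L)) powr alpha_approx L" .
    show ?thesis
    proof (cases "real n < C * length_ratio L")
      case True
      then have "(real n / (C * length_ratio L)) powr alpha_approx L \<le> 1 powr alpha_approx L"
        using n C big alpha_approx_pos[of L] by (intro powr_mono2) auto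
      then have "ln (11/10) / 4 * (real n / (C * length_ratio L)) powr alpha_approx L
        \<le> ln (11/10 :: real) / 4 * 1"
        by (intro mult_left_mono) auto
      also have "\<dots> \<le> ln 2"
        using ln_mono[of "11/10 :: real" 2] ln_ge_zero[of "11/10 :: real"] by linarith
      finally have "exp (c * real n powr (alpha0 - \<epsilon>)) \<le> exp (ln 2)" using le by (simp del: exp_ln)
      then show ?thesis using growth_ge_2[OF n] by simp
    next
      case False
      have ex: "\<exists>k. real n < C * length_ratio L ^ k"
      proof -
        obtain k where "real n / C < length_ratio L ^ k" using real_arch_pow[OF big] by blast
        then show ?thesis using C by (intro exI[of _ k]) (simp add: field_simps)
      qed
      define k where "k = (LEAST k. real n < C * length_ratio L ^ k)"
      have k: "real n < C * length_ratio L ^ k" unfolding k_def using ex by (rule LeastI_ex)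
      have "k \<noteq> 0" 
      proof
        assume "k = 0"
        then have "real n < C * 1" using k by simp
        also have "C * 1 \<le> C * length_ratio L" using C big by (intro mult_left_mono) auto
        finally show False using False by simp
      qed
      moreover have "k \<noteq> 1" using k False by auto
      ultimately obtain m where m: "k = Suc m" "m \<ge> 1" by (cases k) auto
      have m1: "C * length_ratio L ^ m \<le> real n"
        using not_less_Least[of m "\<lambda>k. real n < C * length_ratio L ^
          k"] m(1) unfolding k_def[symmetric] by simp
      have "4 \<le> (3 * L + 1) * m" using L(1) m(2) mult_mono[of 4 "3 * L + 1" 1 m] by simp
      then obtain r where r: "(3 * L + 1) * m = 4 + r" using le_Suc_ex by blast
      define M where "M = 4 * (2::nat) ^ r"
      have M: "4 * M = 2 ^ ((3 * L + 1) * m)" "M \<ge> 2" unfolding r M_def by (simp_all add: power_add)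
      have "real (4 * M) = (2 ^ (3 * L + 1)) ^ m" unfolding M(1)
        by (simp only: power_mult of_nat_power of_nat_numeral)
      also have "\<dots> = (length_ratio L ^ m) powr alpha_approx L"
        unfolding length_ratio_powr[symmetric] using big
        by (simp add: powr_powr powr_realpow[symmetric] mult.commute)
      finally have Meq: "real (4 * M) = (length_ratio L ^ m) powr alpha_approx L" .
      have "(real n / (C * length_ratio L)) powr alpha_approx L
        \<le> (length_ratio L ^ m) powr alpha_approx L"
        using k C big alpha_approx_pos[of L] unfolding m(1)
          by (intro powr_mono2) (auto simp: field_simps)
      then have "ln (11/10) / 4 * (real n / (C * length_ratio L)) powr alpha_approx L
        \<le> ln (11/10) / 4 * real (4 * M)"
        unfolding Meq by (intro mult_left_mono) auto
      then have "c * real n powr (alpha0 - \<epsilon>) \<le> ln (11/10) / 4 * real (4 * M)"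
        using le by (rule order_trans[rotated])
      also have "\<dots> = real M * ln (11/10)" by simp
      finally have "exp (c * real n powr (alpha0 - \<epsilon>)) \<le> exp (real M * ln (11/10))"
        by (simp only: exp_le_cancel_iff)
      also have "\<dots> = (11/10) ^ M" by (simp add: exp_of_nat_mult)
      also have "\<dots> \<le> real (growth Grigorchuk grig_gens n)"
        using m1 by (intro growth_at_scale[OF L(1) M]) (simp add: C_def)
      finally show ?thesis .
    qed
  qed
  then show ?thesis using cpos by blast
qed

section \<open>Germs along the ray\<close>

lemma tendsto_integral_pmf:
  fixes f :: "nat \<Rightarrow> 'a \<Rightarrow> real"
  assumes "\<And>x. x \<in> set_pmf p \<Longrightarrow> (\<lambda>n. f n x) \<longlonglongrightarrow> g x" "\<And>n x. \<bar>f n x\<bar> \<le> B"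
  shows "(\<lambda>n. \<integral>x. f n x \<partial>measure_pmf p) \<longlonglongrightarrow> (\<integral>x. g x \<partial>measure_pmf p)"
  by (rule integral_dominated_convergence[where w = "\<lambda>_. B"])
    (use assms in \<open>auto simp: AE_measure_pmf_iff\<close>)

lemma tendsto_pr:
  assumes "\<And>x. x \<in> set_pmf p \<Longrightarrow> \<forall>\<^sub>F n in sequentially. Q n x \<longleftrightarrow> R x"
  shows "(\<lambda>n. pr p (Q n)) \<longlonglongrightarrow> pr p R"
proof -
  have "(\<lambda>n. \<integral>x. (indicator {x. Q n x} x :: real) \<partial>measure_pmf p)
    \<longlonglongrightarrow> (\<integral>x. indicator {x. R x} x \<partial>measure_pmf p)"
  proof (rule tendsto_integral_pmf[where f = "\<lambda>n. indicator {x. Q n x}" and g = "indicator {x. R x}"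
    and B = 1])
    fix x assume "x \<in> set_pmf p"
    from assms[OF this] show "(\<lambda>n. indicator {x. Q n x} x :: real) \<longlonglongrightarrow> indicator {x. R x} x"
      by (intro tendsto_eventually) (auto elim!: eventually_mono simp: indicator_def)
  qed (auto simp: indicator_def)
  then show ?thesis by simp
qed

lemma letter_map_not_ones:
  "u \<noteq> replicate (length u) True \<Longrightarrow> letter_map l (u @ True # y) = letter_map l (u @ [True]) @ y"
proof (induction u arbitrary: l)
  case (Cons i u)
  have LA: "letter_map LA (z @ True # y) = letter_map LA (z @ [True]) @ y" for z
    by (cases z) (auto simp: grig_a_simps)
  show ?case
  proof (cases i)
    case True
    then have "u \<noteq> replicate (length u) True" using Cons.prems by auto
    note IH = Cons.IH[OF this]
    show ?thesis using True IH[of LB] IH[of LC] IH[of LD] by (cases l) (simp_all add: grig_a_simps)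
  next
    case False
    then show ?thesis using LA[of u] by (cases l) (simp_all add: grig_a_simps)
  qed
qed simp

lemma letter_map_ones: "l \<noteq> LA \<Longrightarrow> \<exists>l'. l' \<noteq> LA
  \<and> (\<forall>y. letter_map l (replicate m True @ y) = replicate m True @ letter_map l' y)"
proof (induction m arbitrary: l)
  case 0
  then show ?case by auto
next
  case (Suc m)
  let ?l = "case l of LB \<Rightarrow> LC | LC \<Rightarrow> LD | _ \<Rightarrow> LB"
  have "?l \<noteq> LA" "\<And>y. letter_map l (True # y) = True # letter_map ?l y" using Suc.prems
    by (cases l; simp)+
  then show ?case using Suc.IH[of ?l] by (metis append_Cons replicate_Suc)
qed

text \<open>
  The possible germs along the ray \<open>1\<^sup>\<infinity>\<close>.
\<close>

definition germ_words :: "letter list set" where "germ_words = {[], [LB], [LC], [LD]}"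

lemma germ_words_mult: "s \<in> germ_words \<Longrightarrow> l \<noteq> LA \<Longrightarrow> \<exists>s'\<in>germ_words. \<forall>v. letter_map l (word_map s v)
  = word_map s' v"
proof -
  assume s: "s \<in> germ_words" and l: "l \<noteq> LA"
  have "(\<forall>v. letter_map l (word_map s v) = word_map [] v)
    \<or> (\<forall>v. letter_map l (word_map s v) = word_map [LB] v) \<or>
      (\<forall>v. letter_map l (word_map s v) = word_map [LC] v) \<or> (\<forall>v. letter_map l (word_map s v) = word_map [LD] v)"
    using s l unfolding germ_words_def by (cases l) (auto simp: klein_four grig_involution)
  then show ?thesis unfolding germ_words_def by blast
qed

lemma germ_words_Cons: "s \<in> germ_words \<Longrightarrow> \<exists>s'\<in>germ_words. \<forall>v. word_map s (True # v) = True
  # word_map s' v"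
  unfolding germ_words_def by auto

text \<open>
  Deep enough on the ray \<open>1\<^sup>\<infinity>\<close> every section of a group element is trivial or one of \<open>b\<close>, \<open>c\<close>, \<open>d\<close>. A
  further letter either acts on the image of the ray vertex by one of these as well, or the image has left
  the ray and, one level below, the letter has trivial section there.
\<close>

lemma germ_exists:
  "\<exists>m\<ge>1. \<exists>s\<in>germ_words. \<forall>v. word_map w (replicate m True @ v)
    = word_map w (replicate m True) @ word_map s v"
proof (induction w rule: rev_induct)
  case Nil
  show ?case by (intro exI[of _ 1] conjI bexI[of _ "[]"]) (auto simp: germ_words_def)
next
  case (snoc l w)
  then obtain m s where m: "m \<ge> 1" "s \<in> germ_words"
    and eq: "\<And>v. word_map w (replicate m True @ v) = word_map w (replicate m True) @ word_map s v"
      by blast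
  obtain s1 where s1: "s1 \<in> germ_words" "\<And>v. word_map s (True # v) = True # word_map s1 v"
    using germ_words_Cons[OF m(2)] by blast
  let ?u = "word_map w (replicate m True)"
  have lenu: "length ?u = m" by simp
  have rep: "replicate (Suc m) True @ v = replicate m True @ True # v" for v :: "bool list"
    by (simp add: replicate_app_Cons_same)
  have eq1: "word_map w (replicate (Suc m) True @ v) = ?u @ True # word_map s1 v" for v
    unfolding rep eq s1(2) ..
  have Nil: "word_map r [] = []" for r by (induction r) (simp_all del: letter_map.simps)
  have eq2: "word_map w (replicate (Suc m) True) = ?u @ [True]"
    using eq1[of "[]"] Nil by (simp only: append_Nil2)
  show ?case
  proof (cases "l \<noteq> LA \<and> ?u = replicate m True")
    case True
    obtain l' where l': "l' \<noteq> LA"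
      "\<And>y. letter_map l (replicate (Suc m) True @ y) = replicate (Suc m) True @ letter_map l' y"
      using letter_map_ones True by blast
    obtain s2 where s2: "s2 \<in> germ_words" "\<And>v. letter_map l' (word_map s1 v) = word_map s2 v"
      using germ_words_mult[OF s1(1) l'(1)] by blast
    have "word_map (w @ [l]) (replicate (Suc m) True @ v) = replicate (Suc m) True @ word_map s2 v"
      for v
    proof -
      have "word_map (w @ [l]) (replicate (Suc m) True @ v)
        = letter_map l (replicate m True @ True # word_map s1 v)"
        using True eq1[of v] by (simp del: replicate_Suc letter_map.simps)
      also have "\<dots> = replicate (Suc m) True @ word_map s2 v"
        unfolding rep[symmetric] l'(2) s2(2) ..
      finally show ?thesis .
    qed
    note h = this
    have "word_map (w @ [l]) (replicate (Suc m) True) = replicate (Suc m) True"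
      using h[of "[]"] by (simp only: append_Nil2 Nil)
    then show ?thesis using h s2(1)
      by (intro exI[of _ "Suc m"] conjI bexI[of _ s2]) (auto simp del: replicate_Suc)
  next
    case False
    have h: "letter_map l (?u @ True # y) = letter_map l (?u @ [True]) @ y" for y
    proof (cases "l = LA")
      case True
      then show ?thesis using lenu m(1) by (cases ?u) (auto simp: grig_a_simps)
    next
      case l: False
      then show ?thesis using False lenu by (intro letter_map_not_ones) auto
    qed
    have "word_map (w @ [l]) (replicate (Suc m) True @ v)
      = word_map (w @ [l]) (replicate (Suc m) True) @ word_map s1 v" for v
      using h[of "word_map s1 v"] eq1[of v] eq2 by (simp del: replicate_Suc letter_map.simps)
    then show ?thesis using s1(1) by (intro exI[of _ "Suc m"] conjI bexI[of _ s1]) auto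
  qed
qed

text \<open>
  The germ is fixed and the level varies in steps of 3, the period of the letters.
\<close>

lemma active_ray_vertex_eventually:
  "\<exists>k0 b. \<forall>k\<ge>k0. active w (ray_vertex (3 * k)) = b"
proof -
  obtain m s where m: "m \<ge> 1" "s \<in> germ_words"
    and eq: "\<And>v. word_map w (replicate m True @ v) = word_map w (replicate m True) @ word_map s v"
    using germ_exists by blast
  have act: "active w (replicate m True @ v) = active s v" for v
    using word_map_snoc[of w "replicate m True @ v" True] eq[of "v @
      [True]"] eq[of v] word_map_snoc[of s v True] by auto
  have base: "ray_vertex K = replicate m True @ ray_vertex (K - m)" if "m < K" for K
  proof -
    have "K - 1 = m + (K - m - 1)" using that by simp
    then show ?thesis unfolding ray_vertex_def by (metis append.assoc replicate_add)
  qed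
  \<comment> \<open>the activity of \<open>b\<close>, \<open>c\<close>, \<open>d\<close> at \<open>1\<dots>10\<close> has period 3 in the level\<close>
  have per: "active s (ray_vertex (n + 3 + 1)) = active s (ray_vertex (n + 1))" for n
  proof -
    have len: "length (ray_vertex (n + 1)) = Suc n" "length (ray_vertex (n + 3 + 1)) = Suc (n + 3)"
      by simp_all
    have "active s' (ray_vertex (n + 3 + 1)) = active s' (ray_vertex (n + 1))"
      if "s' = [] \<or> s' = [LB] \<or> s' = [LC] \<or> s' = [LD]" for s'
      using that letter_active_iff[OF len(1)] letter_active_iff[OF len(2)] mod_add_self2[of n 3]
        by (auto simp: ray_vertex_def)
    then show ?thesis using m(2) by (auto simp: germ_words_def)
  qed
  have step: "active w (ray_vertex (3 * Suc k)) = active w (ray_vertex (3 * k))" if "m < 3 * k"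
    for k
  proof -
    define n where "n = 3 * k - m - 1"
    have "3 * k - m = n + 1" "3 * Suc k - m = n + 3 + 1" using that by (simp_all add: n_def)
    moreover have "m < 3 * Suc k" using that by simp
    ultimately show ?thesis using base[OF that] base[of "3 * Suc k"] act per[of n] by simp
  qed
  have "active w (ray_vertex (3 * k)) = active w (ray_vertex (3 * (m + 1)))" if "m + 1 \<le> k" for k
    using that
  proof (induction k rule: dec_induct)
    case (step k)
    have "m < 3 * k" using step.hyps by simp
    then show ?case using step.IH \<open>\<And>k. m < 3 * k \<Longrightarrow> active w (ray_vertex (3 * Suc k)) = active w
      (ray_vertex (3 * k))\<close> by metis
  qed simp
  then show ?thesis by blast
qed

text \<open>
  The lamp at infinity, defined on the group and not on words because the harmonic function lives on
  the group.
\<close>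

definition germ_bit :: "(bool list \<Rightarrow> bool list) \<Rightarrow> bool" where
  "germ_bit g \<longleftrightarrow> (\<forall>\<^sub>F k in sequentially. last (g (ray_vertex (3 * k) @ [False])))"

lemma germ_bit_eventually: "\<forall>\<^sub>F k in sequentially. active w (ray_vertex (3 * k))
  \<longleftrightarrow> germ_bit (word_map w)"
proof -
  obtain k0 b where b: "\<forall>k\<ge>k0. active w (ray_vertex (3 * k)) = b" using active_ray_vertex_eventually
    by blast
  have last: "last (word_map w (ray_vertex (3 * k) @ [False])) = active w (ray_vertex (3 * k))"
    for k by (simp add: word_map_snoc)
  have ev: "\<forall>\<^sub>F k in sequentially. active w (ray_vertex (3 * k)) = b"
    using b unfolding eventually_sequentially by blast
  have "germ_bit (word_map w) \<longleftrightarrow> b"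
    unfolding germ_bit_def last
  proof
    assume "\<forall>\<^sub>F k in sequentially. active w (ray_vertex (3 * k))"
    with ev have "\<forall>\<^sub>F k in sequentially. b" by eventually_elim simp
    then show b by simp
  next
    assume b
    with ev show "\<forall>\<^sub>F k in sequentially. active w (ray_vertex (3 * k))" by simp
  qed
  with ev show ?thesis by simp
qed

lemma germ_bit_eventually':
  "\<forall>\<^sub>F \<nu> in sequentially. active w (ray_vertex (3 * (L + 1) * \<nu>)) \<longleftrightarrow> germ_bit (word_map w)"
proof -
  have "filterlim (\<lambda>\<nu>. (L + 1) * \<nu>) sequentially sequentially"
    by (intro filterlim_subseq strict_monoI) (simp only: mult_less_cancel1, simp)
  from eventually_compose_filterlim[OF germ_bit_eventually this] show ?thesis
    by (simp only: mult.assoc)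
qed

text \<open>
  The letter \<open>c\<close> fixes the ray vertices and is active there.
\<close>

lemma germ_bit_c_mult: "germ_bit (word_map (LC # w)) \<longleftrightarrow> \<not> germ_bit (word_map w)"
proof -
  have "\<forall>\<^sub>F k in sequentially. active (LC # w) (ray_vertex (3 * k))
    \<longleftrightarrow> \<not> active w (ray_vertex (3 * k))"
    using eventually_gt_at_top[of 0]
  proof eventually_elim
    case (elim k)
    have K: "3 dvd 3 * k" "3 * k > 0" using elim by auto
    have "letter_active LC (ray_vertex (3 * k))"
      using letter_active_level(3)[OF K length_ray_vertex[OF K(2)]] by simp
    moreover have "letter_map LC (ray_vertex (3 * k)) = ray_vertex (3 * k)"
      by (intro letter_map_ray_vertex K) simp
    ultimately show ?case by simp
  qed
  with germ_bit_eventually[of w] germ_bit_eventually[of "LC # w"]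
  have "\<forall>\<^sub>F k :: nat in sequentially. germ_bit (word_map (LC # w)) \<longleftrightarrow> \<not> germ_bit (word_map w)"
    by eventually_elim simp
  then show ?thesis by simp
qed

section \<open>A bounded harmonic function\<close>

definition sample_law :: "nat \<Rightarrow> letter list pmf" where
  "sample_law L = step_law L (3 * L + 10) (return_pmf [])"

text \<open>
  The probability that the lamp at infinity is on, for the walk started at \<open>x\<close>.
\<close>

definition germ_prob :: "nat \<Rightarrow> nat \<Rightarrow> letter list \<Rightarrow> real" where
  "germ_prob L t x = pr (walk (sample_law L) t) (\<lambda>w. germ_bit (word_map (x @ w)))"

text \<open>
  The estimate on finite levels is uniform in the level except for a summand that vanishes in the limit.
\<close>

lemma sum_germ_prob:
  "(\<Sum>t<N. \<bar>germ_prob L (Suc t) x - germ_prob L t x\<bar>) \<le> 3 / 256"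
proof -
  let ?F = "\<lambda>\<nu> t. pr (walk (sample_law L) t) (\<lambda>w. active (x @ w) (ray_vertex (3 * (L + 1) * \<nu>)))"
  let ?j = "3 * L + 10"
  have lim: "(\<lambda>\<nu>. ?F \<nu> t) \<longlonglongrightarrow> germ_prob L t x" for t
    unfolding germ_prob_def by (intro tendsto_pr germ_bit_eventually')
  have "(\<lambda>\<nu>. spread_ratio L ^ \<nu>) \<longlonglongrightarrow> 0" using spread_ratio_bounds[of L]
    by (intro LIMSEQ_realpow_zero) auto
  then have rhs: "(\<lambda>\<nu>. 3 * (real N * spread_ratio L ^ \<nu> + 2 ^ (3 * L + 2) * (1/2) ^ ?j)) \<longlonglongrightarrow>
      3 * (real N * 0 + 2 ^ (3 * L + 2) * (1/2) ^ ?j)"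
    by (intro tendsto_mult tendsto_add tendsto_const)
  have "(\<Sum>t<N. \<bar>germ_prob L (Suc t) x - germ_prob L t x\<bar>)
    \<le> 3 * (real N * 0 + 2 ^ (3 * L + 2) * (1/2) ^ ?j)"
  proof (rule LIMSEQ_le[OF _ rhs])
    show "(\<lambda>\<nu>. \<Sum>t<N. \<bar>?F \<nu> (Suc t) - ?F \<nu> t\<bar>) \<longlonglongrightarrow> (\<Sum>t<N. \<bar>germ_prob L (Suc t) x - germ_prob L t x\<bar>)"
      by (intro tendsto_intros lim)
    show "\<exists>n0. \<forall>\<nu>\<ge>n0. (\<Sum>t<N. \<bar>?F \<nu> (Suc t) - ?F \<nu> t\<bar>)
      \<le> 3 * (real N * spread_ratio L ^ \<nu> + 2 ^ (3 * L + 2) * (1/2) ^ ?j)"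
    proof (intro exI[of _ "(3 * L + 2) * ?j + 1"] allI impI)
      fix \<nu> assume "\<nu> \<ge> (3 * L + 2) * ?j + 1"
      then have \<nu>: "(3 * L + 2) * ?j \<le> \<nu>" "0 < \<nu>" by auto
      let ?b = "ray_vertex (3 * (L + 1) * \<nu>)"
      let ?v = "word_map x ?b"
      have v: "length ?v = 3 * (L + 1) * \<nu>" using \<nu>(2) by simp
      have F: "?F \<nu> t = (if active x ?b then 1 - pr (walk (sample_law L) t) (\<lambda>w. active w ?v) else
        pr (walk (sample_law L) t) (\<lambda>w. active w ?v))" for t
        using measure_pmf.prob_compl[of "{w. active w ?v}" "walk (sample_law L) t"]
        by (simp add: active_append Compl_eq_Diff_UNIV[symmetric] Collect_neg_eq[symmetric])
      have "\<bar>?F \<nu> (Suc t) - ?F \<nu> t\<bar>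
          = \<bar>pr (walk (sample_law L) (Suc t)) (\<lambda>w. active w ?v) - pr (walk (sample_law L) t) (\<lambda>w. active w ?v)\<bar>" for t
        unfolding F by (cases "active x ?b") (simp_all del: walk.simps)
      then have "(\<Sum>t<N. \<bar>?F \<nu> (Suc t) - ?F \<nu> t\<bar>)
          = (\<Sum>t<N. \<bar>pr (walk (sample_law L) (Suc t)) (\<lambda>w. active w ?v) - pr (walk (sample_law L) t) (\<lambda>w. active w ?v)\<bar>)"
        by (simp only:)
      also have "\<dots> \<le> 3 * (real N * spread_ratio L ^ \<nu> + 2 ^ (3 * L + 2) * (1/2) ^ ?j)"
        unfolding sample_law_def by (intro walk_active_sum \<nu> v) (simp add: active_set_def)
      finally show "(\<Sum>t<N. \<bar>?F \<nu> (Suc t) - ?F \<nu> t\<bar>)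
        \<le> 3 * (real N * spread_ratio L ^ \<nu> + 2 ^ (3 * L + 2) * (1/2) ^ ?j)" .
    qed
  qed
  also have "3 * (real N * 0 + 2 ^ (3 * L + 2) * (1/2) ^ ?j) = 3 / 256"
    by (simp add: power_add power_one_over field_simps)
  finally show ?thesis .
qed

text \<open>
  The increments are absolutely summable, since the expected number of lamp changes is finite.
\<close>

lemma convergent_germ_prob: "(\<lambda>t. germ_prob L t x) \<longlonglongrightarrow> lim (\<lambda>t. germ_prob L t x)"
proof -
  have "summable (\<lambda>t. \<bar>germ_prob L (Suc t) x - germ_prob L t x\<bar>)"
    by (intro summableI_nonneg_bounded[where x = "3/256"] sum_germ_prob) simp
  then have "summable (\<lambda>t. germ_prob L (Suc t) x - germ_prob L t x)" by (rule summable_rabs_cancel)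
  then obtain s where "(\<lambda>N. \<Sum>t<N. germ_prob L (Suc t) x - germ_prob L t x) \<longlonglongrightarrow> s"
    by (auto simp: summable_def sums_def)
  then have "(\<lambda>N. germ_prob L N x - germ_prob L 0 x) \<longlonglongrightarrow> s"
    unfolding sum_lessThan_telescope[of "\<lambda>t. germ_prob L t x"] .
  then have "(\<lambda>N. germ_prob L N x - germ_prob L 0 x + germ_prob L 0 x) \<longlonglongrightarrow> s + germ_prob L 0 x"
    by (intro tendsto_intros)
  then have "convergent (\<lambda>t. germ_prob L t x)" by (auto simp: convergent_def)
  then show ?thesis by (simp add: convergent_LIMSEQ_iff)
qed

text \<open>
  The value off the group is a dummy, which keeps the function bounded everywhere.
\<close>

definition germ_limit :: "nat \<Rightarrow> (bool list \<Rightarrow> bool list) \<Rightarrow> real" where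
  "germ_limit L g = (if g \<in> range word_map then lim
    (\<lambda>t. pr (walk (sample_law L) t) (\<lambda>w. germ_bit (word_map w \<circ> g))) else 0)"

lemma germ_limit_word_map: "(\<lambda>t. germ_prob L t x) \<longlonglongrightarrow> germ_limit L (word_map x)"
proof -
  have "word_map w \<circ> word_map x = word_map (x @ w)" for w by (simp add: word_map_append_comp)
  then show ?thesis using convergent_germ_prob[of L x] by (simp add: germ_limit_def germ_prob_def)
qed

lemma germ_prob_bounds: "0 \<le> germ_prob L t x" "germ_prob L t x \<le> 1"
  by (simp_all add: germ_prob_def)

lemma germ_limit_bounds: "0 \<le> germ_limit L g" "germ_limit L g \<le> 1"
proof -
  have "0 \<le> germ_limit L (word_map x)" "germ_limit L (word_map x) \<le> 1" for x
    by (rule LIMSEQ_le_const[OF germ_limit_word_map] LIMSEQ_le_const2[OF germ_limit_word_map], simp add: germ_prob_bounds)+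
  moreover have "g \<in> range word_map \<or> germ_limit L g = 0" by (simp add: germ_limit_def)
  ultimately show "0 \<le> germ_limit L g" "germ_limit L g \<le> 1" by auto
qed

text \<open>
  Condition on the first step and let the number of steps tend to infinity.
\<close>

lemma germ_limit_mean: "germ_limit L (word_map x)
  = (\<integral>y. germ_limit L (word_map (x @ y)) \<partial>measure_pmf (sample_law L))"
proof -
  have "germ_prob L (Suc t) x = (\<integral>y. germ_prob L t (x @ y) \<partial>measure_pmf (sample_law L))" for t
    unfolding germ_prob_def walk_Suc' cat_pmf_def pr_bind pr_map by simp
  moreover have "(\<lambda>t. \<integral>y. germ_prob L t (x @ y) \<partial>measure_pmf (sample_law L))
      \<longlonglongrightarrow> (\<integral>y. germ_limit L (word_map (x @ y)) \<partial>measure_pmf (sample_law L))"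
    by (rule tendsto_integral_pmf[where B = 1]) (auto intro: germ_limit_word_map simp: germ_prob_bounds)
  moreover have "(\<lambda>t. germ_prob L (Suc t) x) \<longlonglongrightarrow> germ_limit L (word_map x)"
    using germ_limit_word_map by (rule LIMSEQ_Suc)
  ultimately show ?thesis using LIMSEQ_unique by (simp only:) blast
qed

lemma germ_limit_id: "germ_limit L (word_map []) \<le> 3 / 256"
proof (rule LIMSEQ_le_const2[OF germ_limit_word_map])
  have "\<not> germ_bit (word_map [])"
    using germ_bit_c_mult[of "[]"] germ_bit_eventually[of "[]"] by auto
  then have 0: "germ_prob L 0 [] = 0" by (simp add: germ_prob_def)
  have "germ_prob L t [] \<le> 3 / 256" for t
  proof -
    have "germ_prob L t [] = (\<Sum>s<t. germ_prob L (Suc s) [] - germ_prob L s [])"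
      using sum_lessThan_telescope[of "\<lambda>s. germ_prob L s []" t] 0 by linarith
    also have "\<dots> \<le> (\<Sum>s<t. \<bar>germ_prob L (Suc s) [] - germ_prob L s []\<bar>)" by (intro sum_mono) simp
    also note sum_germ_prob
    finally show ?thesis .
  qed
  then show "\<exists>n0. \<forall>t\<ge>n0. germ_prob L t [] \<le> 3 / 256" by blast
qed

lemma germ_limit_c: "germ_limit L (word_map [LC]) = 1 - germ_limit L (word_map [])"
proof -
  have "germ_prob L t [LC] = 1 - germ_prob L t []" for t
    unfolding germ_prob_def append_Cons append_Nil germ_bit_c_mult
    using measure_pmf.prob_compl[of "{w. germ_bit (word_map w)}" "walk (sample_law L) t"]
    by (simp add: Compl_eq_Diff_UNIV[symmetric] Collect_neg_eq[symmetric])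
  then have "(\<lambda>t. germ_prob L t [LC]) \<longlonglongrightarrow> 1 - germ_limit L (word_map [])"
    using tendsto_diff[OF tendsto_const germ_limit_word_map[of L "[]"], of 1] by simp
  then show ?thesis using germ_limit_word_map LIMSEQ_unique by blast
qed

text \<open>
  Harmonicity is phrased with unordered sums, the arguments above with integrals.
\<close>

lemma has_sum_expectation:
  fixes h :: "'a \<Rightarrow> real"
  assumes "\<And>y. \<bar>h y\<bar> \<le> 1" "set_pmf p \<subseteq> A"
  shows "((\<lambda>y. h y * pmf p y) has_sum (\<integral>y. h y \<partial>measure_pmf p)) A"
proof -
  let ?f = "\<lambda>y. pmf p y * h y"
  have s: "Infinite_Set_Sum.abs_summable_on ?f UNIV"
    by (rule abs_summable_on_comparison_test[OF pmf_abs_summable[of p UNIV]])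
      (use assms(1) in \<open>auto simp: abs_mult intro!: mult_left_le\<close>)
  then have "?f summable_on UNIV"
    using abs_summable_equivalent abs_summable_summable by blast
  then have "(?f has_sum infsum ?f UNIV) UNIV" by (rule has_sum_infsum)
  also have "infsum ?f UNIV = (\<integral>y. h y \<partial>measure_pmf p)"
    using infsetsum_infsum[OF s] by (simp add: pmf_expectation_eq_infsetsum)
  finally have "(?f has_sum (\<integral>y. h y \<partial>measure_pmf p)) UNIV" .
  moreover have "(?f has_sum s) UNIV \<longleftrightarrow> ((\<lambda>y. h y * pmf p y) has_sum s) A" for s
    using assms(2) by (intro has_sum_cong_neutral) (auto simp: set_pmf_iff)
  ultimately show ?thesis by blast
qed

text \<open>
  The measure whose existence is claimed, up to the choice of \<open>L\<close>.
\<close>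

definition grig_measure :: "nat \<Rightarrow> (bool list \<Rightarrow> bool list) pmf"
  where "grig_measure L = map_pmf word_map (sample_law L)"

lemma set_grig_measure: "set_pmf (grig_measure L) \<subseteq> carrier Grigorchuk"
  by (auto simp: grig_measure_def carrier_eq_range_word_map)

lemma boundary_grig_measure: "nontrivial_Poisson_boundary Grigorchuk (grig_measure L)"
  unfolding nontrivial_Poisson_boundary_def
proof (intro exI[of _ "germ_limit L"] conjI)
  show "harmonic Grigorchuk (grig_measure L) (germ_limit L)"
    unfolding harmonic_def
  proof
    fix x assume "x \<in> carrier Grigorchuk"
    then obtain u where u: "x = word_map u" by (auto simp: carrier_eq_range_word_map)
    have "((\<lambda>y. germ_limit L (mult Grigorchuk x y) * pmf (grig_measure L) y) has_sum
        (\<integral>y. germ_limit L (mult Grigorchuk x y) \<partial>measure_pmf (grig_measure L))) (carrier Grigorchuk)"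
      by (intro has_sum_expectation set_grig_measure)
        (use germ_limit_bounds in \<open>auto simp: abs_le_iff intro: order_trans[of _ 0]\<close>)
    also have "(\<integral>y. germ_limit L (mult Grigorchuk x y) \<partial>measure_pmf (grig_measure L))
      = germ_limit L x"
      unfolding u germ_limit_mean[of L u] grig_measure_def by (simp add: word_map_append_comp)
    finally show "((\<lambda>y. germ_limit L (mult Grigorchuk x y) * pmf (grig_measure L) y) has_sum
      germ_limit L x) (carrier Grigorchuk)" .
  qed
  show "bounded (germ_limit L ` carrier Grigorchuk)"
    using germ_limit_bounds by (intro boundedI[of _ 1]) (auto simp: abs_le_iff intro: order_trans[of _ 0])
  show "\<not> germ_limit L constant_on carrier Grigorchuk"
  proof
    assume "germ_limit L constant_on carrier Grigorchuk"
    then have "germ_limit L (word_map [LC]) = germ_limit L (word_map [])"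
      by (auto simp: constant_on_def carrier_eq_range_word_map)
    then show False using germ_limit_c[of L] germ_limit_id[of L] by simp
  qed
qed

section \<open>Support and symmetry of the measure\<close>

lemma Nil_in_flip_cube: "[] \<in> set_pmf (flip_cube J M)"
  by (induction M) (auto simp: set_cat_pmf set_flip_cube_step)

text \<open>
  Take scale 0 and empty clean factors.
\<close>

lemma letter_in_sample_law: "[l] \<in> set_pmf (sample_law L)"
proof -
  have c: "[] \<in> set_pmf (clean_pmf M)" for M
    by (simp add: clean_pmf_def set_symmetrize Nil_in_flip_cube)
  have "l \<in> {LA, LB, LC, LD}" by (cases l) auto
  then have "[l] \<in> set_pmf (scale_pmf L 0)" by (auto simp: scale_pmf_def)
  then have "[] @ [l] @ [] \<in> set_pmf (scale_step L (3 * L + 10) (return_pmf []) 0)"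
    unfolding scale_step_def cat_pmf_Nil set_cat_pmf using c by blast
  moreover have "0 \<in> set_pmf (scale_law L)"
    using pmf_scale_law[of L 0] scale_ratio_bounds[of L] by (simp add: set_pmf_iff)
  ultimately show ?thesis unfolding sample_law_def step_law_def set_bind_pmf by auto
qed

lemma nondegenerate_grig_measure: "nondegenerate Grigorchuk (grig_measure L)"
  unfolding nondegenerate_def
proof (intro equalityI subsetI)
  fix g assume "g \<in> {foldr (mult Grigorchuk) ws (one Grigorchuk) | ws. ws \<noteq> []
    \<and> set ws \<subseteq> set_pmf (grig_measure L)}"
  then obtain ws where ws: "g = foldr (mult Grigorchuk) ws (one Grigorchuk)"
    "set ws \<subseteq> range word_map"
    using set_grig_measure[of L] carrier_eq_range_word_map by blast
  have "foldr (mult Grigorchuk) ws (one Grigorchuk) \<in> range word_map" using ws(2)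
  proof (induction ws)
    case Nil
    have "id = word_map []" by auto
    then show ?case unfolding foldr.simps one_Grigorchuk id_apply by (rule range_eqI)
  next
    case (Cons x ws)
    have "foldr (mult Grigorchuk) ws (one Grigorchuk) \<in> range word_map" using Cons.IH Cons.prems
      by (simp only: set_simps insert_subset)
    then obtain w where "foldr (mult Grigorchuk) ws (one Grigorchuk) = word_map w" by (rule rangeE)
    moreover obtain u where "x = word_map u" using Cons.prems by auto
    ultimately have "foldr (mult Grigorchuk) (x # ws) (one Grigorchuk) = word_map (u @ w)"
      by (simp add: word_map_append_comp)
    then show ?case by (rule range_eqI)
  qed
  then show "g \<in> carrier Grigorchuk" by (simp add: ws(1) carrier_eq_range_word_map)
next
  fix g assume "g \<in> carrier Grigorchuk"
  then obtain w where w: "g = word_map w" by (auto simp: carrier_eq_range_word_map)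
  have mem: "set (map letter_map w) \<subseteq> set_pmf (grig_measure L)" for w
  proof -
    have "letter_map l \<in> set_pmf (grig_measure L)" for l
      using letter_in_sample_law[of l L]
        unfolding grig_measure_def set_map_pmf word_map_single[symmetric] by (rule imageI)
    then show ?thesis by auto
  qed
  have "\<exists>w'. w' \<noteq> [] \<and> g = word_map w'"
  proof (cases "w = []")
    case True
    \<comment> \<open>the identity needs a non-empty word\<close>
    have "word_map [] = word_map [LA, LA]" by (auto simp: grig_involution)
    then show ?thesis unfolding w True by blast
  qed (use w in blast)
  then obtain w' where "w' \<noteq> []" "g = foldr (mult Grigorchuk) (map letter_map w') (one Grigorchuk)"
    unfolding foldr_letter_map by blast
  then show "g \<in> {foldr (mult Grigorchuk) ws (one Grigorchuk) | ws. ws \<noteq> []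
    \<and> set ws \<subseteq> set_pmf (grig_measure L)}"
    using mem[of w'] by blast
qed

text \<open>
  A step reads \<open>h s h'\<close> with \<open>h\<close> and \<open>h'\<close> independent of the same law, and all three laws are invariant
  under reversal.
\<close>

lemma map_rev_sample_law: "map_pmf rev (sample_law L) = sample_law L"
proof -
  have "map_pmf rev (clean_pmf M) = clean_pmf M" for M
    by (simp add: clean_pmf_def map_rev_symmetrize)
  moreover have "map_pmf rev (scale_pmf L n) = scale_pmf L n" for n
    by (simp add: scale_pmf_def map_rev_symmetrize map_pmf_comp)
  ultimately have "map_pmf rev (scale_step L j (return_pmf []) n)
    = scale_step L j (return_pmf []) n" for n j
    by (simp add: scale_step_def map_rev_cat_pmf cat_pmf_assoc)
  then show ?thesis by (simp add: sample_law_def step_law_def map_bind_pmf)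
qed

lemma symmetric_grig_measure: "symmetric_measure Grigorchuk (grig_measure L)"
  unfolding symmetric_measure_def
proof
  fix g assume "g \<in> carrier Grigorchuk"
  then obtain u where u: "g = word_map u" by (auto simp: carrier_eq_range_word_map)
  have pmf: "pmf (grig_measure L) h = pr (sample_law L) (\<lambda>w. word_map w = h)" for h
    by (simp add: grig_measure_def pmf_map vimage_def)
  have "word_map (rev w) = word_map (rev u) \<longleftrightarrow> word_map w = word_map u" for w
    by (metis word_map_rev_word_map word_map_word_map_rev ext)
  then have "pr (map_pmf rev (sample_law L)) (\<lambda>w. word_map w = word_map (rev u))
    = pr (sample_law L) (\<lambda>w. word_map w = word_map u)"
    unfolding pr_map by (simp only:)
  then show "pmf (grig_measure L) g = pmf (grig_measure L) (inv\<^bsub>Grigorchuk\<^esub> g)"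
    by (simp add: u inv_word_map pmf map_rev_sample_law)
qed

section \<open>Tail of the measure\<close>

lemma length_ratio_gt_1: "1 < length_ratio L"
  using length_ratio_ge[of L] one_less_power[of "2 :: real" "3 * L + 3"] by linarith

text \<open>
  This identity turns the probability of a scale into a power of its length.
\<close>

lemma scale_ratio_powr: "scale_ratio L ^ n = (length_ratio L ^ n) powr (- alpha_approx L)"
proof -
  have "scale_ratio L = length_ratio L powr (- alpha_approx L)"
    unfolding powr_minus length_ratio_powr scale_ratio_def
      by (simp add: power_one_over inverse_eq_divide)
  then show ?thesis using length_ratio_gt_1[of L]
    by (simp add: powr_powr powr_realpow[symmetric] mult.commute)
qed

text \<open>
  A word of length \<open>r\<close> requires a scale at least logarithmic in \<open>r\<close>, and scales have geometric tails.
\<close>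

lemma tail_grig_measure:
  assumes "r \<ge> 1"
  shows "measure_pmf.prob (grig_measure L)
    {g \<in> carrier Grigorchuk. r \<le> real (word_length Grigorchuk grig_gens g)}
    \<le> length_const L (3 * L + 10) powr alpha_approx L * r powr (- alpha_approx L)"
proof -
  let ?j = "3 * L + 10"
  let ?C = "length_const L ?j"
  have ex: "\<exists>k. r \<le> ?C * length_ratio L ^ k"
  proof -
    obtain k where "r / ?C < length_ratio L ^ k" using real_arch_pow[OF length_ratio_gt_1] by blast
    then show ?thesis using length_const_pos[of L ?j] by (intro exI[of _ k]) (simp add: field_simps)
  qed
  \<comment> \<open>the smallest scale whose steps can have length \<open>r\<close>\<close>
  define k where "k = (LEAST k. r \<le> ?C * length_ratio L ^ k)"
  have k: "r \<le> ?C * length_ratio L ^ k" unfolding k_def using ex by (rule LeastI_ex)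
  have least: "k \<le> n" if "r \<le> ?C * length_ratio L ^ n" for n unfolding k_def using that
    by (rule Least_le)
  have "measure_pmf.prob (grig_measure L)
    {g \<in> carrier Grigorchuk. r \<le> real (word_length Grigorchuk grig_gens g)}
      = pr (sample_law L) (\<lambda>w. r \<le> real (word_length Grigorchuk grig_gens (word_map w)))"
    by (simp add: grig_measure_def vimage_def carrier_eq_range_word_map)
  also have "\<dots> \<le> pr (sample_law L) (\<lambda>w. r \<le> real (length w))"
    using word_length_le by (intro pr_mono) (meson of_nat_le_iff order_trans)
  also have "\<dots> \<le> (\<integral>n. indicator {n. k \<le> n} n \<partial>measure_pmf (scale_law L))"
    unfolding sample_law_def step_law_def
  proof (rule pr_bind_le_integral)
    fix n
    show "pr (scale_step L ?j (return_pmf []) n) (\<lambda>w. r \<le> real (length w)) \<le> indicator {n. k \<le> n} n"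
    proof (cases "k \<le> n")
      case False
      then have "\<not> r \<le> ?C * length_ratio L ^ n" using least by blast
      then have "\<not> r \<le> real (length w)" if "w \<in> set_pmf (scale_step L ?j (return_pmf []) n)" for w
        using length_scale_step[OF that] by linarith
      then have "pr (scale_step L ?j (return_pmf []) n) (\<lambda>w. r \<le> real (length w))
        \<le> pr (scale_step L ?j (return_pmf []) n) (\<lambda>w. False)"
        by (intro pr_mono) auto
      then show ?thesis using False by simp
    qed simp
  qed (auto intro!: integrable_pmf_bounded[where B = 1] simp: indicator_def)
  also have "\<dots> = pr (scale_law L) (\<lambda>n. k \<le> n)" by simp
  also have "\<dots> = scale_ratio L ^ k"
  proof (cases k)
    case (Suc i)
    have "pr (scale_law L) (\<lambda>n. k \<le> n) = 1 - pr (scale_law L) (\<lambda>n. n \<le> i)"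
      using measure_pmf.prob_compl[of "{n. n \<le> i}" "scale_law L"]
      by (simp add: Compl_eq_Diff_UNIV[symmetric] Collect_neg_eq[symmetric] not_le Suc Suc_le_eq)
    then show ?thesis by (simp only: pr_scale_law_le Suc) simp
  qed simp
  also have "\<dots> \<le> (r / ?C) powr (- alpha_approx L)"
    unfolding scale_ratio_powr using k assms length_const_pos[of L ?j] alpha_approx_pos[of L]
    by (intro powr_mono2') (auto simp: field_simps)
  also have "\<dots> = ?C powr alpha_approx L * r powr (- alpha_approx L)"
    using assms length_const_pos[of L ?j] by (simp add: powr_divide powr_minus field_simps)
  finally show ?thesis .
qed

section \<open>Entropy of the measure\<close>

lemma finite_card_flip_cube: "finite (set_pmf (flip_cube J M)) \<and> card (set_pmf (flip_cube J M))
  \<le> 2 ^ M"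
proof (induction M)
  case (Suc M)
  let ?A = "(\<lambda>u. u @ flip_word M) ` set_pmf (flip_cube J M) \<union> set_pmf (flip_cube J M)"
  have sub: "set_pmf (flip_cube J (Suc M)) \<subseteq> ?A"
    by (auto simp: set_cat_pmf set_flip_cube_step)
  have fin: "finite ?A" using Suc by simp
  have "finite (set_pmf (flip_cube J (Suc M)))" "card (set_pmf (flip_cube J (Suc M))) \<le> card ?A"
    by (rule finite_subset[OF sub fin], rule card_mono[OF fin sub])
  moreover have "card ?A \<le> card ((\<lambda>u. u @ flip_word M) ` set_pmf (flip_cube J M))
    + card (set_pmf (flip_cube J M))"
    by (rule card_Un_le)
  moreover have "card ((\<lambda>u. u @ flip_word M) ` set_pmf (flip_cube J M))
    \<le> card (set_pmf (flip_cube J M))"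
    using Suc by (intro card_image_le) simp
  ultimately show ?case using Suc by simp
qed simp

lemma finite_card_symmetrize:
  assumes "finite (set_pmf p)" "card (set_pmf p) \<le> c"
  shows "finite (set_pmf (symmetrize p)) \<and> card (set_pmf (symmetrize p)) \<le> 2 * c"
  unfolding set_symmetrize using assms card_Un_le[of "set_pmf p"
    "rev ` set_pmf p"] card_image_le[of "set_pmf p" rev]
  by auto

lemma finite_card_cat_pmf:
  assumes "finite (set_pmf p)" "card (set_pmf p) \<le> c" "finite (set_pmf q)" "card (set_pmf q) \<le> d"
  shows "finite (set_pmf (cat_pmf p q)) \<and> card (set_pmf (cat_pmf p q)) \<le> c * d"
proof -
  have eq: "set_pmf (cat_pmf p q) = (\<lambda>(u, w). u @ w) ` (set_pmf p \<times> set_pmf q)"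
    by (auto simp: set_cat_pmf)
  have "card (set_pmf (cat_pmf p q)) \<le> card (set_pmf p \<times> set_pmf q)"
    unfolding eq using assms by (intro card_image_le) auto
  also have "\<dots> \<le> c * d" using assms by (simp add: card_cartesian_product mult_mono)
  finally show ?thesis unfolding eq using assms by auto
qed

text \<open>
  The group elements that a step of scale \<open>n\<close> can produce; their number is exponential in \<open>n\<close>.
\<close>

definition scale_support :: "nat \<Rightarrow> nat \<Rightarrow> (bool list \<Rightarrow> bool list) set" where
  "scale_support L n = word_map ` set_pmf (scale_step L (3 * L + 10) (return_pmf []) n)"

definition support_ratio :: "nat \<Rightarrow> real" where "support_ratio L = 2 ^ (3 * (L + 1))"

lemma card_scale_support: "\<exists>D. \<forall>n. finite (scale_support L n) \<and> real (card (scale_support L n))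
  \<le> D * support_ratio L ^ n"
proof -
  let ?M = "(3 * L + 2) * (3 * L + 10)"
  let ?c = "2 * 2 ^ (3 * ?M) :: nat"
  have H: "finite (set_pmf (clean_pmf ?M))" "card (set_pmf (clean_pmf ?M)) \<le> ?c"
    unfolding clean_pmf_def using finite_card_flip_cube finite_card_symmetrize by blast+
  have C: "finite (set_pmf (scale_pmf L n)) \<and> card (set_pmf (scale_pmf L n))
    \<le> 4 * 2 ^ (3 * (L + 1) * n)" for n
  proof (cases "n = 0")
    case True
    have "card ((\<lambda>l. [l]) ` {LA, LB, LC, LD}) \<le> card {LA, LB, LC, LD}" by (intro card_image_le) simp
    then show ?thesis using True by (simp add: scale_pmf_def)
  next
    case False
    have "finite (set_pmf (scale_pmf L n)) \<and> card (set_pmf (scale_pmf L n))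
      \<le> 2 * 2 ^ (3 * (L + 1) * n)"
      unfolding scale_pmf_def using False finite_card_flip_cube finite_card_symmetrize
        by (simp only: if_False) blast
    then show ?thesis by auto
  qed
  have S: "finite (set_pmf (scale_step L (3 * L + 10) (return_pmf []) n)) \<and>
      card (set_pmf (scale_step L (3 * L + 10) (return_pmf []) n)) \<le> ?c * (4 * 2 ^ (3 * (L + 1) * n) * ?c)" for n
    unfolding scale_step_def cat_pmf_Nil
    using finite_card_cat_pmf[OF H] finite_card_cat_pmf[OF _ _ H] C[of n] by blast
  show ?thesis
  proof (intro exI[of _ "real (?c * (4 * ?c))"] allI conjI)
    fix n
    show "finite (scale_support L n)" using S[of n] by (simp add: scale_support_def)
    have "card (scale_support L n) \<le> ?c * (4 * 2 ^ (3 * (L + 1) * n) * ?c)"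
      unfolding scale_support_def using S[of n] card_image_le order_trans by blast
    then have "real (card (scale_support L n)) \<le> real (?c * (4 * 2 ^ (3 * (L + 1) * n) * ?c))"
      by (simp only: of_nat_le_iff)
    also have "\<dots> = real (?c * (4 * ?c)) * support_ratio L ^ n"
      by (simp add: support_ratio_def power_mult[symmetric] del: mult_Suc_right)
    finally show "real (card (scale_support L n)) \<le> real (?c * (4 * ?c)) * support_ratio L ^ n" .
  qed
qed

text \<open>
  Gibbs' inequality for a single term; the summand \<open>q\<close> makes up for the missing summation.
\<close>

lemma gibbs: "0 < p \<Longrightarrow> 0 < q \<Longrightarrow> - (p * ln p) \<le> p * (- ln q) + (q :: real)"
proof -
  assume p: "0 < p" and q: "0 < q"
  have "p * ln (q / p) \<le> p * (q / p - 1)"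
    using p q by (intro mult_left_mono ln_le_minus_one) auto
  also have "\<dots> \<le> q" using p by (simp add: field_simps)
  finally show ?thesis using p q by (simp add: ln_div algebra_simps)
qed

text \<open>
  Compare the measure with weights \<open>b\<close> to the power \<open>-n\<close>, where \<open>n\<close> is the least scale that produces
  the element. As the supports grow exponentially these weights are summable for large \<open>b\<close>, and the cross
  entropy is bounded by the expected scale. Since all terms are non-negative, it is enough to bound
  finite partial sums.
\<close>

lemma entropy_grig_measure:
  assumes L: "L \<ge> 1"
  shows "shannon_entropy Grigorchuk (grig_measure L) < \<infinity>"
proof -
  obtain D where D: "\<And>n. finite (scale_support L n)"
    "\<And>n. real (card (scale_support L n)) \<le> D * support_ratio L ^ n"
    using card_scale_support by blast
  have D0: "D \<ge> 0" using D(2)[of 0]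
    by (simp add: order_trans[of 0 "real (card (scale_support L 0))"])
  define b where "b = 2 * support_ratio L"
  have sB: "support_ratio L \<ge> 1" by (simp add: support_ratio_def one_le_power)
  have b: "b > 1" using sB by (simp add: b_def)
  have supp: "set_pmf (grig_measure L) = (\<Union>n\<in>set_pmf (scale_law L). scale_support L n)"
    by (auto simp: grig_measure_def sample_law_def step_law_def scale_support_def)
  define lev where "lev g = (LEAST n. g \<in> scale_support L n)" for g
  have lev: "g \<in> scale_support L (lev g)" if "g \<in> set_pmf (grig_measure L)" for g
    using that unfolding supp lev_def by (auto intro: LeastI)
  define E where "E = ln b * ((1 - scale_ratio L) / (1 - 2 * scale_ratio L)) + 2 * D"
  have om: "2 * scale_ratio L < 1"
  proof -
    have "scale_ratio L \<le> (1/2) ^ 4" unfolding scale_ratio_def using L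
      by (intro power_decreasing) auto
    then show ?thesis by (simp add: power_one_over)
  qed
  have mean: "(\<integral>g. real (lev g) * indicator F g \<partial>measure_pmf (grig_measure L))
    \<le> (1 - scale_ratio L) / (1 - 2 * scale_ratio L)"
    if F: "finite F" for F
  proof -
    have "ennreal (\<integral>g. real (lev g) * indicator F g \<partial>measure_pmf (grig_measure L))
        = (\<integral>\<^sup>+g. ennreal (real (lev g) * indicator F g) \<partial>measure_pmf (grig_measure L))"
    proof (intro nn_integral_eq_integral[symmetric])
      show "integrable (measure_pmf (grig_measure L)) (\<lambda>g. real (lev g) * indicator F g)"
        by (rule integrable_pmf_bounded[where B = "\<Sum>g\<in>F. real (lev g)"])
          (auto simp: indicator_def F intro!: sum_nonneg member_le_sum)
    qed auto
    also have "\<dots> \<le> (\<integral>\<^sup>+g. ennreal (real (lev g)) \<partial>measure_pmf (grig_measure L))"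
      by (intro nn_integral_mono ennreal_leI) (auto simp: indicator_def)
    also have "\<dots> = (\<integral>\<^sup>+n. \<integral>\<^sup>+w. ennreal (real (lev (word_map w))) \<partial>measure_pmf
      (scale_step L (3 * L + 10) (return_pmf []) n)
        \<partial>measure_pmf (scale_law L))"
      by (simp add: grig_measure_def sample_law_def step_law_def)
    also have "\<dots> \<le> (\<integral>\<^sup>+n. ennreal (2 ^ n) \<partial>measure_pmf (scale_law L))"
    proof (intro nn_integral_mono)
      fix n
      have "lev (word_map w) \<le> n" if "w \<in> set_pmf (scale_step L (3 * L + 10) (return_pmf []) n)"
        for w
        unfolding lev_def using that by (intro Least_le) (simp add: scale_support_def)
      then have "(\<integral>\<^sup>+w. ennreal (real (lev (word_map w))) \<partial>measure_pmf
        (scale_step L (3 * L + 10) (return_pmf []) n))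
          \<le> (\<integral>\<^sup>+w. ennreal (real n) \<partial>measure_pmf (scale_step L (3 * L + 10) (return_pmf []) n))"
        by (intro nn_integral_mono_AE) (auto simp: AE_measure_pmf_iff intro!: ennreal_leI)
      also have "\<dots> \<le> ennreal (2 ^ n)" using of_nat_less_two_power[of n, where 'a = real]
        by (simp add: ennreal_leI)
      finally show "(\<integral>\<^sup>+w. ennreal (real (lev (word_map w))) \<partial>measure_pmf
        (scale_step L (3 * L + 10) (return_pmf []) n))
          \<le> ennreal (2 ^ n)" .
    qed
    also have "\<dots> = ennreal ((1 - scale_ratio L) / (1 - 2 * scale_ratio L))"
    proof (rule nn_integral_scale_law)
      have "(\<lambda>n. (1 - scale_ratio L) * (2 * scale_ratio L) ^ n) sums
        ((1 - scale_ratio L) * (1 / (1 - 2 * scale_ratio L)))"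
        using om scale_ratio_bounds[of L] by (intro sums_mult geometric_sums) auto
      then show "(\<lambda>n. (1 - scale_ratio L) * scale_ratio L ^ n * 2 ^ n) sums
        ((1 - scale_ratio L) / (1 - 2 * scale_ratio L))"
        by (simp add: power_mult_distrib mult_ac)
    qed simp
    finally show ?thesis using om scale_ratio_bounds[of L] by (simp add: ennreal_le_iff)
  qed
  have partial: "(\<Sum>g\<in>F. ennreal (- (pmf (grig_measure L) g * ln (pmf (grig_measure L) g))))
    \<le> ennreal E"
    if F: "finite F" "F \<subseteq> carrier Grigorchuk" for F
  proof -
    let ?S = "set_pmf (grig_measure L)"
    let ?q = "\<lambda>g. (1 / b) ^ lev g"
    have nonneg: "0 \<le> - (pmf (grig_measure L) g * ln (pmf (grig_measure L) g))" for g
      by (cases "pmf (grig_measure L) g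
        = 0") (auto simp: mult_nonneg_nonpos pmf_le_1 ln_le_zero_iff pmf_pos order_le_neq_trans)
    have "(\<Sum>g\<in>F. - (pmf (grig_measure L) g * ln (pmf (grig_measure L) g)))
      = (\<Sum>g\<in>F \<inter> ?S. - (pmf (grig_measure L) g * ln (pmf (grig_measure L) g)))"
      using F(1) by (intro sum.mono_neutral_right) (auto simp: set_pmf_iff)
    also have "\<dots> \<le> (\<Sum>g\<in>F \<inter> ?S. pmf (grig_measure L) g * (ln b * real (lev g)) + ?q g)"
    proof (intro sum_mono)
      fix g assume "g \<in> F \<inter> ?S"
      then have "0 < pmf (grig_measure L) g" by (simp add: pmf_positive)
      from gibbs[OF this, of "?q g"] b show "-
        (pmf (grig_measure L) g * ln (pmf (grig_measure L) g)) \<le> pmf (grig_measure L) g * (ln b * real (lev g)) + ?q g"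
        by (simp add: ln_realpow ln_div mult_ac)
    qed
    also have "\<dots> = ln b * (\<Sum>g\<in>F \<inter> ?S. pmf (grig_measure L) g * real (lev g)) + (\<Sum>g\<in>F \<inter> ?S. ?q g)"
      by (simp add: sum.distrib sum_distrib_left mult_ac)
    also have "(\<Sum>g\<in>F \<inter> ?S. pmf (grig_measure L) g * real (lev g))
      = (\<integral>g. real (lev g) * indicator (F \<inter> ?S) g \<partial>measure_pmf (grig_measure L))"
      using F(1) by (subst integral_measure_pmf_real[where A = "F \<inter>
        ?S"]) (auto simp: indicator_def mult_ac)
    also have "\<dots> \<le> (1 - scale_ratio L) / (1 - 2 * scale_ratio L)" using F(1) by (intro mean) auto
    also have "(\<Sum>g\<in>F \<inter> ?S. ?q g) \<le> 2 * D"
    proof -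
      obtain N where N: "\<And>g. g \<in> F \<inter> ?S \<Longrightarrow> lev g < N"
        using finite_nat_bounded[of "lev ` (F \<inter> ?S)"] F(1) by blast
      have fin: "finite (scale_support L n)" for n by (rule D(1))
      have "(\<Sum>g\<in>F \<inter> ?S. ?q g) = (\<Sum>n<N. \<Sum>g\<in>{g \<in> F \<inter> ?S. lev g = n}. ?q g)"
        using F(1) N by (intro sum.group[symmetric]) auto
      also have "\<dots> \<le> (\<Sum>n<N. D * (1/2) ^ n)"
      proof (intro sum_mono)
        fix n
        have "(\<Sum>g\<in>{g \<in> F \<inter> ?S. lev g = n}. ?q g)
          = real (card {g \<in> F \<inter> ?S. lev g = n}) * (1 / b) ^ n" by simp
        also have "\<dots> \<le> real (card (scale_support L n)) * (1 / b) ^ n"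
          using lev b by (intro mult_right_mono of_nat_mono card_mono fin) auto
        also have "\<dots> \<le> D * support_ratio L ^ n * (1 / b) ^ n"
          using D(2)[of n] b by (intro mult_right_mono) auto
        also have "\<dots> = D * (1/2) ^ n"
          using sB by (simp add: b_def power_mult_distrib power_divide)
        finally show "(\<Sum>g\<in>{g \<in> F \<inter> ?S. lev g = n}. ?q g) \<le> D * (1/2) ^ n" .
      qed
      also have "\<dots> = D * (\<Sum>n<N. (1/2) ^ n)" by (simp add: sum_distrib_left)
      also have "\<dots> \<le> D * 2"
      proof (intro mult_left_mono D0)
        have "(\<Sum>n<N. (1/2 :: real) ^ n) = 2 - 2 * (1/2) ^ N" by (induction N) auto
        then show "(\<Sum>n<N. (1/2 :: real) ^ n) \<le> 2" by simp
      qed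
      finally show ?thesis by simp
    qed
    finally have "(\<Sum>g\<in>F. - (pmf (grig_measure L) g * ln (pmf (grig_measure L) g))) \<le> E"
      using b by (simp add: E_def mult_left_mono)
    then show ?thesis using nonneg by (subst sum_ennreal) (auto intro: ennreal_leI)
  qed
  have "shannon_entropy Grigorchuk (grig_measure L) \<le> ennreal E"
    unfolding shannon_entropy_def by (subst nonneg_infsum_complete) (auto intro!: SUP_least partial)
  then show ?thesis using le_less_trans ennreal_less_top by fastforce
qed

theorem theorem1:
  shows "(\<forall>\<epsilon>::real. \<epsilon> > 0 \<longrightarrow>
            (\<exists>C>0. \<exists>\<mu>. set_pmf \<mu> \<subseteq> carrier Grigorchuk
               \<and> nondegenerate Grigorchuk \<mu>
               \<and> symmetric_measure Grigorchuk \<mu>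
               \<and> shannon_entropy Grigorchuk \<mu> < \<infinity>
               \<and> nontrivial_Poisson_boundary Grigorchuk \<mu>
               \<and> (\<forall>r::real. r \<ge> 1 \<longrightarrow>
                    measure_pmf.prob \<mu> {g \<in> carrier Grigorchuk.
                        r \<le> real (word_length Grigorchuk grig_gens g)}
                      \<le> C * r powr (- alpha0 + \<epsilon>))))
       \<and> (\<forall>\<epsilon>::real. \<epsilon> > 0 \<longrightarrow>
            (\<exists>c>0. \<forall>n::nat. n \<ge> 1 \<longrightarrow>
               real (growth Grigorchuk grig_gens n) \<ge> exp (c * real n powr (alpha0 - \<epsilon>))))"
proof (intro conjI allI impI)
  fix \<epsilon> :: real assume "\<epsilon> > 0"
  then obtain L where L: "L \<ge> 1" "alpha0 - \<epsilon> \<le> alpha_approx L" using exists_alpha_approx by blast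
  let ?C = "length_const L (3 * L + 10) powr alpha_approx L"
  have C: "?C > 0" using length_const_pos[of L "3 * L + 10"] by simp
  have "measure_pmf.prob (grig_measure L)
    {g \<in> carrier Grigorchuk. r \<le> real (word_length Grigorchuk grig_gens g)}
      \<le> ?C * r powr (- alpha0 + \<epsilon>)" if "r \<ge> 1" for r
  proof -
    have "r powr (- alpha_approx L) \<le> r powr (- alpha0 + \<epsilon>)" using that L(2)
      by (intro powr_mono) auto
    then have "?C * r powr (- alpha_approx L) \<le> ?C * r powr (- alpha0 + \<epsilon>)"
      by (intro mult_left_mono) auto
    with tail_grig_measure[OF that, of L] show ?thesis by (rule order_trans)
  qed
  with C set_grig_measure nondegenerate_grig_measure symmetric_grig_measure
    entropy_grig_measure[OF L(1)] boundary_grig_measure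
  show "\<exists>C>0. \<exists>\<mu>. set_pmf \<mu> \<subseteq> carrier Grigorchuk
               \<and> nondegenerate Grigorchuk \<mu>
               \<and> symmetric_measure Grigorchuk \<mu>
               \<and> shannon_entropy Grigorchuk \<mu> < \<infinity>
               \<and> nontrivial_Poisson_boundary Grigorchuk \<mu>
               \<and> (\<forall>r::real. r \<ge> 1 \<longrightarrow>
                    measure_pmf.prob \<mu> {g \<in> carrier Grigorchuk.
                        r \<le> real (word_length Grigorchuk grig_gens g)}
                      \<le> C * r powr (- alpha0 + \<epsilon>))"
    by blast
qed (rule growth_lower_bound)

end
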